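(* Fix $z$ with $0<|z|<1$. Let $\mathbf K_z^{(1)}|_{\frac x2,\frac\tau2}$ denote the flat-initial-condition operator $\mathbf K_z^{(1)}$ with parameters $(x,\tau)$ replaced by $(\frac x2,\frac\tau2)$, and let $\mathsf R(\tau,x)=(X_1)_{21}$ and $\mathsf Q(\tau,x)=(X_1)_{11}$ be the entries, at $\gamma=0$, of the matrix $X_1$ defined in the context. Then, for $(\tau,x)$, $\tau>0$, $x\in\mathbb R$, where $X_1$ is defined, $$\partial_x\log\det\left(\mathbf I-\mathbf K_z^{(1)}|_{\frac x2,\frac\tau2}\right)=\tfrac12\mathsf R(\tau,x)+\tfrac12\mathsf Q(\tau,x).$$ The function $\mathsf R$ satisfies the (defocusing) mKdV equation $$3\mathsf R_\tau+\mathsf R_{xxx}-6\mathsf R^2\mathsf R_x=0,\qquad\text{and}\qquad \mathsf Q_x=-\mathsf R^2 .$$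
   Context: Roots and logarithms are principal. $\mathrm{Li}_s(z)=\sum_{k\ge1}z^k/k^s$ for $|z|<1$, continued analytically to $\mathbb C\setminus[1,\infty)$. For $0<|z|<1$, $\mathcal S_-=\{\xi\in\mathbb C:e^{-\xi^2/2}=z,\ \mathrm{Re}\,\xi<0\}$, $\mathcal S_+=-\mathcal S_-$, $\mathcal S=\mathcal S_+\cup\mathcal S_-$. The set $\mathcal S_-$ lies in the sector $3\pi/4<\arg\xi<5\pi/4$; in that sector $Q(\xi)=\sqrt{2/\pi}\int_{-\infty}^\xi\mathrm{Li}_{1/2}(e^{-s^2/2})\,ds$ (path in the sector) and $\Psi(\xi;x,\tau)=-\frac13\tau\xi^3+x\xi-\frac12Q(\xi)$. $\mathbf K^{(1)}_z$ is the operator on $\ell^2(\mathcal S_-)$ with kernel $\frac{e^{\Psi(\xi_1)+\Psi(\xi_2)}}{\xi_1(\xi_1+\xi_2)}$ (conjugate to the kernel $-\frac{e^{\Psi(\xi_1)+\Psi(\xi_2)}}{\sqrt{-\xi_1}\sqrt{-\xi_2}(\xi_1+\xi_2)}$, with the same Fredholm determinant); it arises in the limiting one-point distribution of the periodic TASEP with flat initial condition. Let $V(u)=-\frac\tau3u^3+xu$ (the case $\gamma=0$ of $-\frac\tau3u^3+\frac\gamma2u^2+xu$). Define vector functions on $\mathcal S$: for $u\in\mathcal S_+$, $\vec f(u)=\left(\frac{e^{-\frac12V(u)-\frac12Q(-u)}}{\sqrt u},0\right)^T$ and $\vec g(u)=\left(0,\frac{e^{-\frac12V(u)-\frac12Q(-u)}}{\sqrt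 u}\right)^T$; for $u\in\mathcal S_-$, $\vec f(u)=\left(0,\frac{e^{\frac12V(u)-\frac12Q(u)}}{\sqrt{-u}}\right)^T$ and $\vec g(u)=\left(-\frac{e^{\frac12V(u)-\frac12Q(u)}}{\sqrt{-u}},0\right)^T$. Let $\mathbf H$ be the trace class operator on $\ell^2(\mathcal S)$ with kernel $\frac{\vec f(u)^T\vec g(v)}{u-v}$ for $u\ne v$ and $0$ for $u=v$. Whenever $\det(\mathbf I-\mathbf H)\neq0$, there is a unique $2\times2$ matrix function $X(s)$, analytic off $\mathcal S$, with a simple pole at each $\xi\in\mathcal S$ satisfying $\mathrm{Res}_{s=\xi}X(s)=\lim_{s\to\xi}X(s)\vec f(\xi)\vec g(\xi)^T$, and with an expansion $X(s)\sim I+X_1s^{-1}+\cdots$ as $s\to\infty$ uniformly away from $\mathcal S$. This defines the $2\times2$ matrix $X_1$; equivalently $X_1=\sum_{s\in\mathcal S}\vec F(s)\vec g(s)^T$ with $\vec F=(\mathbf I-\mathbf H)^{-1}\vec f$ (componentwise).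
   Formalization: The sign of R in the first identity is corrected: with the stated f, g, H and R=(X_1)_{21}, the x-derivative of log det(I−K) equals −R/2+Q/2, not R/2+Q/2. The printed sign fails wherever R≠0, e.g. for 0<z<1 and large x. The mKdV equation and Q_x=−R² are as printed. *)

theory Defs
  imports "HOL-Analysis.Analysis" "Jordan_Normal_Form.Determinant"
begin

no_notation vec_index (infixl \<open>$\<close> 100)

section \<open>Kernels on a discrete set\<close>

text \<open>
  A kernel \<open>K\<close> on a set \<open>A\<close> of complex numbers acts on \<open>\<ell>\<^sup>2(A)\<close> by
  \<open>(K f) u = (\<Sum>v\<in>A. K u v * f v)\<close>. Elements of \<open>\<ell>\<^sup>2(A)\<close> are represented by
  functions that vanish outside \<open>A\<close>.
\<close>

definition ell2 :: "complex set \<Rightarrow> (complex \<Rightarrow> complex) set" where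
  "ell2 A = {f. (\<forall>u. u \<notin> A \<longrightarrow> f u = 0) \<and> (\<lambda>u. (cmod (f u))\<^sup>2) summable_on A}"

definition kernel_op ::
  "complex set \<Rightarrow> (complex \<Rightarrow> complex \<Rightarrow> complex) \<Rightarrow> (complex \<Rightarrow> complex) \<Rightarrow> complex \<Rightarrow> complex" where
  "kernel_op A K f u = (\<Sum>\<^sub>\<infinity>v\<in>A. K u v * f v)"

text \<open>
  The Fredholm determinant \<open>det(I - K)\<close> on \<open>\<ell>\<^sup>2(A)\<close>, given by its Fredholm series
  (with respect to counting measure); the inner sum ranges over all \<open>n\<close>-tuples in \<open>A\<close>.
\<close>

definition fredholm_det :: "complex set \<Rightarrow> (complex \<Rightarrow> complex \<Rightarrow> complex) \<Rightarrow> complex" where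
  "fredholm_det A K =
     (\<Sum>n. (- 1) ^ n / fact n *
        (\<Sum>\<^sub>\<infinity>p \<in> {..<n} \<rightarrow>\<^sub>E A. Determinant.det (Matrix.mat n n (\<lambda>(i, j). K (p i) (p j)))))"

text \<open>
  \<open>(I - K)\<^sup>-\<^sup>1 f\<close>, i.e. the unique \<open>F \<in> \<ell>\<^sup>2(A)\<close> with \<open>F - K F = f\<close> on \<open>A\<close>. It is only used
  when \<open>fredholm_det A K \<noteq> 0\<close>, where \<open>I - K\<close> is invertible.
\<close>

definition inv_one_minus ::
  "complex set \<Rightarrow> (complex \<Rightarrow> complex \<Rightarrow> complex) \<Rightarrow> (complex \<Rightarrow> complex) \<Rightarrow> complex \<Rightarrow> complex" where
  "inv_one_minus A K f = (THE F. F \<in> ell2 A \<and> (\<forall>u\<in>A. F u - kernel_op A K F u = f u))"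


section \<open>The discrete sets and the functions \<open>Q\<close> and \<open>\<Psi>\<close>\<close>

definition S_minus :: "complex \<Rightarrow> complex set" where
  "S_minus z = {\<xi>. exp (- \<xi>\<^sup>2 / 2) = z \<and> Re \<xi> < 0}"

definition S_plus :: "complex \<Rightarrow> complex set" where
  "S_plus z = uminus ` S_minus z"

definition S_all :: "complex \<Rightarrow> complex set" where
  "S_all z = S_plus z \<union> S_minus z"

text \<open>
  Only the values of the polylogarithm in the open unit disc are needed: for \<open>s\<close> in the sector
  \<open>3\<pi>/4 < arg s < 5\<pi>/4\<close> one has \<open>Re (s\<^sup>2) > 0\<close>, so \<open>\<bar>exp (- s\<^sup>2 / 2)\<bar> < 1\<close>.
\<close>

definition polylog :: "complex \<Rightarrow> complex \<Rightarrow> complex" where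
  "polylog s w = (\<Sum>k. w ^ Suc k / of_nat (Suc k) powr s)"

text \<open>
  The path from \<open>- \<infinity>\<close> to \<open>\<xi>\<close> is the horizontal half-line \<open>t \<mapsto> \<xi> + t\<close>, \<open>t \<le> 0\<close>, which stays in
  the sector when \<open>\<xi>\<close> is in the sector; the integrand is holomorphic there.
\<close>

definition Q_fun :: "complex \<Rightarrow> complex" where
  "Q_fun \<xi> = of_real (sqrt (2 / pi)) *
     integral {..0} (\<lambda>t::real. polylog (1 / 2) (exp (- (\<xi> + of_real t)\<^sup>2 / 2)))"

definition Psi :: "complex \<Rightarrow> real \<Rightarrow> real \<Rightarrow> complex" where
  "Psi \<xi> x \<tau> = - (1 / 3) * of_real \<tau> * \<xi> ^ 3 + of_real x * \<xi> - (1 / 2) * Q_fun \<xi>"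

text \<open>The kernel of the flat-initial-condition operator, acting on \<open>\<ell>\<^sup>2(S_minus z)\<close>.\<close>

definition K_flat :: "real \<Rightarrow> real \<Rightarrow> complex \<Rightarrow> complex \<Rightarrow> complex" where
  "K_flat x \<tau> \<xi>1 \<xi>2 = exp (Psi \<xi>1 x \<tau> + Psi \<xi>2 x \<tau>) / (\<xi>1 * (\<xi>1 + \<xi>2))"


section \<open>The operator \<open>H\<close> and the matrix \<open>X\<^sub>1\<close>\<close>

definition V_fun :: "real \<Rightarrow> real \<Rightarrow> complex \<Rightarrow> complex" where
  "V_fun \<tau> x u = - (of_real \<tau> / 3) * u ^ 3 + of_real x * u"

definition f_vec :: "complex \<Rightarrow> real \<Rightarrow> real \<Rightarrow> complex \<Rightarrow> complex ^ 2" where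
  "f_vec z \<tau> x u =
     (if u \<in> S_plus z
      then vector [exp (- (1 / 2) * V_fun \<tau> x u - (1 / 2) * Q_fun (- u)) / csqrt u, 0]
      else vector [0, exp ((1 / 2) * V_fun \<tau> x u - (1 / 2) * Q_fun u) / csqrt (- u)])"

definition g_vec :: "complex \<Rightarrow> real \<Rightarrow> real \<Rightarrow> complex \<Rightarrow> complex ^ 2" where
  "g_vec z \<tau> x u =
     (if u \<in> S_plus z
      then vector [0, exp (- (1 / 2) * V_fun \<tau> x u - (1 / 2) * Q_fun (- u)) / csqrt u]
      else vector [- exp ((1 / 2) * V_fun \<tau> x u - (1 / 2) * Q_fun u) / csqrt (- u), 0])"

definition H_ker :: "complex \<Rightarrow> real \<Rightarrow> real \<Rightarrow> complex \<Rightarrow> complex \<Rightarrow> complex" where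
  "H_ker z \<tau> x u v =
     (if u = v then 0 else (\<Sum>i\<in>UNIV. f_vec z \<tau> x u $ i * g_vec z \<tau> x v $ i) / (u - v))"

definition F_vec :: "complex \<Rightarrow> real \<Rightarrow> real \<Rightarrow> complex \<Rightarrow> complex ^ 2" where
  "F_vec z \<tau> x u =
     (\<chi> i. inv_one_minus (S_all z) (H_ker z \<tau> x) (\<lambda>v. f_vec z \<tau> x v $ i) u)"

text \<open>
  \<open>X\<^sub>1 = (\<Sum>s. F(s) g(s)\<^sup>T)\<close>: this is the coefficient of \<open>1/s\<close> at infinity of the solution
  \<open>X(s) = I + (\<Sum>v. F(v) g(v)\<^sup>T / (s - v))\<close> of the discrete Riemann-Hilbert problem with residue
  condition \<open>Res X(\<xi>) = lim X(s) f(\<xi>) g(\<xi>)\<^sup>T\<close>.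
\<close>

definition X1 :: "complex \<Rightarrow> real \<Rightarrow> real \<Rightarrow> complex ^ 2 ^ 2" where
  "X1 z \<tau> x = (\<chi> i j. \<Sum>\<^sub>\<infinity>s\<in>S_all z. F_vec z \<tau> x s $ i * g_vec z \<tau> x s $ j)"

definition X1_defined :: "complex \<Rightarrow> real \<Rightarrow> real \<Rightarrow> bool" where
  "X1_defined z \<tau> x \<longleftrightarrow> fredholm_det (S_all z) (H_ker z \<tau> x) \<noteq> 0"

text \<open>
  Sign of \<open>R_fun\<close>: under the reflection \<open>S_minus z = - S_plus z\<close> the kernel \<open>K_flat\<close> at
  \<open>(x/2, \<tau>/2)\<close> is conjugate to \<open>M(u,w) = h(u) h(w) / (u + w)\<close> on \<open>S_plus z\<close>, where \<open>h\<close> is the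
  nonzero entry of \<open>f_vec\<close>, and \<open>H\<close> has the off-diagonal blocks \<open>- M\<close>. With the present \<open>f\<close> and \<open>g\<close>
  this gives \<open>(X\<^sub>1)\<^sub>2\<^sub>1 = - (X\<^sub>1)\<^sub>1\<^sub>2 = - h\<^sup>T (I - M\<^sup>2)\<^sup>-\<^sup>1 h\<close> and \<open>(X\<^sub>1)\<^sub>1\<^sub>1 = h\<^sup>T M (I - M\<^sup>2)\<^sup>-\<^sup>1 h\<close>, while
  the \<open>x\<close>-derivative of \<open>log det(I - M)\<close> is \<open>1/2 h\<^sup>T (I - M)\<^sup>-\<^sup>1 h\<close>. So \<open>R_fun\<close> enters the formula
  for that derivative with coefficient \<open>- 1/2\<close> (coefficient \<open>+ 1/2\<close> would give \<open>log det(I + M)\<close>).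
\<close>

definition R_fun :: "complex \<Rightarrow> real \<Rightarrow> real \<Rightarrow> complex" where
  "R_fun z \<tau> x = X1 z \<tau> x $ 2 $ 1"

definition Q_entry :: "complex \<Rightarrow> real \<Rightarrow> real \<Rightarrow> complex" where
  "Q_entry z \<tau> x = X1 z \<tau> x $ 1 $ 1"


section \<open>Derivatives\<close>

text \<open>
  \<open>has_log_derivative D l x\<close>: near \<open>x\<close> there is a continuous branch \<open>L\<close> of \<open>log D\<close>, and
  \<open>L' x = l\<close>. The principal branch will not do, as \<open>D x\<close> is complex and may lie on its cut.
\<close>

definition has_log_derivative :: "(real \<Rightarrow> complex) \<Rightarrow> complex \<Rightarrow> real \<Rightarrow> bool" where
  "has_log_derivative D l x \<longleftrightarrow>
     (\<exists>L. \<exists>e>0. continuous_on (ball x e) L \<and> (\<forall>y\<in>ball x e. exp (L y) = D y) \<and>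
        (L has_vector_derivative l) (at x))"

definition partial_\<tau> :: "(real \<Rightarrow> real \<Rightarrow> complex) \<Rightarrow> real \<Rightarrow> real \<Rightarrow> complex" where
  "partial_\<tau> G \<tau> x = vector_derivative (\<lambda>t. G t x) (at \<tau>)"

definition partial_x :: "(real \<Rightarrow> real \<Rightarrow> complex) \<Rightarrow> real \<Rightarrow> real \<Rightarrow> complex" where
  "partial_x G \<tau> x = vector_derivative (\<lambda>y. G \<tau> y) (at x)"

end

(*
  On S_plus the operator K_flat is conjugate to M(u,v) = h(u) h(v) / (u + v), and H is block
  antidiagonal with blocks -M, so det(I - H) = D(-) D(+) with D(s) = det(I + s M), s = -1, 1.
  Cauchy's determinant turns D(s) into an absolutely convergent sum, over finite subsets J of S_plus,
  of products of exponentials: an infinite soliton tau function. Multiplying its terms by the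
  Blaschke products B_J(u) = prod_{v in J} (u - v) / (u + v) gives, by partial fractions, explicit
  solutions of (I + s M) a = h and the resolvent kernel; so F is given explicitly, and
    R = d/dx log (D(1) / D(-1)),   Q = d/dx log (D(1) D(-1)).
  (With T(k) = sum over J of the k-th power of the power sum p_1(J), the sign comes from
  d/dx T(k) = - T(k+1).) Since (u + v) M(u,v) = h(u) h(v) has rank one, evaluating the pairings
  of the two wave functions in two ways yields two Hirota bilinear equations for D(-1), D(1), and
  these are equivalent to Q_x = - R^2 and, after one more x-derivative, to mKdV.
*)
theory Submission
  imports Defs
begin

subsection \<open>Sums over finite subsets\<close>

text \<open>Everything is phrased through scalar series over finite subsets of
  \<open>S_plus z\<close>, so that no operator is ever differentiated: the dependence on x and
  \<tau> sits in one exponential per term, and a derivative only inserts a power sum. Convergence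
  has two sources. Points of \<open>S_plus z\<close> lie on the hyperbola Re(u)^2 - Im(u)^2 = -2
  ln|z|, where Re(u^3) tends to minus infinity like -2 Re(u)^3; for \<tau> > 0 this beats every
  polynomial weight. They also lie within 45 degrees of the real axis, which bounds every factor (u
  - v)/(u + v) by 1 and so every Cauchy determinant by the product of its diagonal.
  \<open>inv_one_minus\<close> is a definite description, so an explicit solution is of use only
  together with uniqueness in \<open>ell2\<close>; the explicit resolvent kernel supplies it. The
  second Hirota equation shapes the algebra. At second order the pairing of the two wave functions
  contains three unknown double sums and just three relations among them, so nothing follows. A
  further pairing, with the wave function weighted by -p_1 (the x-derivative at fixed argument),
  fixes one of the sums again, and the comparison is the equation.\<close>

lemma summable_on_norm_bound:
  fixes f :: "'a \<Rightarrow> 'b::banach"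
  assumes "b summable_on A" and "\<And>x. x \<in> A \<Longrightarrow> norm (f x) \<le> b x"
  shows "f summable_on A"
  by (rule abs_summable_summable, rule summable_on_comparison_test[OF assms(1)]) (use assms in auto)

lemma infsum_diff:
  fixes f h :: "'a \<Rightarrow> complex"
  assumes "f summable_on A" "h summable_on A"
  shows "infsum (\<lambda>x. f x - h x) A = infsum f A - infsum h A"
  using infsum_add[of f A "\<lambda>x. - h x"] assms by (simp add: infsum_uminus summable_on_uminus)

lemma summable_on_times_real:
  fixes a :: "'a \<Rightarrow> real" and b :: "'b \<Rightarrow> real"
  assumes "a summable_on A" "b summable_on B"
    and "\<And>x. x \<in> A \<Longrightarrow> 0 \<le> a x" "\<And>y. y \<in> B \<Longrightarrow> 0 \<le> b y"
  shows "(\<lambda>(x, y). a x * b y) summable_on A \<times> B"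
proof -
  have "(\<lambda>p. norm (a (fst p) * b (snd p))) summable_on A \<times> B"
    unfolding Infinite_Sum.abs_summable_on_Sigma_iff
  proof (intro conjI ballI)
    fix x assume "x \<in> A"
    have "(\<lambda>y. \<bar>a x\<bar> * b y) summable_on B"
      using assms(2) by (rule summable_on_cmult_right)
    then show "(\<lambda>y. norm (a (fst (x, y)) * b (snd (x, y)))) summable_on B"
      using assms(4) by (auto simp: abs_mult cong: summable_on_cong)
  next
    have "infsum (\<lambda>y. norm (a (fst (x, y)) * b (snd (x, y)))) B = a x * infsum b B" if "x \<in> A" for x
    proof -
      have "infsum (\<lambda>y. norm (a (fst (x, y)) * b (snd (x, y)))) B = infsum (\<lambda>y. a x * b y) B"
        using assms that by (intro infsum_cong) (auto simp: abs_mult)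
      then show ?thesis by (simp add: infsum_cmult_right')
    qed
    moreover have "(\<lambda>x. a x * infsum b B) summable_on A"
      using assms(1) by (rule summable_on_cmult_left)
    moreover have "0 \<le> infsum b B" using assms(4) by (rule infsum_nonneg)
    ultimately show "(\<lambda>x. norm (infsum (\<lambda>y. norm (a (fst (x, y)) * b (snd (x, y)))) B)) summable_on A"
      using assms(3) by (auto simp: abs_mult cong: summable_on_cong)
  qed
  then have "(\<lambda>p. a (fst p) * b (snd p)) summable_on A \<times> B"
    by (rule abs_summable_summable)
  then show ?thesis by (simp add: case_prod_unfold)
qed

lemma infsum_times_infsum:
  fixes a b :: "_ \<Rightarrow> complex"
  assumes "a summable_on A" "b summable_on B"
  shows "(\<lambda>(x, y). a x * b y) summable_on A \<times> B"
    and "infsum a A * infsum b B = infsum (\<lambda>(x, y). a x * b y) (A \<times> B)"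
proof -
  show s: "(\<lambda>(x, y). a x * b y) summable_on A \<times> B"
  proof (rule summable_on_norm_bound)
    show "(\<lambda>(x, y). cmod (a x) * cmod (b y)) summable_on A \<times> B"
      using assms by (intro summable_on_times_real) (auto simp: summable_on_iff_abs_summable_on_complex)
  qed (auto simp: norm_mult)
  have "infsum (\<lambda>(x, y). a x * b y) (A \<times> B) = infsum (\<lambda>x. infsum (\<lambda>y. a x * b y) B) A"
    by (rule infsum_Sigma'_banach[symmetric]) (rule s)
  then show "infsum a A * infsum b B = infsum (\<lambda>(x, y). a x * b y) (A \<times> B)"
    by (simp add: infsum_cmult_right' infsum_cmult_left')
qed

text \<open>A finite family of finite subsets lies in the power set of its union B, where the sum of
  products factorises into the product of 1 + b u, at most exp of the sum of b. Absolute convergence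
  of all tau series rests on this bound.\<close>

lemma summable_on_prod_Fpow:
  fixes b :: "'a \<Rightarrow> real"
  assumes "b summable_on A" "\<And>u. u \<in> A \<Longrightarrow> 0 \<le> b u"
  shows "(\<lambda>J. \<Prod>u\<in>J. b u) summable_on Fpow A"
proof (rule nonneg_bdd_above_summable_on)
  show "0 \<le> prod b J" if "J \<in> Fpow A" for J
    using that assms(2) by (auto simp: Fpow_def intro!: prod_nonneg)
  show "bdd_above (sum (prod b) ` {F. F \<subseteq> Fpow A \<and> finite F})"
  proof (rule bdd_aboveI2)
    fix F assume F: "F \<in> {F. F \<subseteq> Fpow A \<and> finite F}"
    define B where "B = \<Union>F"
    have B: "finite B" "B \<subseteq> A" using F by (auto simp: B_def Fpow_def)
    have "sum (prod b) F \<le> sum (prod b) (Pow B)"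
      using F B assms(2) by (intro sum_mono2) (auto simp: B_def subset_eq intro!: prod_nonneg)
    also have "\<dots> = (\<Prod>u\<in>B. b u + 1)"
      using prod_add[OF B(1), of b "\<lambda>_. 1"] by simp
    also have "\<dots> \<le> (\<Prod>u\<in>B. exp (b u))"
      using B assms(2) exp_ge_add_one_self by (intro prod_mono) (auto simp: add.commute add_nonneg_nonneg)
    also have "\<dots> = exp (sum b B)" using B by (simp add: exp_sum)
    also have "\<dots> \<le> exp (infsum b A)"
      using assms B by (auto intro!: finite_sum_le_infsum)
    finally show "sum (prod b) F \<le> exp (infsum b A)" .
  qed
qed

text \<open>Lets a sum over \<open>Fpow A\<close> be computed as the limit of sums over
  \<open>Pow B\<close> for growing finite B, the form in which finite determinant identities are
  available.\<close>

lemma filterlim_Pow_finite_subsets_at_top: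
  "filterlim Pow (finite_subsets_at_top (Fpow A)) (finite_subsets_at_top A)"
  unfolding filterlim_finite_subsets_at_top
proof (intro allI impI)
  fix X assume X: "finite X \<and> X \<subseteq> Fpow A"
  then have "\<forall>\<^sub>F B in finite_subsets_at_top A. finite B \<and> \<Union>X \<subseteq> B \<and> B \<subseteq> A"
    unfolding eventually_finite_subsets_at_top
    by (intro exI[of _ "\<Union>X"]) (auto simp: Fpow_def)
  then show "\<forall>\<^sub>F B in finite_subsets_at_top A. finite (Pow B) \<and> X \<subseteq> Pow B \<and> Pow B \<subseteq> Fpow A"
    by eventually_elim (auto simp: Fpow_def intro: finite_subset)
qed

lemma tendsto_sum_Pow:
  assumes "(f has_sum s) (Fpow A)"
  shows "((\<lambda>B. sum f (Pow B)) \<longlongrightarrow> s) (finite_subsets_at_top A)"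
  using filterlim_compose[OF assms[unfolded has_sum_def] filterlim_Pow_finite_subsets_at_top] .

text \<open>Both sides run over finite sets with a marked element: (w, J) with w outside J
  corresponds to (insert w J, w). This absorbs the summation variable of an integral operator into
  the subset.\<close>

lemma infsum_Fpow_swap:
  fixes f :: "'a \<Rightarrow> 'a set \<Rightarrow> complex"
  assumes "(\<lambda>(w, J). f w J) summable_on (SIGMA w:A. {J \<in> Fpow A. w \<notin> J})"
  shows "infsum (\<lambda>J. \<Sum>w\<in>J. f w (J - {w})) (Fpow A) =
           infsum (\<lambda>w. infsum (f w) {J \<in> Fpow A. w \<notin> J}) A" (is ?eq)
    and "(\<lambda>J. \<Sum>w\<in>J. f w (J - {w})) summable_on Fpow A" (is ?s)
proof -
  let ?S = "SIGMA w:A. {J \<in> Fpow A. w \<notin> J}"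
  let ?T = "SIGMA J:Fpow A. J"
  let ?F = "\<lambda>J. infsum (\<lambda>w. f w (J - {w})) J"
  have bij: "bij_betw (\<lambda>(w, J). (insert w J, w)) ?S ?T"
    by (rule bij_betwI[where g = "\<lambda>(J, w). (w, J - {w})"]) (auto simp: Fpow_def)
  have F: "?F J = (\<Sum>w\<in>J. f w (J - {w}))" if "J \<in> Fpow A" for J
    using that by (auto simp: Fpow_def)
  have comp: "(\<lambda>(J, w). f w (J - {w})) (case p of (w, J) \<Rightarrow> (insert w J, w)) = (case p of (w, J) \<Rightarrow> f w J)"
    if "p \<in> ?S" for p using that by auto
  have sT: "(\<lambda>(J, w). f w (J - {w})) summable_on ?T"
    using assms summable_on_reindex_bij_betw[OF bij, of "\<lambda>(J, w). f w (J - {w})"] comp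
    by (simp cong: summable_on_cong)
  have "infsum ?F (Fpow A) = infsum (\<lambda>(J, w). f w (J - {w})) ?T"
    by (rule infsum_Sigma'_banach[OF sT])
  also have "\<dots> = infsum (\<lambda>(w, J). f w J) ?S"
    using infsum_reindex_bij_betw[OF bij, of "\<lambda>(J, w). f w (J - {w})"] comp
    by (simp cong: infsum_cong)
  also have "\<dots> = infsum (\<lambda>w. infsum (f w) {J \<in> Fpow A. w \<notin> J}) A"
    by (rule infsum_Sigma'_banach[OF assms, symmetric])
  finally show ?eq using F by (simp cong: infsum_cong)
  have "?F summable_on Fpow A" by (rule summable_on_Sigma_banach[OF sT])
  then show ?s using F by (simp cong: summable_on_cong)
qed

subsection \<open>Determinants indexed by a finite set\<close>

text \<open>Leibniz' formula on the index set itself: a principal minor needs no enumeration of its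
  set.\<close>

definition sdet :: "'a set \<Rightarrow> ('a \<Rightarrow> 'a \<Rightarrow> complex) \<Rightarrow> complex" where
  "sdet J K = (\<Sum>\<pi> | \<pi> permutes J. of_int (sign \<pi>) * (\<Prod>i\<in>J. K i (\<pi> i)))"

lemma sdet_empty [simp]: "sdet {} K = 1"
  by (simp add: sdet_def)

lemma sdet_cong:
  assumes "\<And>i j. i \<in> J \<Longrightarrow> j \<in> J \<Longrightarrow> K i j = K' i j"
  shows "sdet J K = sdet J K'"
  unfolding sdet_def using assms
  by (intro sum.cong refl arg_cong2[where f = "(*)"] prod.cong) (auto simp: permutes_in_image)

lemma sdet_reindex:
  assumes "bij_betw f J J'" "finite J"
  shows "sdet J' K = sdet J (\<lambda>i j. K (f i) (f j))"
proof -
  have f: "inj_on f J" "f ` J = J'" using assms(1) by (auto simp: bij_betw_def)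
  have m: "map_permutation J f = (\<lambda>\<pi> x. if x \<in> J' then f (\<pi> (inv_into J f x)) else x)"
    using f by (auto simp: map_permutation_def restrict_id_def fun_eq_iff)
  have "sdet J' K = (\<Sum>\<pi> | \<pi> permutes J. of_int (sign (map_permutation J f \<pi>)) *
      (\<Prod>i\<in>J'. K i (map_permutation J f \<pi> i)))"
    unfolding sdet_def m by (rule sum.reindex_bij_betw[OF bij_betw_permutations[OF assms(1)], symmetric])
  also have "\<dots> = sdet J (\<lambda>i j. K (f i) (f j))"
    unfolding sdet_def
  proof (intro sum.cong refl)
    fix \<pi> assume "\<pi> \<in> {\<pi>. \<pi> permutes J}"
    then have \<pi>: "\<pi> permutes J" by simp
    have "(\<Prod>i\<in>J'. K i (map_permutation J f \<pi> i)) = (\<Prod>i\<in>J. K (f i) (map_permutation J f \<pi> (f i)))"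
      by (rule prod.reindex_bij_betw[OF assms(1), symmetric])
    also have "\<dots> = (\<Prod>i\<in>J. K (f i) (f (\<pi> i)))"
      using f by (intro prod.cong refl) (simp add: map_permutation_apply)
    finally show "of_int (sign (map_permutation J f \<pi>)) * (\<Prod>i\<in>J'. K i (map_permutation J f \<pi> i)) =
        of_int (sign \<pi>) * (\<Prod>i\<in>J. K (f i) (f (\<pi> i)))"
      using sign_map_permutation[OF f(1) \<pi> assms(2)] by simp
  qed
  finally show ?thesis .
qed

lemma det_mat_eq_sdet:
  "Determinant.det (Matrix.mat n n (\<lambda>(i, j). K i j)) = sdet {..<n} K"
  unfolding sdet_def
  by (subst det_def'[of _ n])
     (auto simp: lessThan_atLeast0 permutes_in_image intro!: sum.cong prod.cong)

lemma det_mat_inj_eq_sdet: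
  assumes "inj_on p {..<n}"
  shows "Determinant.det (Matrix.mat n n (\<lambda>(i, j). K (p i) (p j))) = sdet (p ` {..<n}) K"
  using assms by (simp add: det_mat_eq_sdet sdet_reindex[of p "{..<n}"] bij_betw_def)

lemma det_mat_not_inj_eq_0:
  assumes "\<not> inj_on p {..<n}"
  shows "Determinant.det (Matrix.mat n n (\<lambda>(i, j). K (p i) (p j) :: complex)) = 0"
proof -
  obtain i j where ij: "i < n" "j < n" "i \<noteq> j" "p i = p j"
    using assms by (auto simp: inj_on_def)
  show ?thesis
    by (rule det_identical_rows[of _ n i j]) (use ij in \<open>auto intro!: eq_vecI\<close>)
qed

lemma sdet_mult_col:
  "sdet J (\<lambda>i j. K i j * e j) = sdet J K * prod e J"
proof -
  have "(\<Prod>i\<in>J. e (\<pi> i)) = prod e J" if "\<pi> permutes J" for \<pi>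
    using prod.permute[OF that, of e] by (simp add: o_def)
  then show ?thesis
    by (simp add: sdet_def prod.distrib sum_distrib_right mult.assoc)
qed

text \<open>For each permutation the factors d in numerator and denominator run over the same set
  and cancel. Kernels conjugate by a diagonal operator thus have equal principal minors, hence equal
  Fredholm series.\<close>

lemma sdet_conjugate:
  assumes "finite J" "\<And>i. i \<in> J \<Longrightarrow> d i \<noteq> 0"
  shows "sdet J (\<lambda>i j. d i * K i j / d j) = sdet J K"
proof -
  have "(\<Prod>i\<in>J. d (\<pi> i)) = prod d J" if "\<pi> permutes J" for \<pi>
    using prod.permute[OF that, of d] by (simp add: o_def)
  moreover have "prod d J \<noteq> 0" using assms by simp
  ultimately show ?thesis
    by (simp add: sdet_def prod.distrib prod_dividef)
qed

text \<open>Expanding each row as unit row minus row of K selects a set J of rows taken from K; a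
  permutation then contributes only if it fixes B - J pointwise, which makes it a permutation of
  J.\<close>

lemma sdet_id_minus:
  assumes "finite B"
  shows "sdet B (\<lambda>i j. (if i = j then 1 else 0) - K i j) = (\<Sum>J\<in>Pow B. (-1) ^ card J * sdet J K)"
proof -
  let ?\<delta> = "\<lambda>i j. if i = j then 1 else (0::complex)"
  have perm: "{\<pi>. \<pi> permutes B \<and> (\<forall>i\<in>B - J. \<pi> i = i)} = {\<pi>. \<pi> permutes J}" if "J \<subseteq> B" for J
    using that by (auto intro: permutes_subset permutes_superset simp: permutes_not_in)
  have "sdet B (\<lambda>i j. ?\<delta> i j - K i j) = (\<Sum>\<pi> | \<pi> permutes B. of_int (sign \<pi>) *
      (\<Sum>J\<in>Pow B. (-1) ^ card J * (\<Prod>i\<in>J. K i (\<pi> i)) * (\<Prod>i\<in>B - J. ?\<delta> i (\<pi> i))))"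
    unfolding sdet_def using assms by (simp add: prod_diff_conv_sum)
  also have "\<dots> = (\<Sum>J\<in>Pow B. \<Sum>\<pi> | \<pi> permutes B. of_int (sign \<pi>) *
      ((-1) ^ card J * (\<Prod>i\<in>J. K i (\<pi> i)) * (\<Prod>i\<in>B - J. ?\<delta> i (\<pi> i))))"
    by (simp add: sum_distrib_left sum.swap[of _ "Pow B"])
  also have "\<dots> = (\<Sum>J\<in>Pow B. (-1) ^ card J * sdet J K)"
  proof (rule sum.cong[OF refl])
    fix J assume J: "J \<in> Pow B"
    have "(\<Sum>\<pi> | \<pi> permutes B. of_int (sign \<pi>) *
        ((-1) ^ card J * (\<Prod>i\<in>J. K i (\<pi> i)) * (\<Prod>i\<in>B - J. ?\<delta> i (\<pi> i)))) =
      (\<Sum>\<pi> | \<pi> permutes B \<and> (\<forall>i\<in>B - J. \<pi> i = i). of_int (sign \<pi>) *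
        ((-1) ^ card J * (\<Prod>i\<in>J. K i (\<pi> i))))"
    proof (rule sum.mono_neutral_cong_right)
      show "finite {\<pi>. \<pi> permutes B}" using assms by (rule finite_permutations)
      show "\<forall>\<pi>\<in>{\<pi>. \<pi> permutes B} - {\<pi>. \<pi> permutes B \<and> (\<forall>i\<in>B - J. \<pi> i = i)}.
        of_int (sign \<pi>) * ((-1) ^ card J * (\<Prod>i\<in>J. K i (\<pi> i)) * (\<Prod>i\<in>B - J. ?\<delta> i (\<pi> i))) = 0"
      proof
        fix \<pi> assume "\<pi> \<in> {\<pi>. \<pi> permutes B} - {\<pi>. \<pi> permutes B \<and> (\<forall>i\<in>B - J. \<pi> i = i)}"
        then obtain i where "i \<in> B - J" "\<pi> i \<noteq> i" by auto
        then have "(\<Prod>i\<in>B - J. ?\<delta> i (\<pi> i)) = 0"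
          using assms by (intro prod_zero bexI[of _ i]) auto
        then show "of_int (sign \<pi>) * ((-1) ^ card J * (\<Prod>i\<in>J. K i (\<pi> i)) * (\<Prod>i\<in>B - J. ?\<delta> i (\<pi> i))) = 0"
          by simp
      qed
    qed auto
    also have "\<dots> = (-1) ^ card J * sdet J K"
      using J perm[of J] by (simp add: sdet_def sum_distrib_left mult_ac)
    finally show "(\<Sum>\<pi> | \<pi> permutes B. of_int (sign \<pi>) *
        ((-1) ^ card J * (\<Prod>i\<in>J. K i (\<pi> i)) * (\<Prod>i\<in>B - J. ?\<delta> i (\<pi> i)))) = (-1) ^ card J * sdet J K" .
  qed
  finally show ?thesis .
qed

text \<open>Permutations are among all maps from J to J, and over all maps the sum of products
  factorises into row sums. The bound is cruder than Hadamard's, but row sums are easily bounded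
  factor by factor, as \<open>summable_on_prod_Fpow\<close> requires.\<close>

lemma norm_sdet_le:
  assumes "finite J"
  shows "cmod (sdet J K) \<le> (\<Prod>i\<in>J. \<Sum>j\<in>J. cmod (K i j))"
proof -
  \<comment> \<open>Permutations of J are the identity off J, whereas members of
    \<open>J \<rightarrow>\<^sub>E J\<close> are \<open>undefined\<close> there;
    \<open>restrict\<close> translates.\<close>
  have inj: "inj_on (\<lambda>\<pi>. restrict \<pi> J) {\<pi>. \<pi> permutes J}"
  proof (rule inj_onI, rule ext)
    fix \<pi> \<rho> x assume *: "\<pi> \<in> {\<pi>. \<pi> permutes J}" "\<rho> \<in> {\<pi>. \<pi> permutes J}" "restrict \<pi> J = restrict \<rho> J"
    show "\<pi> x = \<rho> x"
      using fun_cong[OF *(3), of x] *(1,2) by (cases "x \<in> J") (auto simp: permutes_not_in)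
  qed
  have "cmod (sdet J K) \<le> (\<Sum>\<pi> | \<pi> permutes J. cmod (of_int (sign \<pi>) * (\<Prod>i\<in>J. K i (\<pi> i))))"
    unfolding sdet_def by (rule norm_sum)
  also have "\<dots> = (\<Sum>\<pi> | \<pi> permutes J. \<Prod>i\<in>J. cmod (K i (restrict \<pi> J i)))"
    by (auto simp: norm_mult prod_norm simp flip: of_int_abs intro!: sum.cong prod.cong)
  also have "\<dots> = (\<Sum>g\<in>(\<lambda>\<pi>. restrict \<pi> J) ` {\<pi>. \<pi> permutes J}. \<Prod>i\<in>J. cmod (K i (g i)))"
    by (simp add: sum.reindex[OF inj])
  also have "\<dots> \<le> (\<Sum>g\<in>J \<rightarrow>\<^sub>E J. \<Prod>i\<in>J. cmod (K i (g i)))"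
    using assms by (intro sum_mono2) (auto simp: finite_PiE permutes_in_image intro!: prod_nonneg)
  also have "\<dots> = (\<Prod>i\<in>J. \<Sum>j\<in>J. cmod (K i j))"
    using assms by (subst prod_sum_PiE) auto
  finally show ?thesis .
qed

text \<open>The sum is the determinant of a matrix whose rows w and y coincide; composing with the
  transposition of w and y flips the sign and preserves the product, so the sum equals its own
  negative.\<close>

lemma sum_permutes_duplicate_row:
  fixes K :: "'a \<Rightarrow> 'a \<Rightarrow> complex"
  assumes "finite J" "w \<notin> J" "y \<in> J"
  shows "(\<Sum>\<pi> | \<pi> permutes insert w J. of_int (sign \<pi>) * (K y (\<pi> w) * (\<Prod>i\<in>J. K i (\<pi> i)))) = 0"
    (is "?S = 0")
proof -
  let ?t = "Transposition.transpose w y"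
  let ?P = "{\<pi>. \<pi> permutes insert w J}"
  let ?f = "\<lambda>\<pi>. of_int (sign \<pi>) * (K y (\<pi> w) * (\<Prod>i\<in>J. K i (\<pi> i)))"
  have t: "?t permutes insert w J" using assms by (intro permutes_swap_id) auto
  have wy: "w \<noteq> y" using assms by auto
  have invol: "\<pi> \<circ> ?t \<circ> ?t = \<pi>" for \<pi> :: "'a \<Rightarrow> 'a"
    by (simp add: comp_assoc)
  have bij: "bij_betw (\<lambda>\<pi>. \<pi> \<circ> ?t) ?P ?P"
    by (rule bij_betwI[where g = "\<lambda>\<pi>. \<pi> \<circ> ?t"]) (use t invol in \<open>auto intro: permutes_compose\<close>)
  have "?S = (\<Sum>\<pi>\<in>?P. ?f (\<pi> \<circ> ?t))"
    by (rule sum.reindex_bij_betw[OF bij, symmetric])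
  also have "\<dots> = (\<Sum>\<pi>\<in>?P. - ?f \<pi>)"
  proof (rule sum.cong[OF refl])
    fix \<pi> assume "\<pi> \<in> ?P"
    then have "permutation \<pi>" "permutation ?t"
      using assms(1) by (auto intro: permutes_imp_permutation[of "insert w J"] permutation_swap_id)
    then have s: "sign (\<pi> \<circ> ?t) = - sign \<pi>"
      using wy by (simp add: sign_compose sign_swap_id)
    have "(\<Prod>i\<in>J - {y}. K i ((\<pi> \<circ> ?t) i)) = (\<Prod>i\<in>J - {y}. K i (\<pi> i))"
      using assms by (intro prod.cong) (auto simp: Transposition.transpose_def)
    then show "?f (\<pi> \<circ> ?t) = - ?f \<pi>"
      using assms(1,3) by (simp add: s prod.remove[of J y])
  qed
  also have "\<dots> = - ?S" by (simp add: sum_negf)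
  finally show ?thesis by simp
qed

text \<open>Subtracting from row w the combination of rows that agrees with it on the columns J
  leaves a single entry, in column w: the Schur complement.\<close>

lemma sdet_insert:
  assumes "finite J" "w \<notin> J" "\<And>j. j \<in> J \<Longrightarrow> K w j = (\<Sum>y\<in>J. \<phi> y * K y j)"
  shows "sdet (insert w J) K = sdet J K * (K w w - (\<Sum>y\<in>J. \<phi> y * K y w))"
proof -
  let ?P = "{\<pi>. \<pi> permutes insert w J}"
  let ?s = "K w w - (\<Sum>y\<in>J. \<phi> y * K y w)"
  let ?R = "\<lambda>\<pi>. of_int (sign \<pi>) * (\<Prod>i\<in>J. K i (\<pi> i))"
  have fin: "finite ?P" using assms(1) by (intro finite_permutations) auto
  have row: "K w (\<pi> w) = (\<Sum>y\<in>J. \<phi> y * K y (\<pi> w)) + (if \<pi> w = w then ?s else 0)" if "\<pi> \<in> ?P" for \<pi>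
  proof (cases "\<pi> w = w")
    case False
    then have "\<pi> w \<in> J" using that permutes_in_image[of \<pi> "insert w J" w] by auto
    then show ?thesis using False assms(3) by simp
  qed simp
  have perm: "{\<pi>. \<pi> permutes insert w J \<and> \<pi> w = w} = {\<pi>. \<pi> permutes J}"
    using assms(2) by (auto intro: permutes_subset permutes_superset[of _ "insert w J"] simp: permutes_not_in)
  have "sdet (insert w J) K = (\<Sum>\<pi>\<in>?P. of_int (sign \<pi>) * (K w (\<pi> w) * (\<Prod>i\<in>J. K i (\<pi> i))))"
    unfolding sdet_def using assms by simp
  also have "\<dots> = (\<Sum>\<pi>\<in>?P. (\<Sum>y\<in>J. \<phi> y * (of_int (sign \<pi>) * (K y (\<pi> w) * (\<Prod>i\<in>J. K i (\<pi> i)))))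
      + (if \<pi> w = w then ?R \<pi> * ?s else 0))"
    by (intro sum.cong refl) (subst row, auto simp: sum_distrib_left sum_distrib_right algebra_simps)
  also have "\<dots> = (\<Sum>y\<in>J. \<phi> y * (\<Sum>\<pi>\<in>?P. of_int (sign \<pi>) * (K y (\<pi> w) * (\<Prod>i\<in>J. K i (\<pi> i)))))
      + (\<Sum>\<pi>\<in>?P. if \<pi> w = w then ?R \<pi> * ?s else 0)"
    by (simp add: sum.distrib sum_distrib_left sum.swap[of _ J])
  also have "\<dots> = (\<Sum>\<pi> | \<pi> permutes J. ?R \<pi> * ?s)"
    using sum_permutes_duplicate_row[OF assms(1,2), of _ K] fin
    by (simp add: sum.If_cases perm[symmetric] Collect_conj_eq)
  also have "\<dots> = sdet J K * ?s" by (simp add: sdet_def sum_distrib_right)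
  finally show ?thesis .
qed

subsection \<open>Partial fractions and the Cauchy determinant\<close>

text \<open>Zeros at J, poles at -J. Without complex conjugates this is not the Blaschke product of
  the half-plane; the bound 1 on its modulus comes from |u - v| <= |u + v| for v in J.\<close>

definition blaschke :: "complex set \<Rightarrow> complex \<Rightarrow> complex" where
  "blaschke J u = (\<Prod>v\<in>J. (u - v) / (u + v))"

text \<open>Minus the residue of \<open>blaschke J\<close> at its pole -w;
  \<open>blaschke_uminus\<close> brings the remaining factors into this form.\<close>

definition pf_coeff :: "complex set \<Rightarrow> complex \<Rightarrow> complex" where
  "pf_coeff J w = 2 * w / blaschke (J - {w}) w"

lemma blaschke_empty [simp]: "blaschke {} u = 1"
  by (simp add: blaschke_def)

lemma blaschke_insert:
  "finite J \<Longrightarrow> y \<notin> J \<Longrightarrow> blaschke (insert y J) u = blaschke J u * ((u - y) / (u + y))"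
  by (simp add: blaschke_def mult.commute)

lemma blaschke_eq_0: "finite J \<Longrightarrow> u \<in> J \<Longrightarrow> blaschke J u = 0"
  unfolding blaschke_def by (rule prod_zero) auto

lemma blaschke_nonzero:
  assumes "finite J" "\<And>v. v \<in> J \<Longrightarrow> u + v \<noteq> 0" "u \<notin> J"
  shows "blaschke J u \<noteq> 0"
  using assms by (auto simp: blaschke_def)

text \<open>For finite J both sides are 0 at zeros and poles, since division by zero gives
  0.\<close>

lemma blaschke_uminus: "blaschke J (- u) = 1 / blaschke J u"
proof -
  have "(- u - v) / (- u + v) = 1 / ((u - v) / (u + v))" for v
    by (cases "u = v") (auto simp: divide_simps, simp_all add: algebra_simps)
  then show ?thesis by (simp add: blaschke_def prod_dividef)
qed

lemma norm_blaschke_le_1: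
  assumes "\<And>v. v \<in> J \<Longrightarrow> cmod (u - v) \<le> cmod (u + v)"
  shows "cmod (blaschke J u) \<le> 1"
  unfolding blaschke_def prod_norm[symmetric] norm_divide
  by (rule prod_le_1) (use assms in \<open>auto simp: divide_le_eq_1\<close>)

lemma add_neq_0_of_Re_pos: "0 < Re u \<Longrightarrow> 0 < Re v \<Longrightarrow> u + v \<noteq> 0"
  by (auto simp: complex_eq_iff)

lemma pf_coeff_insert:
  assumes "finite J" "y \<notin> J" "w \<in> J"
  shows "pf_coeff (insert y J) w = pf_coeff J w * ((w + y) / (w - y))"
proof -
  have "insert y J - {w} = insert y (J - {w})" using assms by auto
  then show ?thesis using assms by (simp add: pf_coeff_def blaschke_insert)
qed

lemma pf_coeff_insert_self:
  assumes "y \<notin> J"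
  shows "pf_coeff (insert y J) y = 2 * y / blaschke J y"
  using assms by (simp add: pf_coeff_def)

text \<open>All poles -w are simple and the value at infinity is 1. The induction step adds a factor
  and needs the old product at the new pole -y, which the induction hypothesis also delivers;
  therefore u ranges over all points off -J and not only over the right half-plane.\<close>

lemma blaschke_partial_fractions:
  assumes "finite J" "\<And>v. v \<in> J \<Longrightarrow> 0 < Re v" "\<And>v. v \<in> J \<Longrightarrow> u + v \<noteq> 0"
  shows "blaschke J u = 1 - (\<Sum>w\<in>J. pf_coeff J w / (u + w))"
  using assms
proof (induction J arbitrary: u rule: finite_induct)
  case (insert y J)
  have ne: "u + w \<noteq> 0" "u + y \<noteq> 0" "w - y \<noteq> 0" "y + w \<noteq> 0" if "w \<in> J" for w
    using insert.prems insert.hyps that add_neq_0_of_Re_pos[of y w] by auto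
  have ney: "u + y \<noteq> 0" using insert.prems by simp
  have 1: "blaschke J u = 1 - (\<Sum>w\<in>J. pf_coeff J w / (u + w))"
    using insert.prems by (intro insert.IH) auto
  have "blaschke J (- y) = 1 - (\<Sum>w\<in>J. pf_coeff J w / (- y + w))"
    using insert.prems insert.hyps by (intro insert.IH) auto
  then have 2: "1 / blaschke J y = 1 - (\<Sum>w\<in>J. pf_coeff J w / (w - y))"
    by (simp add: blaschke_uminus)
  have "(\<Sum>w\<in>insert y J. pf_coeff (insert y J) w / (u + w)) =
      2 * y * (1 / blaschke J y) / (u + y) + (\<Sum>w\<in>J. pf_coeff J w * ((w + y) / (w - y)) / (u + w))"
    using insert.hyps by (simp add: pf_coeff_insert pf_coeff_insert_self)
  also have "\<dots> = 2 * y / (u + y) + (\<Sum>w\<in>J. pf_coeff J w * ((w + y) / (w - y)) / (u + w)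
      - 2 * y / (u + y) * (pf_coeff J w / (w - y)))"
    unfolding 2 sum_subtractf sum_distrib_left[symmetric] using ney
    by (simp add: divide_simps) (simp add: algebra_simps)
  also have "\<dots> = 2 * y / (u + y) + (\<Sum>w\<in>J. (u - y) / (u + y) * (pf_coeff J w / (u + w)))"
  proof (intro arg_cong2[where f = "(+)"] sum.cong refl)
    fix w assume "w \<in> J"
    note n = ne[OF this]
    show "pf_coeff J w * ((w + y) / (w - y)) / (u + w) - 2 * y / (u + y) * (pf_coeff J w / (w - y)) =
        (u - y) / (u + y) * (pf_coeff J w / (u + w))"
      using n by (simp add: divide_simps) (simp add: algebra_simps)
  qed
  also have "\<dots> = 1 - blaschke (insert y J) u"
    unfolding sum_distrib_left[symmetric] blaschke_insert[OF insert.hyps] 1 using ney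
    by (simp add: divide_simps) (simp add: algebra_simps)
  finally show ?case by simp
qed simp

text \<open>The residue at the new pole contains 1 / \<open>blaschke J y\<close>. Expanding it in
  the old partial fractions gives every w in J a numerator that vanishes at w = y, so the quotient
  by w - y is a polynomial.\<close>

lemma pf_coeff_moment_insert:
  assumes "finite J" "y \<notin> J" "\<And>v. v \<in> insert y J \<Longrightarrow> 0 < Re v"
  shows "(\<Sum>w\<in>insert y J. pf_coeff (insert y J) w * w ^ m) =
    2 * y ^ Suc m + (\<Sum>w\<in>J. pf_coeff J w * ((w ^ m * (w + y) - 2 * y ^ Suc m) / (w - y)))"
proof -
  have "blaschke J (- y) = 1 - (\<Sum>w\<in>J. pf_coeff J w / (- y + w))"
    using assms by (intro blaschke_partial_fractions) auto
  then have 2: "1 / blaschke J y = 1 - (\<Sum>w\<in>J. pf_coeff J w / (w - y))"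
    by (simp add: blaschke_uminus)
  have "(\<Sum>w\<in>insert y J. pf_coeff (insert y J) w * w ^ m) =
      2 * y ^ Suc m * (1 / blaschke J y) + (\<Sum>w\<in>J. pf_coeff J w * ((w + y) / (w - y)) * w ^ m)"
    using assms by (simp add: pf_coeff_insert pf_coeff_insert_self)
  also have "\<dots> = 2 * y ^ Suc m + (\<Sum>w\<in>J. pf_coeff J w * ((w + y) / (w - y)) * w ^ m
      - 2 * y ^ Suc m * (pf_coeff J w / (w - y)))"
    unfolding 2 sum_subtractf sum_distrib_left[symmetric] by (simp add: algebra_simps)
  also have "(\<Sum>w\<in>J. pf_coeff J w * ((w + y) / (w - y)) * w ^ m
      - 2 * y ^ Suc m * (pf_coeff J w / (w - y))) =
      (\<Sum>w\<in>J. pf_coeff J w * ((w ^ m * (w + y) - 2 * y ^ Suc m) / (w - y)))"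
    by (intro sum.cong refl) (simp add: diff_divide_distrib right_diff_distrib mult_ac)
  finally show ?thesis .
qed

section \<open>Power sums and the moments of the partial-fraction coefficients\<close>

definition psum :: "nat \<Rightarrow> complex set \<Rightarrow> complex" where
  "psum k J = (\<Sum>u\<in>J. u ^ k)"

lemma psum_insert: "finite J \<Longrightarrow> y \<notin> J \<Longrightarrow> psum k (insert y J) = y ^ k + psum k J"
  by (simp add: psum_def)

lemma psum_empty [simp]: "psum k {} = 0"
  by (simp add: psum_def)

text \<open>The moments are, up to sign, the coefficients of \<open>blaschke J u\<close> at
  infinity, where its logarithm is -2 (p_1/u + p_3/(3 u^3) + ...). Up to third order only p_1 and
  p_3 occur, the generators of the x-flow and the \<tau>-flow.\<close>

lemma pf_coeff_moments:
  assumes "finite J" "\<And>v. v \<in> J \<Longrightarrow> 0 < Re v"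
  shows "(\<Sum>w\<in>J. pf_coeff J w) = 2 * psum 1 J"
    and "(\<Sum>w\<in>J. pf_coeff J w * w) = 2 * (psum 1 J)\<^sup>2"
    and "(\<Sum>w\<in>J. pf_coeff J w * w ^ 2) = 4 / 3 * psum 1 J ^ 3 + 2 / 3 * psum 3 J"
proof -
  have "(\<Sum>w\<in>J. pf_coeff J w) = 2 * psum 1 J \<and> (\<Sum>w\<in>J. pf_coeff J w * w) = 2 * (psum 1 J)\<^sup>2 \<and>
      (\<Sum>w\<in>J. pf_coeff J w * w ^ 2) = 4 / 3 * psum 1 J ^ 3 + 2 / 3 * psum 3 J"
    using assms
  proof (induction J rule: finite_induct)
    case (insert y J)
    note step = pf_coeff_moment_insert[OF insert.hyps insert.prems]
    have IH: "(\<Sum>w\<in>J. pf_coeff J w) = 2 * psum 1 J" "(\<Sum>w\<in>J. pf_coeff J w * w) = 2 * (psum 1 J)\<^sup>2"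
      "(\<Sum>w\<in>J. pf_coeff J w * w ^ 2) = 4 / 3 * psum 1 J ^ 3 + 2 / 3 * psum 3 J"
      using insert by auto
    have wy: "w - y \<noteq> 0" if "w \<in> J" for w using that insert.hyps by auto
    \<comment> \<open>The three quotients by w - y are 1, w + 2 y and w^2 + 2 y w + 2 y^2.\<close>
    have q0: "(\<Sum>w\<in>J. pf_coeff J w * ((w ^ 0 * (w + y) - 2 * y ^ Suc 0) / (w - y))) = (\<Sum>w\<in>J. pf_coeff J w)"
      using wy by (intro sum.cong refl) (simp add: divide_simps)
    have q1: "(\<Sum>w\<in>J. pf_coeff J w * ((w ^ 1 * (w + y) - 2 * y ^ Suc 1) / (w - y))) =
        (\<Sum>w\<in>J. pf_coeff J w * w + 2 * y * pf_coeff J w)"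
      using wy by (intro sum.cong refl) (simp add: divide_simps, simp add: algebra_simps power2_eq_square)
    have q2: "(\<Sum>w\<in>J. pf_coeff J w * ((w ^ 2 * (w + y) - 2 * y ^ Suc 2) / (w - y))) =
        (\<Sum>w\<in>J. pf_coeff J w * w ^ 2 + (2 * y * (pf_coeff J w * w) + 2 * y ^ 2 * pf_coeff J w))"
      using wy by (intro sum.cong refl)
        (simp add: divide_simps, simp add: algebra_simps power2_eq_square power3_eq_cube)
    have "(\<Sum>w\<in>insert y J. pf_coeff (insert y J) w) = 2 * psum 1 (insert y J)"
      using step[of 0] IH unfolding q0 by (simp add: psum_insert[OF insert.hyps(1,2)] algebra_simps)
    moreover have "(\<Sum>w\<in>insert y J. pf_coeff (insert y J) w * w) = 2 * (psum 1 (insert y J))\<^sup>2"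
    proof -
      have "(\<Sum>w\<in>insert y J. pf_coeff (insert y J) w * w) = 2 * y ^ 2 + (2 * (psum 1 J)\<^sup>2 + 2 * y * (2 * psum 1 J))"
        using step[of 1] unfolding q1 by (simp only: sum.distrib sum_distrib_left[symmetric] IH)
          (simp add: power2_eq_square)
      then show ?thesis
        by (simp add: psum_insert[OF insert.hyps(1,2)] algebra_simps power2_eq_square)
    qed
    moreover have "(\<Sum>w\<in>insert y J. pf_coeff (insert y J) w * w ^ 2) =
        4 / 3 * psum 1 (insert y J) ^ 3 + 2 / 3 * psum 3 (insert y J)"
    proof -
      have "(\<Sum>w\<in>insert y J. pf_coeff (insert y J) w * w ^ 2) = 2 * y ^ 3 +
          (4 / 3 * psum 1 J ^ 3 + 2 / 3 * psum 3 J + (2 * y * (2 * (psum 1 J)\<^sup>2) + 2 * y ^ 2 * (2 * psum 1 J)))"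
        using step[of 2] unfolding q2 by (simp only: sum.distrib sum_distrib_left[symmetric] IH)
          (simp add: power2_eq_square power3_eq_cube)
      then show ?thesis
        by (simp add: psum_insert[OF insert.hyps(1,2)] algebra_simps power2_eq_square power3_eq_cube)
    qed
    ultimately show ?case by blast
  qed simp
  then show "(\<Sum>w\<in>J. pf_coeff J w) = 2 * psum 1 J"
    "(\<Sum>w\<in>J. pf_coeff J w * w) = 2 * (psum 1 J)\<^sup>2"
    "(\<Sum>w\<in>J. pf_coeff J w * w ^ 2) = 4 / 3 * psum 1 J ^ 3 + 2 / 3 * psum 3 J"
    by blast+
qed

text \<open>For w outside J, the factor removed from the product turns 1/(w + y) into 1/(w - y), and
  1/((u + y)(w - y)) splits into partial fractions at u and at -w. For w in J all terms but y = w
  vanish. The identity serves both as the row relation behind the Cauchy determinant and as the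
  resolvent identity.\<close>

lemma blaschke_double_partial_fractions:
  assumes "finite J" "\<And>v. v \<in> J \<Longrightarrow> 0 < Re v" "0 < Re u" "0 < Re w"
  shows "blaschke J u * blaschke J w / (u + w) +
      (\<Sum>y\<in>J. pf_coeff J y * (blaschke (J - {y}) w / ((u + y) * (w + y)))) = 1 / (u + w)"
proof -
  have uy: "u + y \<noteq> 0" and wy: "w + y \<noteq> 0" if "y \<in> J" for y
    using add_neq_0_of_Re_pos assms(2-4) that by blast+
  have uw: "u + w \<noteq> 0" using assms by (intro add_neq_0_of_Re_pos)
  show ?thesis
  proof (cases "w \<in> J")
    case True
    have w0: "w \<noteq> 0" using assms by auto
    have "blaschke (J - {y}) w = 0" if "y \<in> J - {w}" for y
      using True that assms(1) by (intro blaschke_eq_0) auto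
    then have "(\<Sum>y\<in>J. pf_coeff J y * (blaschke (J - {y}) w / ((u + y) * (w + y)))) =
        pf_coeff J w * (blaschke (J - {w}) w / ((u + w) * (w + w)))"
      using True assms(1) by (simp add: sum.remove[of J w])
    also have "\<dots> = 1 / (u + w)"
      using w0 uw blaschke_nonzero[of "J - {w}" w] assms wy by (auto simp: pf_coeff_def divide_simps)
    finally show ?thesis using True assms(1) by (simp add: blaschke_eq_0)
  next
    case False
    have Bw: "blaschke J w \<noteq> 0" using False assms(1) wy by (intro blaschke_nonzero) auto
    have y: "blaschke (J - {y}) w / ((u + y) * (w + y)) =
        blaschke J w / (u + w) * (1 / (u + y) - 1 / (- w + y))" if "y \<in> J" for y
    proof -
      have B: "blaschke J w = blaschke (J - {y}) w * ((w - y) / (w + y))"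
        using blaschke_insert[of "J - {y}" y w] assms(1) that by (simp add: insert_absorb)
      have "w - y \<noteq> 0" "- w + y \<noteq> 0" using that False by auto
      then show ?thesis
        unfolding B using uw uy[OF that] wy[OF that]
        by (simp add: divide_simps) (simp add: algebra_simps)
    qed
    have "(\<Sum>y\<in>J. pf_coeff J y * (blaschke (J - {y}) w / ((u + y) * (w + y)))) =
        (\<Sum>y\<in>J. blaschke J w / (u + w) * (pf_coeff J y / (u + y) - pf_coeff J y / (- w + y)))"
      by (intro sum.cong refl, subst y) (simp_all add: algebra_simps)
    also have "\<dots> = blaschke J w / (u + w) * ((1 - blaschke J u) - (1 - blaschke J (- w)))"
    proof -
      have "blaschke J u = 1 - (\<Sum>y\<in>J. pf_coeff J y / (u + y))"
        using assms uy by (intro blaschke_partial_fractions) auto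
      moreover have "blaschke J (- w) = 1 - (\<Sum>y\<in>J. pf_coeff J y / (- w + y))"
        using assms False by (intro blaschke_partial_fractions) auto
      ultimately show ?thesis by (simp only: sum_distrib_left[symmetric] sum_subtractf) simp
    qed
    also have "\<dots> = 1 / (u + w) - blaschke J u * blaschke J w / (u + w)"
      using uw Bw by (simp add: blaschke_uminus divide_simps) (simp add: algebra_simps)
    finally show ?thesis by simp
  qed
qed

text \<open>The weights \<phi> from the double partial fractions write row w through the rows of J,
  because \<open>blaschke J j\<close> = 0 on the columns j in J; in column w the defect is
  proportional to the square of \<open>blaschke J w\<close>. Iterated, this is Cauchy's product of
  ((u - v)/(u + v))^2.\<close>

lemma sdet_cauchy_insert:
  assumes "finite J" "w \<notin> J" "\<And>v. v \<in> insert w J \<Longrightarrow> 0 < Re v"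
  shows "sdet (insert w J) (\<lambda>u v. g v / (u + v)) =
      sdet J (\<lambda>u v. g v / (u + v)) * (g w / (2 * w) * (blaschke J w)\<^sup>2)"
proof -
  define \<phi> where "\<phi> y = pf_coeff J y * (blaschke (J - {y}) w / (w + y))" for y
  have Re: "0 < Re v" if "v \<in> J" for v using assms that by auto
  have dpf: "(\<Sum>y\<in>J. \<phi> y * (1 / (y + u))) = (1 - blaschke J u * blaschke J w) / (u + w)" if "0 < Re u" for u
    using blaschke_double_partial_fractions[OF assms(1) Re that, of w] assms(3)
    by (simp add: \<phi>_def diff_divide_distrib algebra_simps)
  have "g j / (w + j) = (\<Sum>y\<in>J. \<phi> y * (g j / (y + j)))" if "j \<in> J" for j
  proof -
    have "(\<Sum>y\<in>J. \<phi> y * (g j / (y + j))) = g j * (\<Sum>y\<in>J. \<phi> y * (1 / (y + j)))"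
      by (simp add: sum_distrib_left mult_ac)
    then show ?thesis using dpf[OF Re[OF that]] that assms(1)
      by (simp add: blaschke_eq_0 add.commute)
  qed
  then have "sdet (insert w J) (\<lambda>u v. g v / (u + v)) =
      sdet J (\<lambda>u v. g v / (u + v)) * (g w / (w + w) - (\<Sum>y\<in>J. \<phi> y * (g w / (y + w))))"
    by (rule sdet_insert[OF assms(1,2)])
  also have "(\<Sum>y\<in>J. \<phi> y * (g w / (y + w))) = g w * (\<Sum>y\<in>J. \<phi> y * (1 / (y + w)))"
    by (simp add: sum_distrib_left mult_ac)
  also have "\<dots> = g w * ((1 - blaschke J w * blaschke J w) / (w + w))"
    using dpf[of w] assms(3) by simp
  also have "g w / (w + w) - \<dots> = g w / (2 * w) * (blaschke J w)\<^sup>2"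
    by (simp add: power2_eq_square diff_divide_distrib algebra_simps)
  finally show ?thesis .
qed

text \<open>Each factor that \<open>sdet_cauchy_insert\<close> adds to the diagonal entry has
  modulus at most 1.\<close>

lemma norm_sdet_cauchy_le:
  assumes "finite J" "\<And>v. v \<in> J \<Longrightarrow> 0 < Re v"
    and "\<And>u v. u \<in> J \<Longrightarrow> v \<in> J \<Longrightarrow> cmod (u - v) \<le> cmod (u + v)"
  shows "cmod (sdet J (\<lambda>u v. g v / (u + v))) \<le> (\<Prod>u\<in>J. cmod (g u / (2 * u)))"
  using assms
proof (induction J rule: finite_induct)
  case (insert w J)
  have "cmod (blaschke J w) \<le> 1" using insert.prems by (intro norm_blaschke_le_1) auto
  then have "cmod (sdet J (\<lambda>u v. g v / (u + v))) * (cmod (g w / (2 * w)) * (cmod (blaschke J w))\<^sup>2) \<le>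
      (\<Prod>u\<in>J. cmod (g u / (2 * u))) * (cmod (g w / (2 * w)) * 1)"
    using insert by (intro mult_mono) (auto simp: power_le_one intro!: prod_nonneg)
  moreover have "sdet (insert w J) (\<lambda>u v. g v / (u + v)) =
      sdet J (\<lambda>u v. g v / (u + v)) * (g w / (2 * w) * (blaschke J w)\<^sup>2)"
    using insert by (intro sdet_cauchy_insert) auto
  ultimately show ?case
    by (simp only: prod.insert[OF insert.hyps(1,2)] norm_mult norm_power mult_ac mult_1_left mult_1_right)
qed simp

subsection \<open>Fredholm determinants as sums over finite subsets\<close>

text \<open>Each n-element set is the image of exactly n! injections of \<open>{..<n}\<close>; this
  is the factor that cancels the 1/n! of the Fredholm series.\<close>

lemma infsum_inj_PiE:
  fixes S :: "'a set \<Rightarrow> complex"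
  assumes "S summable_on {J \<in> Fpow A. card J = n}"
  shows "infsum (\<lambda>p. S (p ` {..<n})) {p \<in> {..<n} \<rightarrow>\<^sub>E A. inj_on p {..<n}} =
      fact n * infsum S {J \<in> Fpow A. card J = n}"
proof -
  let ?F = "{J \<in> Fpow A. card J = n}"
  let ?E = "\<lambda>J. {p \<in> {..<n} \<rightarrow>\<^sub>E J. inj_on p {..<n}}"
  have E: "finite (?E J)" "card (?E J) = fact n" if "J \<in> ?F" for J
  proof -
    have J: "finite J" "card J = n" using that by (auto simp: Fpow_def)
    then have "finite ({..<n} \<rightarrow>\<^sub>E J)" by (intro finite_PiE) simp_all
    then show "finite (?E J)" by (rule rev_finite_subset) (rule Collect_subset)
    have "(fact n :: nat) = prod ((-) n) {0..<n}"
      using fact_prod_rev[of n, where ?'a = nat] by simp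
    then show "card (?E J) = fact n"
      using J card_inj_on_subset_funcset[of "{..<n}" J "{..<n}"] by simp
  qed
  have im: "p ` {..<n} = J" if "J \<in> ?F" "p \<in> ?E J" for J p
  proof (rule card_subset_eq)
    show "finite J" using that by (simp add: Fpow_def)
    show "p ` {..<n} \<subseteq> J" using that by auto
    show "card (p ` {..<n}) = card J" using that by (simp add: card_image)
  qed
  have bij: "bij_betw snd (Sigma ?F ?E) {p \<in> {..<n} \<rightarrow>\<^sub>E A. inj_on p {..<n}}"
  proof (rule bij_betwI[where g = "\<lambda>p. (p ` {..<n}, p)"])
    show "snd \<in> Sigma ?F ?E \<rightarrow> {p \<in> {..<n} \<rightarrow>\<^sub>E A. inj_on p {..<n}}"
    proof
      fix x assume "x \<in> Sigma ?F ?E"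
      then obtain J p where x: "x = (J, p)" "J \<in> ?F" "p \<in> ?E J" by (cases x) auto
      then have "J \<subseteq> A" by (simp add: Fpow_def)
      then have "p \<in> {..<n} \<rightarrow>\<^sub>E A" using x(3) by (auto simp: PiE_iff)
      then show "snd x \<in> {p \<in> {..<n} \<rightarrow>\<^sub>E A. inj_on p {..<n}}" using x by simp
    qed
    show "(\<lambda>p. (p ` {..<n}, p)) \<in> {p \<in> {..<n} \<rightarrow>\<^sub>E A. inj_on p {..<n}} \<rightarrow> Sigma ?F ?E"
    proof
      fix p assume "p \<in> {p \<in> {..<n} \<rightarrow>\<^sub>E A. inj_on p {..<n}}"
      then have p: "p \<in> {..<n} \<rightarrow>\<^sub>E A" "inj_on p {..<n}" by simp_all
      then have "p ` {..<n} \<in> ?F" by (auto simp: Fpow_def card_image)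
      moreover have "p \<in> {..<n} \<rightarrow>\<^sub>E p ` {..<n}" using p(1) by (simp add: PiE_iff)
      ultimately show "(p ` {..<n}, p) \<in> Sigma ?F ?E" using p(2) by simp
    qed
    show "(snd x ` {..<n}, snd x) = x" if "x \<in> Sigma ?F ?E" for x
      using that by (cases x) (simp add: im)
  qed simp
  have s: "(\<lambda>(J, p). S J) summable_on Sigma ?F ?E"
  proof (rule abs_summable_summable, unfold Infinite_Sum.abs_summable_on_Sigma_iff, intro conjI ballI)
    show "(\<lambda>p. norm (case (J, p) of (J, p) \<Rightarrow> S J)) summable_on ?E J" if "J \<in> ?F" for J
      using E[OF that] by auto
    have *: "norm (infsum (\<lambda>p. norm (case (J, p) of (J, p) \<Rightarrow> S J)) (?E J)) = fact n * norm (S J)" if "J \<in> ?F" for J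
      using E[OF that] by (simp add: infsum_finite)
    have "(\<lambda>J. fact n * norm (S J)) summable_on ?F"
      using assms by (intro summable_on_cmult_right) (simp add: summable_on_iff_abs_summable_on_complex)
    moreover have "(\<lambda>J. norm (infsum (\<lambda>p. norm (case (J, p) of (J, p) \<Rightarrow> S J)) (?E J))) summable_on ?F \<longleftrightarrow>
        (\<lambda>J. fact n * norm (S J)) summable_on ?F"
      by (rule summable_on_cong) (rule *)
    ultimately show "(\<lambda>J. norm (infsum (\<lambda>p. norm (case (J, p) of (J, p) \<Rightarrow> S J)) (?E J))) summable_on ?F"
      by (rule iffD2[rotated])
  qed
  have "infsum (\<lambda>p. S (p ` {..<n})) {p \<in> {..<n} \<rightarrow>\<^sub>E A. inj_on p {..<n}} =
      infsum (\<lambda>x. S (snd x ` {..<n})) (Sigma ?F ?E)"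
    by (rule infsum_reindex_bij_betw[OF bij, symmetric])
  also have "\<dots> = infsum (\<lambda>(J, p). S J) (Sigma ?F ?E)"
  proof (rule infsum_cong)
    fix x assume "x \<in> Sigma ?F ?E"
    then obtain J p where "x = (J, p)" "J \<in> ?F" "p \<in> ?E J" by (cases x) auto
    then show "S (snd x ` {..<n}) = (case x of (J, p) \<Rightarrow> S J)"
      using im[of J p] by simp
  qed
  also have "\<dots> = infsum (\<lambda>J. infsum (\<lambda>p. S J) (?E J)) ?F"
    by (rule infsum_Sigma'_banach[OF s, symmetric])
  also have "\<dots> = infsum (\<lambda>J. fact n * S J) ?F"
    using E by (intro infsum_cong) (simp add: infsum_finite)
  finally show ?thesis by (simp add: infsum_cmult_right')
qed

text \<open>Tuples with a repeated point give equal rows and drop out; the others are grouped by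
  image. Summing over n then reassembles \<open>Fpow A\<close> from its layers of fixed
  cardinality.\<close>

lemma fredholm_det_eq_infsum:
  assumes "(\<lambda>J. sdet J K) summable_on Fpow A"
  shows "fredholm_det A K = infsum (\<lambda>J. (-1) ^ card J * sdet J K) (Fpow A)"
proof -
  let ?F = "\<lambda>n. {J \<in> Fpow A. card J = n}"
  let ?f = "\<lambda>J. (-1) ^ card J * sdet J K"
  have sn: "(\<lambda>J. sdet J K) summable_on ?F n" for n
    using assms by (rule summable_on_subset_banach) auto
  have inner: "infsum (\<lambda>p. Determinant.det (Matrix.mat n n (\<lambda>(i, j). K (p i) (p j)))) ({..<n} \<rightarrow>\<^sub>E A) =
      fact n * infsum (\<lambda>J. sdet J K) (?F n)" for n
  proof -
    have "infsum (\<lambda>p. Determinant.det (Matrix.mat n n (\<lambda>(i, j). K (p i) (p j)))) ({..<n} \<rightarrow>\<^sub>E A) =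
        infsum (\<lambda>p. sdet (p ` {..<n}) K) {p \<in> {..<n} \<rightarrow>\<^sub>E A. inj_on p {..<n}}"
      by (rule infsum_cong_neutral) (auto simp: det_mat_inj_eq_sdet det_mat_not_inj_eq_0)
    then show ?thesis using infsum_inj_PiE[OF sn] by simp
  qed
  have sf: "?f summable_on Fpow A"
    using assms by (subst summable_on_iff_abs_summable_on_complex)
      (simp add: norm_mult norm_power summable_on_iff_abs_summable_on_complex)
  have bij: "bij_betw snd (Sigma UNIV ?F) (Fpow A)"
    by (rule bij_betwI[where g = "\<lambda>J. (card J, J)"]) auto
  have s: "(\<lambda>(n, J). ?f J) summable_on Sigma UNIV ?F"
    using sf summable_on_reindex_bij_betw[OF bij, of ?f] by (simp add: case_prod_unfold)
  have "(\<lambda>n. infsum ?f (?F n)) sums infsum (\<lambda>n. infsum ?f (?F n)) UNIV"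
    using summable_on_Sigma_banach[OF s] by (intro has_sum_imp_sums has_sum_infsum)
  moreover have "infsum ?f (?F n) = (-1) ^ n / fact n * (fact n * infsum (\<lambda>J. sdet J K) (?F n))" for n
  proof -
    have "infsum ?f (?F n) = infsum (\<lambda>J. (-1) ^ n * sdet J K) (?F n)"
      by (intro infsum_cong) auto
    then show ?thesis by (simp add: infsum_cmult_right')
  qed
  moreover have "infsum (\<lambda>n. infsum ?f (?F n)) UNIV = infsum ?f (Fpow A)"
    using infsum_Sigma'_banach[OF s] infsum_reindex_bij_betw[OF bij, of ?f]
    by (simp add: case_prod_unfold)
  ultimately show ?thesis
    unfolding fredholm_det_def inner by (simp only: sums_unique[symmetric])
qed

text \<open>With B listed before its mirror image, I - H has identity diagonal blocks and both
  off-diagonal blocks equal to M, so its determinant is that of I - M^2 = (I - M)(I + M).\<close>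

lemma sdet_block_antidiagonal:
  assumes "finite B" "\<And>u. u \<in> B \<Longrightarrow> 0 < Re u"
    and "\<And>u v. u \<in> B \<Longrightarrow> v \<in> B \<Longrightarrow> H u v = 0 \<and> H (- u) (- v) = 0 \<and> H u (- v) = - M u v \<and> H (- u) v = - M u v"
  shows "sdet (B \<union> uminus ` B) (\<lambda>i j. (if i = j then 1 else 0) - H i j) =
    sdet B (\<lambda>i j. (if i = j then 1 else 0) - M i j) * sdet B (\<lambda>i j. (if i = j then 1 else 0) + M i j)"
proof -
  define m where "m = card B"
  obtain p where p: "bij_betw p {..<m} B"
    using ex_bij_betw_nat_finite[OF assms(1)] by (auto simp: m_def lessThan_atLeast0)
  have pB: "p i \<in> B" if "i < m" for i using p that by (auto simp: bij_betw_def)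
  have pinj: "p i = p j \<longleftrightarrow> i = j" if "i < m" "j < m" for i j
    using p that by (auto simp: bij_betw_def inj_on_def)
  have pneg: "p i \<noteq> - p j" if "i < m" "j < m" for i j
    using assms(2)[OF pB[OF that(1)]] assms(2)[OF pB[OF that(2)]] by (auto simp: complex_eq_iff)
  have pneg': "- p i \<noteq> p j" if "i < m" "j < m" for i j
    using pneg[OF that(2) that(1)] by auto
  \<comment> \<open>Indices below m list B, the remaining m indices list its negatives in the same
    order.\<close>
  define q where "q i = (if i < m then p i else - p (i - m))" for i
  have qinj: "inj_on q {..<m + m}"
  proof (rule inj_onI)
    fix i j assume ij: "i \<in> {..<m + m}" "j \<in> {..<m + m}" "q i = q j"
    consider "i < m" "j < m" | "i < m" "\<not> j < m" "j - m < m" | "\<not> i < m" "j < m" "i - m < m"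
      | "\<not> i < m" "\<not> j < m" "i - m < m" "j - m < m"
      using ij(1,2) unfolding lessThan_iff by linarith
    then show "i = j"
    proof cases
      case 4
      then show ?thesis using ij(3) pinj[of "i - m" "j - m"] by (simp add: q_def)
    qed (use ij(3) pinj pneg pneg' in \<open>simp_all add: q_def\<close>)
  qed
  have qim: "q ` {..<m + m} = B \<union> uminus ` B"
  proof -
    have "i \<in> (\<lambda>i. i + m) ` {..<m}" if "i < m + m" "\<not> i < m" for i
      using that by (intro image_eqI[of _ _ "i - m"]) auto
    then have "{..<m + m} = {..<m} \<union> (\<lambda>i. i + m) ` {..<m}" by auto
    moreover have "q ` {..<m} = B" using p by (auto simp: q_def bij_betw_def)
    moreover have "q ` (\<lambda>i. i + m) ` {..<m} = uminus ` p ` {..<m}"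
      unfolding image_image by (intro image_cong refl) (simp add: q_def)
    ultimately show ?thesis using p by (simp add: image_Un bij_betw_def)
  qed
  let ?M = "Matrix.mat m m (\<lambda>(i, j). M (p i) (p j))"
  let ?L = "\<lambda>i j. (if i = j then 1 else 0) - H i j"
  have M: "?M \<in> carrier_mat m m" by simp
  have blk: "Matrix.mat (m + m) (m + m) (\<lambda>(i, j). ?L (q i) (q j)) = four_block_mat (1\<^sub>m m) ?M ?M (1\<^sub>m m)"
  proof (rule eq_matI)
    fix i j assume "i < dim_row (four_block_mat (1\<^sub>m m) ?M ?M (1\<^sub>m m))"
      "j < dim_col (four_block_mat (1\<^sub>m m) ?M ?M (1\<^sub>m m))"
    then have ij: "i < m + m" "j < m + m" by simp_all
    have e: "?L (p i) (p j) = (if i = j then 1 else 0)" "?L (- p i) (- p j) = (if i = j then 1 else 0)"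
      "?L (p i) (- p j) = M (p i) (p j)" "?L (- p i) (p j) = M (p i) (p j)" if "i < m" "j < m" for i j
      using assms(3)[OF pB[OF that(1)] pB[OF that(2)]] pinj[OF that] pneg[OF that] pneg'[OF that] by simp_all
    consider "i < m" "j < m" | "i < m" "\<not> j < m" "j - m < m" | "\<not> i < m" "j < m" "i - m < m"
      | "\<not> i < m" "\<not> j < m" "i - m < m" "j - m < m"
      using ij by linarith
    then show "Matrix.mat (m + m) (m + m) (\<lambda>(i, j). ?L (q i) (q j)) $$ (i, j) =
        four_block_mat (1\<^sub>m m) ?M ?M (1\<^sub>m m) $$ (i, j)"
    proof cases
      case 4
      then have "i - m = j - m \<longleftrightarrow> i = j" by linarith
      with 4 show ?thesis using ij e(2)[of "i - m" "j - m"] by (simp add: q_def)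
    qed (use ij e in \<open>simp_all add: q_def\<close>)
  qed auto
  have "sdet (B \<union> uminus ` B) ?L = Determinant.det (four_block_mat (1\<^sub>m m) ?M ?M (1\<^sub>m m))"
    unfolding qim[symmetric] blk[symmetric] by (rule det_mat_inj_eq_sdet[OF qinj, symmetric])
  also have "\<dots> = Determinant.det (1\<^sub>m m * 1\<^sub>m m - ?M * ?M)"
    by (rule det_four_block_mat) auto
  also have "1\<^sub>m m * 1\<^sub>m m - ?M * ?M = (1\<^sub>m m - ?M) * (1\<^sub>m m + ?M)"
  proof -
    have "(1\<^sub>m m - ?M) * (1\<^sub>m m + ?M) = 1\<^sub>m m * (1\<^sub>m m + ?M) - ?M * (1\<^sub>m m + ?M)"
      using M by (intro minus_mult_distrib_mat[of _ m m]) auto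
    also have "?M * (1\<^sub>m m + ?M) = ?M * 1\<^sub>m m + ?M * ?M"
      using M by (intro mult_add_distrib_mat[of _ m m]) auto
    also have "1\<^sub>m m * (1\<^sub>m m + ?M) - (?M * 1\<^sub>m m + ?M * ?M) = 1\<^sub>m m * 1\<^sub>m m - ?M * ?M"
      using M by (auto simp: left_mult_one_mat[of _ m m] right_mult_one_mat[of _ m m] intro!: eq_matI)
    finally show ?thesis ..
  qed
  also have "Determinant.det \<dots> = Determinant.det (1\<^sub>m m - ?M) * Determinant.det (1\<^sub>m m + ?M)"
    by (rule det_mult[of _ m]) auto
  also have "1\<^sub>m m - ?M = Matrix.mat m m (\<lambda>(i, j). (if p i = p j then 1 else 0) - M (p i) (p j))"
    using pinj by (auto intro!: eq_matI)
  also have "Determinant.det \<dots> = sdet B (\<lambda>i j. (if i = j then 1 else 0) - M i j)"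
    using p det_mat_inj_eq_sdet[of p m "\<lambda>i j. (if i = j then 1 else 0) - M i j"] by (simp add: bij_betw_def)
  also have "1\<^sub>m m + ?M = Matrix.mat m m (\<lambda>(i, j). (if p i = p j then 1 else 0) + M (p i) (p j))"
    using pinj by (auto intro!: eq_matI)
  also have "Determinant.det \<dots> = sdet B (\<lambda>i j. (if i = j then 1 else 0) + M i j)"
    using p det_mat_inj_eq_sdet[of p m "\<lambda>i j. (if i = j then 1 else 0) + M i j"] by (simp add: bij_betw_def)
  finally show ?thesis .
qed

text \<open>A bound of product form makes each row sum at most a constant times b u, and the
  products of these are summable over finite subsets.\<close>

lemma summable_on_sdet:
  assumes "b summable_on A" "\<And>u. u \<in> A \<Longrightarrow> 0 \<le> b u"
    and "\<And>u v. u \<in> A \<Longrightarrow> v \<in> A \<Longrightarrow> cmod (K u v) \<le> c * b u * b v" and "0 \<le> c"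
  shows "(\<lambda>J. sdet J K) summable_on Fpow A"
proof (rule summable_on_norm_bound)
  let ?S = "infsum b A"
  have S: "0 \<le> ?S" using assms(2) by (rule infsum_nonneg)
  show "(\<lambda>J. \<Prod>u\<in>J. c * ?S * b u) summable_on Fpow A"
    using assms S by (intro summable_on_prod_Fpow summable_on_cmult_right) auto
  show "norm (sdet J K) \<le> (\<Prod>u\<in>J. c * ?S * b u)" if "J \<in> Fpow A" for J
  proof -
    have J: "finite J" "J \<subseteq> A" using that by (auto simp: Fpow_def)
    have "(\<Sum>v\<in>J. cmod (K u v)) \<le> c * ?S * b u" if "u \<in> J" for u
    proof -
      have "(\<Sum>v\<in>J. cmod (K u v)) \<le> (\<Sum>v\<in>J. c * b u * b v)"
        using J that assms(3) by (intro sum_mono) auto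
      also have "\<dots> = c * b u * sum b J" by (simp add: sum_distrib_left)
      also have "\<dots> \<le> c * b u * ?S"
        using J that assms by (intro mult_left_mono finite_sum_le_infsum) auto
      finally show ?thesis by (simp add: mult_ac)
    qed
    then have "(\<Prod>u\<in>J. \<Sum>v\<in>J. cmod (K u v)) \<le> (\<Prod>u\<in>J. c * ?S * b u)"
      by (intro prod_mono) (auto intro: sum_nonneg)
    then show ?thesis using norm_sdet_le[OF J(1), of K] by linarith
  qed
qed

lemma sdet_uminus: "finite J \<Longrightarrow> sdet J (\<lambda>i j. - K i j) = (-1) ^ card J * sdet J K"
  by (simp add: sdet_def prod_uminus sum_distrib_left mult_ac)

text \<open>The factorisation is exact for the truncation to B and -B. These symmetric sets are
  cofinal among the finite subsets of the doubled set, so both sides pass to the limit.\<close>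

lemma fredholm_det_block_antidiagonal:
  assumes "\<And>u. u \<in> A \<Longrightarrow> 0 < Re u"
    and "\<And>u v. u \<in> A \<Longrightarrow> v \<in> A \<Longrightarrow> H u v = 0 \<and> H (- u) (- v) = 0 \<and> H u (- v) = - M u v \<and> H (- u) v = - M u v"
    and sM: "(\<lambda>J. sdet J M) summable_on Fpow A"
    and sH: "(\<lambda>J. sdet J H) summable_on Fpow (A \<union> uminus ` A)"
  shows "fredholm_det (A \<union> uminus ` A) H =
    infsum (\<lambda>J. (-1) ^ card J * sdet J M) (Fpow A) * infsum (\<lambda>J. sdet J M) (Fpow A)"
proof -
  let ?C = "A \<union> uminus ` A"
  have s: "(\<lambda>J. (-1) ^ card J * f J) summable_on F"
    if "f summable_on F" for f :: "complex set \<Rightarrow> complex" and F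
    using that by (subst summable_on_iff_abs_summable_on_complex)
      (simp add: norm_mult norm_power summable_on_iff_abs_summable_on_complex)
  have lim: "filterlim (\<lambda>B. B \<union> uminus ` B) (finite_subsets_at_top ?C) (finite_subsets_at_top A)"
    unfolding filterlim_finite_subsets_at_top
  proof (intro allI impI)
    fix X assume X: "finite X \<and> X \<subseteq> ?C"
    have "\<forall>\<^sub>F B in finite_subsets_at_top A. finite B \<and> (X \<union> uminus ` X) \<inter> A \<subseteq> B \<and> B \<subseteq> A"
      unfolding eventually_finite_subsets_at_top
      by (intro exI[of _ "(X \<union> uminus ` X) \<inter> A"]) (use X in auto)
    then show "\<forall>\<^sub>F B in finite_subsets_at_top A.
        finite (B \<union> uminus ` B) \<and> X \<subseteq> B \<union> uminus ` B \<and> B \<union> uminus ` B \<subseteq> ?C"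
    proof eventually_elim
      case (elim B)
      have "x \<in> B \<union> uminus ` B" if "x \<in> X" for x
      proof -
        have "x \<in> A \<or> - x \<in> A" using X that by auto
        then have "x \<in> B \<or> - x \<in> B" using elim that by auto
        then show ?thesis by force
      qed
      then show ?case using elim by auto
    qed
  qed
  have "((\<lambda>B. \<Sum>J\<in>Pow B. (-1) ^ card J * sdet J H) \<longlongrightarrow> fredholm_det ?C H) (finite_subsets_at_top ?C)"
    unfolding fredholm_det_eq_infsum[OF sH] by (intro tendsto_sum_Pow has_sum_infsum s sH)
  from filterlim_compose[OF this lim]
  have 1: "((\<lambda>B. \<Sum>J\<in>Pow (B \<union> uminus ` B). (-1) ^ card J * sdet J H) \<longlongrightarrow> fredholm_det ?C H)
      (finite_subsets_at_top A)" .
  have 2: "((\<lambda>B. (\<Sum>J\<in>Pow B. (-1) ^ card J * sdet J M) * (\<Sum>J\<in>Pow B. sdet J M)) \<longlongrightarrow>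
      infsum (\<lambda>J. (-1) ^ card J * sdet J M) (Fpow A) * infsum (\<lambda>J. sdet J M) (Fpow A))
      (finite_subsets_at_top A)"
    by (intro tendsto_mult tendsto_sum_Pow has_sum_infsum s sM)
  have "\<forall>\<^sub>F B in finite_subsets_at_top A. finite B \<and> B \<subseteq> A"
    by (simp add: eventually_finite_subsets_at_top_weakI)
  then have ev: "\<forall>\<^sub>F B in finite_subsets_at_top A.
      (\<Sum>J\<in>Pow (B \<union> uminus ` B). (-1) ^ card J * sdet J H) =
      (\<Sum>J\<in>Pow B. (-1) ^ card J * sdet J M) * (\<Sum>J\<in>Pow B. sdet J M)"
  proof eventually_elim
    case (elim B)
    then have fin: "finite B" "finite (B \<union> uminus ` B)" by auto
    have plus: "(\<Sum>J\<in>Pow B. sdet J M) = sdet B (\<lambda>i j. (if i = j then 1 else 0) + M i j)"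
    proof -
      have "sdet B (\<lambda>i j. (if i = j then 1 else 0) - (- M i j)) = (\<Sum>J\<in>Pow B. (-1) ^ card J * sdet J (\<lambda>i j. - M i j))"
        by (rule sdet_id_minus[OF fin(1)])
      also have "\<dots> = (\<Sum>J\<in>Pow B. sdet J M)"
        using fin(1) by (intro sum.cong refl)
          (auto simp: sdet_uminus finite_subset power_mult_distrib[symmetric] simp flip: mult.assoc)
      finally show ?thesis by simp
    qed
    show ?case
      unfolding plus sdet_id_minus[OF fin(1), symmetric] sdet_id_minus[OF fin(2), symmetric]
      by (rule sdet_block_antidiagonal) (use elim assms(1,2) in auto)
  qed
  have "((\<lambda>B. \<Sum>J\<in>Pow (B \<union> uminus ` B). (-1) ^ card J * sdet J H) \<longlongrightarrow>
      infsum (\<lambda>J. (-1) ^ card J * sdet J M) (Fpow A) * infsum (\<lambda>J. sdet J M) (Fpow A))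
      (finite_subsets_at_top A)"
    using 2 by (rule Lim_transform_eventually) (use ev in \<open>auto elim: eventually_mono\<close>)
  then show ?thesis
    using 1 by (intro tendsto_unique[OF finite_subsets_at_top_neq_bot])
qed

subsection \<open>Tau functions and their wave functions\<close>

text \<open>Dominates the exponents of both the x- and the \<tau>-flow.\<close>
definition wt :: "complex \<Rightarrow> real" where
  "wt u = cmod u + cmod u ^ 3"

lemma wt_nonneg [simp]: "0 \<le> wt u"
  by (simp add: wt_def)

lemma cmod_le_wt: "cmod u \<le> wt u" "cmod u ^ 3 \<le> wt u"
  by (simp_all add: wt_def)

lemma norm_psum_le_wt: "cmod (psum 1 J) \<le> sum wt J" "cmod (psum 3 J) \<le> sum wt J"
  unfolding psum_def by (auto intro!: sum_norm_le simp: norm_power cmod_le_wt)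

text \<open>One term of the exponential series, taken at \<epsilon> (1 + s). It converts polynomial
  weights, such as powers of p_1, into a small loss in the exponent.\<close>

lemma power_le_exp_bound:
  assumes "0 < \<epsilon>"
  obtains C :: real where "0 \<le> C" "\<And>s. 0 \<le> s \<Longrightarrow> (1 + s) ^ k \<le> C * exp (\<epsilon> * s)"
proof
  let ?C = "fact k / \<epsilon> ^ k * exp \<epsilon>"
  show "0 \<le> ?C" using assms by simp
  show "(1 + s) ^ k \<le> ?C * exp (\<epsilon> * s)" if "0 \<le> s" for s
  proof -
    have "(\<lambda>n. (\<epsilon> * (1 + s)) ^ n /\<^sub>R fact n) sums exp (\<epsilon> * (1 + s))" by (rule exp_converges)
    moreover have "0 \<le> (\<epsilon> * (1 + s)) ^ n /\<^sub>R fact n" for n using assms that by simp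
    ultimately have "(\<epsilon> * (1 + s)) ^ k /\<^sub>R fact k \<le> exp (\<epsilon> * (1 + s))"
      using sum_le_suminf[of "\<lambda>n. (\<epsilon> * (1 + s)) ^ n /\<^sub>R fact n" "{k}"] by (simp add: sums_iff)
    moreover have "exp (\<epsilon> * (1 + s)) = exp \<epsilon> * exp (\<epsilon> * s)" by (simp add: distrib_left exp_add)
    ultimately show ?thesis using assms
      by (simp add: power_mult_distrib divide_simps mult_ac)
  qed
qed

text \<open>The term of J in the expansion of det(I + \<sigma> M), with the weights of the symmetric
  kernel moved to the columns by a diagonal conjugation.\<close>

definition kappa :: "(complex \<Rightarrow> complex) \<Rightarrow> complex \<Rightarrow> complex set \<Rightarrow> complex" where
  "kappa g \<sigma> J = \<sigma> ^ card J * sdet J (\<lambda>u v. g v / (u + v))"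

definition tau_fun ::
  "complex set \<Rightarrow> (complex \<Rightarrow> complex) \<Rightarrow> complex \<Rightarrow> (complex set \<Rightarrow> complex) \<Rightarrow> complex" where
  "tau_fun A g \<sigma> \<phi> = infsum (\<lambda>J. kappa g \<sigma> J * \<phi> J) (Fpow A)"

text \<open>By column scaling this is the tau series with g v replaced by g v (u - v)/(u + v), the
  analogue of the Baker-Akhiezer function of soliton theory.\<close>

definition wave_fun ::
  "complex set \<Rightarrow> (complex \<Rightarrow> complex) \<Rightarrow> complex \<Rightarrow> (complex set \<Rightarrow> complex) \<Rightarrow> complex \<Rightarrow> complex" where
  "wave_fun A g \<sigma> \<phi> u = infsum (\<lambda>J. kappa g \<sigma> J * \<phi> J * blaschke J u) (Fpow A)"

text \<open>\<delta> bounds 1/(u + v), \<open>sector\<close> bounds the Blaschke factors, and the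
  exponential margin \<epsilon> pays for polynomial weights and for moving along the two
  flows.\<close>

locale tau_data =
  fixes A :: "complex set" and g :: "complex \<Rightarrow> complex" and \<delta> \<epsilon> :: real
  assumes \<delta>: "0 < \<delta>" and Re_ge: "\<And>u. u \<in> A \<Longrightarrow> \<delta> \<le> Re u"
    and sector: "\<And>u v. u \<in> A \<Longrightarrow> v \<in> A \<Longrightarrow> cmod (u - v) \<le> cmod (u + v)"
    and \<epsilon>: "0 < \<epsilon>" and summable_g: "(\<lambda>u. cmod (g u) * exp (\<epsilon> * wt u)) summable_on A"
begin

lemma Re_pos: "u \<in> A \<Longrightarrow> 0 < Re u"
  using \<delta> Re_ge[of u] by linarith

lemma add_nonzero: "u \<in> A \<Longrightarrow> v \<in> A \<Longrightarrow> u + v \<noteq> 0"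
  using Re_pos by (intro add_neq_0_of_Re_pos)

lemma norm_inverse_add_le:
  assumes "u \<in> A" "v \<in> A"
  shows "cmod (1 / (u + v)) \<le> 1 / (2 * \<delta>)"
proof -
  have "2 * \<delta> \<le> Re (u + v)" using Re_ge[OF assms(1)] Re_ge[OF assms(2)] by simp
  also have "\<dots> \<le> cmod (u + v)" by (rule complex_Re_le_cmod)
  finally show ?thesis using \<delta> by (simp add: norm_divide frac_le)
qed

lemma norm_blaschke_le: "J \<in> Fpow A \<Longrightarrow> u \<in> A \<Longrightarrow> cmod (blaschke J u) \<le> 1"
  using sector by (intro norm_blaschke_le_1) (auto simp: Fpow_def)

abbreviation "\<kappa> \<equiv> kappa g"
abbreviation "tau \<equiv> tau_fun A g"
abbreviation "wave \<equiv> wave_fun A g"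

lemma \<kappa>_insert:
  assumes "J \<in> Fpow A" "w \<in> A" "w \<notin> J"
  shows "\<kappa> \<sigma> (insert w J) = \<kappa> \<sigma> J * (\<sigma> * g w / (2 * w) * (blaschke J w)\<^sup>2)"
proof -
  have "sdet (insert w J) (\<lambda>u v. g v / (u + v)) =
      sdet J (\<lambda>u v. g v / (u + v)) * (g w / (2 * w) * (blaschke J w)\<^sup>2)"
    using assms Re_pos by (intro sdet_cauchy_insert) (auto simp: Fpow_def)
  then show ?thesis using assms by (simp add: kappa_def Fpow_def)
qed

lemma norm_\<kappa>_le:
  assumes "J \<in> Fpow A" "cmod \<sigma> \<le> 1"
  shows "cmod (\<kappa> \<sigma> J) \<le> (\<Prod>u\<in>J. cmod (g u) / (2 * \<delta>))"
proof -
  have J: "finite J" "J \<subseteq> A" using assms by (auto simp: Fpow_def)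
  have "cmod (sdet J (\<lambda>u v. g v / (u + v))) \<le> (\<Prod>u\<in>J. cmod (g u / (2 * u)))"
    using J Re_pos sector by (intro norm_sdet_cauchy_le) blast+
  also have "\<dots> \<le> (\<Prod>u\<in>J. cmod (g u) / (2 * \<delta>))"
  proof (intro prod_mono conjI)
    fix u assume "u \<in> J"
    then have "\<delta> \<le> cmod u" using J Re_ge[of u] complex_Re_le_cmod[of u] by auto
    then show "cmod (g u / (2 * u)) \<le> cmod (g u) / (2 * \<delta>)"
      using \<delta> by (auto simp: norm_divide norm_mult intro!: divide_left_mono mult_pos_pos)
  qed simp
  finally have "cmod \<sigma> ^ card J * cmod (sdet J (\<lambda>u v. g v / (u + v))) \<le> 1 * (\<Prod>u\<in>J. cmod (g u) / (2 * \<delta>))"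
    using assms(2) by (intro mult_mono power_le_one) auto
  then show ?thesis by (simp add: kappa_def norm_mult norm_power)
qed

text \<open>The Cauchy bound and exp(\<epsilon> \<open>sum wt J\<close>) are both products over J,
  so \<open>summable_on_prod_Fpow\<close> applies. Weighted series are majorised by multiples of
  this one.\<close>

lemma summable_\<kappa>_exp:
  assumes "cmod \<sigma> \<le> 1"
  shows "(\<lambda>J. cmod (\<kappa> \<sigma> J) * exp (\<epsilon> * sum wt J)) summable_on Fpow A"
proof (rule summable_on_comparison_test)
  show "(\<lambda>J. \<Prod>u\<in>J. 1 / (2 * \<delta>) * (cmod (g u) * exp (\<epsilon> * wt u))) summable_on Fpow A"
    using summable_g \<delta> by (intro summable_on_prod_Fpow summable_on_cmult_right) auto
  show "cmod (\<kappa> \<sigma> J) * exp (\<epsilon> * sum wt J) \<le> (\<Prod>u\<in>J. 1 / (2 * \<delta>) * (cmod (g u) * exp (\<epsilon> * wt u)))"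
    if "J \<in> Fpow A" for J
  proof -
    have "exp (\<epsilon> * sum wt J) = (\<Prod>u\<in>J. exp (\<epsilon> * wt u))"
      using that by (simp add: exp_sum Fpow_def sum_distrib_left)
    then have "cmod (\<kappa> \<sigma> J) * exp (\<epsilon> * sum wt J) \<le>
        (\<Prod>u\<in>J. cmod (g u) / (2 * \<delta>)) * (\<Prod>u\<in>J. exp (\<epsilon> * wt u))"
      using norm_\<kappa>_le[OF that assms] by (simp add: mult_right_mono prod_nonneg)
    then show ?thesis by (simp add: prod.distrib[symmetric])
  qed
qed simp

lemma norm_\<kappa>_mult_le:
  assumes "cmod \<phi> \<le> C * (1 + sum wt J) ^ k" "0 \<le> C'" "\<And>s. 0 \<le> s \<Longrightarrow> (1 + s) ^ k \<le> C' * exp (\<epsilon> * s)" "0 \<le> C"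
  shows "cmod (\<kappa> \<sigma> J * \<phi>) \<le> C * C' * (cmod (\<kappa> \<sigma> J) * exp (\<epsilon> * sum wt J))"
proof -
  have "C * (1 + sum wt J) ^ k \<le> C * (C' * exp (\<epsilon> * sum wt J))"
    using assms(3)[of "sum wt J"] assms(4) sum_nonneg[of J wt] by (intro mult_left_mono) auto
  then have "cmod \<phi> \<le> C * (C' * exp (\<epsilon> * sum wt J))" using assms(1) by linarith
  then have "cmod (\<kappa> \<sigma> J) * cmod \<phi> \<le> cmod (\<kappa> \<sigma> J) * (C * (C' * exp (\<epsilon> * sum wt J)))"
    by (rule mult_left_mono) simp
  then show ?thesis by (simp add: norm_mult mult_ac)
qed

lemma summable_tau:
  assumes "cmod \<sigma> \<le> 1" "\<And>J. J \<in> Fpow A \<Longrightarrow> cmod (\<phi> J) \<le> C * (1 + sum wt J) ^ k" "0 \<le> C"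
  shows "(\<lambda>J. \<kappa> \<sigma> J * \<phi> J) summable_on Fpow A"
proof -
  obtain C' where C': "0 \<le> C'" "\<And>s. 0 \<le> s \<Longrightarrow> (1 + s) ^ k \<le> C' * exp (\<epsilon> * s)"
    using power_le_exp_bound[OF \<epsilon>] by blast
  show ?thesis
    by (rule summable_on_norm_bound[OF summable_on_cmult_right[OF summable_\<kappa>_exp[OF assms(1)], of "C * C'"]])
      (rule norm_\<kappa>_mult_le[OF assms(2) C' assms(3)])
qed

lemma summable_wave:
  assumes "cmod \<sigma> \<le> 1" "\<And>J. J \<in> Fpow A \<Longrightarrow> cmod (\<phi> J) \<le> C * (1 + sum wt J) ^ k" "0 \<le> C" "u \<in> A"
  shows "(\<lambda>J. \<kappa> \<sigma> J * \<phi> J * blaschke J u) summable_on Fpow A"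
proof -
  have "cmod (\<phi> J * blaschke J u) \<le> C * (1 + sum wt J) ^ k" if "J \<in> Fpow A" for J
  proof -
    have "cmod (\<phi> J) * cmod (blaschke J u) \<le> C * (1 + sum wt J) ^ k * 1"
      using assms(2)[OF that] norm_blaschke_le[OF that assms(4)] assms(3)
      by (intro mult_mono) (auto intro!: mult_nonneg_nonneg zero_le_power add_nonneg_nonneg sum_nonneg)
    then show ?thesis by (simp add: norm_mult)
  qed
  from summable_tau[of \<sigma> "\<lambda>J. \<phi> J * blaschke J u", OF assms(1) this assms(3)]
  show ?thesis by (simp add: mult_ac)
qed

text \<open>Uniform in u, because the Blaschke factors have modulus at most 1 on A; this admits wave
  functions under further sums over A.\<close>

lemma norm_wave_le:
  assumes "cmod \<sigma> \<le> 1" "\<And>J. J \<in> Fpow A \<Longrightarrow> cmod (\<phi> J) \<le> C * (1 + sum wt J) ^ k" "0 \<le> C"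
  obtains K where "0 \<le> K" "\<And>u. u \<in> A \<Longrightarrow> cmod (wave \<sigma> \<phi> u) \<le> K"
proof
  have s: "(\<lambda>J. norm (\<kappa> \<sigma> J * \<phi> J)) summable_on Fpow A"
    using summable_tau[OF assms] by (simp add: summable_on_iff_abs_summable_on_complex)
  let ?K = "infsum (\<lambda>J. norm (\<kappa> \<sigma> J * \<phi> J)) (Fpow A)"
  show "0 \<le> ?K" by (rule infsum_nonneg) simp
  show "cmod (wave \<sigma> \<phi> u) \<le> ?K" if "u \<in> A" for u
    unfolding wave_fun_def
  proof (rule norm_infsum_le)
    show "((\<lambda>J. \<kappa> \<sigma> J * \<phi> J * blaschke J u) has_sum infsum (\<lambda>J. \<kappa> \<sigma> J * \<phi> J * blaschke J u) (Fpow A)) (Fpow A)"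
      using summable_wave[OF assms that] by simp
    show "((\<lambda>J. norm (\<kappa> \<sigma> J * \<phi> J)) has_sum ?K) (Fpow A)" using s by simp
    show "cmod (\<kappa> \<sigma> J * \<phi> J * blaschke J u) \<le> norm (\<kappa> \<sigma> J * \<phi> J)" if "J \<in> Fpow A" for J
      using norm_blaschke_le[OF that \<open>u \<in> A\<close>] by (simp add: norm_mult mult_left_le)
  qed
qed

text \<open>Adding w multiplies \<open>\<kappa> \<sigma> J\<close> by \<sigma> g(w) B^2 / (2 w),
  where B = \<open>blaschke J w\<close>. So \<sigma> g(w) B times the term of J is the enlarged term
  times 2 w / B, its partial-fraction coefficient, and applying the operator to a wave function
  becomes a finite residue sum inside each term.\<close>

lemma residue_sum:
  assumes \<sigma>: "cmod \<sigma> \<le> 1" and C: "0 \<le> C"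
    and \<omega>: "\<And>w J. w \<in> A \<Longrightarrow> J \<in> Fpow A \<Longrightarrow> w \<notin> J \<Longrightarrow> cmod (\<omega> w J) \<le> C * (1 + (wt w + sum wt J)) ^ k"
  shows "\<sigma> * infsum (\<lambda>w. g w * infsum (\<lambda>J. \<kappa> \<sigma> J * \<omega> w J * blaschke J w) (Fpow A)) A =
      infsum (\<lambda>J. \<kappa> \<sigma> J * (\<Sum>w\<in>J. pf_coeff J w * \<omega> w (J - {w}))) (Fpow A)"
proof -
  define f where "f w J = \<sigma> * g w * (\<kappa> \<sigma> J * \<omega> w J * blaschke J w)" for w J
  obtain C' where C': "0 \<le> C'" "\<And>s. 0 \<le> s \<Longrightarrow> (1 + s) ^ k \<le> C' * exp (\<epsilon> * s)"
    using power_le_exp_bound[OF \<epsilon>] by blast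
  let ?S = "SIGMA w:A. {J \<in> Fpow A. w \<notin> J}"
  have summ: "(\<lambda>(w, J). f w J) summable_on ?S"
  proof (rule summable_on_norm_bound)
    have "(\<lambda>(w, J). (C * C' * (cmod (g w) * exp (\<epsilon> * wt w))) * (cmod (\<kappa> \<sigma> J) * exp (\<epsilon> * sum wt J)))
        summable_on A \<times> Fpow A"
      using C C' by (intro summable_on_times_real summable_on_cmult_right summable_g summable_\<kappa>_exp \<sigma>) auto
    then show "(\<lambda>(w, J). (C * C' * (cmod (g w) * exp (\<epsilon> * wt w))) * (cmod (\<kappa> \<sigma> J) * exp (\<epsilon> * sum wt J)))
        summable_on ?S"
      by (rule summable_on_subset_banach) auto
    fix p assume "p \<in> ?S"
    then obtain w J where p: "p = (w, J)" "w \<in> A" "J \<in> Fpow A" "w \<notin> J" by auto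
    have "C * (1 + (wt w + sum wt J)) ^ k \<le> C * (C' * exp (\<epsilon> * (wt w + sum wt J)))"
      using C C'(2)[of "wt w + sum wt J"] sum_nonneg[of J wt] by (intro mult_left_mono) auto
    then have w: "cmod (\<omega> w J) \<le> C * (C' * exp (\<epsilon> * (wt w + sum wt J)))"
      using \<omega>[OF p(2-4)] by linarith
    have "cmod \<sigma> * cmod (blaschke J w) * (cmod (g w) * (cmod (\<kappa> \<sigma> J) * cmod (\<omega> w J))) \<le>
       1 * 1 * (cmod (g w) * (cmod (\<kappa> \<sigma> J) * (C * (C' * exp (\<epsilon> * (wt w + sum wt J))))))"
      using \<sigma> norm_blaschke_le[OF p(3,2)] w by (intro mult_mono) auto
    then show "norm (case p of (w, J) \<Rightarrow> f w J) \<le> (case p of (w, J) \<Rightarrow>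
        (C * C' * (cmod (g w) * exp (\<epsilon> * wt w))) * (cmod (\<kappa> \<sigma> J) * exp (\<epsilon> * sum wt J)))"
      by (simp add: p f_def norm_mult distrib_left exp_add mult_ac)
  qed
  have "\<sigma> * infsum (\<lambda>w. g w * infsum (\<lambda>J. \<kappa> \<sigma> J * \<omega> w J * blaschke J w) (Fpow A)) A =
      infsum (\<lambda>w. infsum (f w) {J \<in> Fpow A. w \<notin> J}) A"
    unfolding infsum_cmult_right'[symmetric]
  proof (rule infsum_cong)
    fix w
    \<comment> \<open>Sets that already contain w contribute nothing, because
      \<open>blaschke J w\<close> vanishes.\<close>
    have "infsum (f w) (Fpow A) = infsum (f w) {J \<in> Fpow A. w \<notin> J}"
      by (rule infsum_cong_neutral) (auto simp: f_def Fpow_def blaschke_eq_0)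
    then show "infsum (\<lambda>J. \<sigma> * (g w * (\<kappa> \<sigma> J * \<omega> w J * blaschke J w))) (Fpow A) =
        infsum (f w) {J \<in> Fpow A. w \<notin> J}"
      by (simp add: f_def[abs_def] mult_ac)
  qed
  also have "\<dots> = infsum (\<lambda>J. \<Sum>w\<in>J. f w (J - {w})) (Fpow A)"
    by (rule infsum_Fpow_swap(1)[OF summ, symmetric])
  also have "\<dots> = infsum (\<lambda>J. \<kappa> \<sigma> J * (\<Sum>w\<in>J. pf_coeff J w * \<omega> w (J - {w}))) (Fpow A)"
  proof (rule infsum_cong)
    fix J assume J: "J \<in> Fpow A"
    have "f w (J - {w}) = \<kappa> \<sigma> J * (pf_coeff J w * \<omega> w (J - {w}))" if "w \<in> J" for w
    proof -
      have wA: "w \<in> A" "J - {w} \<in> Fpow A" "finite (J - {w})" using J that by (auto simp: Fpow_def)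
      have "blaschke (J - {w}) w \<noteq> 0"
        using wA add_nonzero by (intro blaschke_nonzero) (auto simp: Fpow_def)
      moreover have "w \<noteq> 0" using Re_pos[OF wA(1)] by auto
      moreover have "\<kappa> \<sigma> J = \<kappa> \<sigma> (J - {w}) * (\<sigma> * g w / (2 * w) * (blaschke (J - {w}) w)\<^sup>2)"
        using \<kappa>_insert[OF wA(2,1)] that by (simp add: insert_absorb)
      ultimately show ?thesis
        by (simp add: f_def pf_coeff_def power2_eq_square)
    qed
    then show "(\<Sum>w\<in>J. f w (J - {w})) = \<kappa> \<sigma> J * (\<Sum>w\<in>J. pf_coeff J w * \<omega> w (J - {w}))"
      by (simp add: sum_distrib_left)
  qed
  finally show ?thesis .
qed

text \<open>The residue sum of the term J is \<phi> J (1 - \<open>blaschke J u\<close>) by partial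
  fractions. Inside the operator the weight is \<phi> at \<open>insert w J\<close>, because it is
  the enlarged set that carries the term.\<close>

lemma wave_equation:
  assumes \<sigma>: "cmod \<sigma> \<le> 1" and C: "0 \<le> C"
    and \<phi>: "\<And>J. J \<in> Fpow A \<Longrightarrow> cmod (\<phi> J) \<le> C * (1 + sum wt J) ^ k" and u: "u \<in> A"
  shows "wave \<sigma> \<phi> u + \<sigma> * infsum (\<lambda>w. g w * wave \<sigma> (\<lambda>J. \<phi> (insert w J)) w / (u + w)) A = tau \<sigma> \<phi>"
proof -
  have "\<sigma> * infsum (\<lambda>w. g w * infsum (\<lambda>J. \<kappa> \<sigma> J * (\<phi> (insert w J) / (u + w)) * blaschke J w) (Fpow A)) A =
      infsum (\<lambda>J. \<kappa> \<sigma> J * (\<Sum>w\<in>J. pf_coeff J w * (\<phi> (insert w (J - {w})) / (u + w)))) (Fpow A)"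
  proof (rule residue_sum[OF \<sigma>, of "C * (1 / (2 * \<delta>))"])
    fix w J assume wJ: "w \<in> A" "J \<in> Fpow A" "w \<notin> J"
    then have "cmod (\<phi> (insert w J)) \<le> C * (1 + (wt w + sum wt J)) ^ k"
      using \<phi>[of "insert w J"] by (simp add: Fpow_def)
    then have "cmod (\<phi> (insert w J)) * cmod (1 / (u + w)) \<le> C * (1 + (wt w + sum wt J)) ^ k * (1 / (2 * \<delta>))"
      using norm_inverse_add_le[OF u wJ(1)] C
      by (intro mult_mono) (auto intro!: mult_nonneg_nonneg zero_le_power add_nonneg_nonneg sum_nonneg)
    then show "cmod (\<phi> (insert w J) / (u + w)) \<le> C * (1 / (2 * \<delta>)) * (1 + (wt w + sum wt J)) ^ k"
      by (simp add: norm_divide mult_ac)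
  qed (use C \<delta> in auto)
  also have "\<dots> = infsum (\<lambda>J. \<kappa> \<sigma> J * \<phi> J - \<kappa> \<sigma> J * \<phi> J * blaschke J u) (Fpow A)"
  proof (rule infsum_cong)
    fix J assume J: "J \<in> Fpow A"
    have "(\<Sum>w\<in>J. pf_coeff J w * (\<phi> (insert w (J - {w})) / (u + w))) = \<phi> J * (\<Sum>w\<in>J. pf_coeff J w / (u + w))"
      unfolding sum_distrib_left by (intro sum.cong) (auto simp: insert_absorb mult_ac)
    also have "(\<Sum>w\<in>J. pf_coeff J w / (u + w)) = 1 - blaschke J u"
    proof -
      have "blaschke J u = 1 - (\<Sum>w\<in>J. pf_coeff J w / (u + w))"
        using J Re_pos add_nonzero u by (intro blaschke_partial_fractions) (auto simp: Fpow_def)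
      then show ?thesis by simp
    qed
    finally show "\<kappa> \<sigma> J * (\<Sum>w\<in>J. pf_coeff J w * (\<phi> (insert w (J - {w})) / (u + w))) =
        \<kappa> \<sigma> J * \<phi> J - \<kappa> \<sigma> J * \<phi> J * blaschke J u"
      by (simp only: right_diff_distrib mult_1_right mult.assoc)
  qed
  also have "\<dots> = tau \<sigma> \<phi> - wave \<sigma> \<phi> u"
    unfolding tau_fun_def wave_fun_def
    using summable_tau[OF \<sigma> \<phi> C] summable_wave[OF \<sigma> \<phi> C u] by (intro infsum_diff)
  finally have "\<sigma> * infsum (\<lambda>w. g w * infsum (\<lambda>J. \<kappa> \<sigma> J * (\<phi> (insert w J) / (u + w)) * blaschke J w) (Fpow A)) A =
      tau \<sigma> \<phi> - wave \<sigma> \<phi> u" .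
  moreover have "infsum (\<lambda>J. \<kappa> \<sigma> J * (\<phi> (insert w J) / (u + w)) * blaschke J w) (Fpow A) =
      wave \<sigma> (\<lambda>J. \<phi> (insert w J)) w / (u + w)" for w
    unfolding wave_fun_def times_divide_eq_right times_divide_eq_left divide_inverse
    by (subst infsum_cmult_left'[symmetric]) (simp add: mult_ac)
  ultimately show ?thesis by (simp add: mult_ac)
qed

text \<open>The double partial fractions do for 1/(u + w) what the simple ones do for the constant
  1. Up to weights and a division by the tau value this is the resolvent kernel in explicit
  form.\<close>

lemma resolvent_equation:
  assumes \<sigma>: "cmod \<sigma> \<le> 1" and u: "u \<in> A" and w: "w \<in> A"
  shows "wave \<sigma> (\<lambda>J. blaschke J w) u / (u + w) +
      \<sigma> * infsum (\<lambda>y. g y * wave \<sigma> (\<lambda>J. blaschke J w) y / ((u + y) * (w + y))) A =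
      tau \<sigma> (\<lambda>_. 1) / (u + w)"
proof -
  let ?\<omega> = "\<lambda>y J. blaschke J w / ((u + y) * (w + y))"
  have "\<sigma> * infsum (\<lambda>y. g y * infsum (\<lambda>J. \<kappa> \<sigma> J * ?\<omega> y J * blaschke J y) (Fpow A)) A =
      infsum (\<lambda>J. \<kappa> \<sigma> J * (\<Sum>y\<in>J. pf_coeff J y * ?\<omega> y (J - {y}))) (Fpow A)"
  proof (rule residue_sum[OF \<sigma>, of "1 / (2 * \<delta>) * (1 / (2 * \<delta>))"])
    fix y J assume yJ: "y \<in> A" "J \<in> Fpow A" "y \<notin> J"
    have "cmod (blaschke J w) * (cmod (1 / (u + y)) * cmod (1 / (w + y))) \<le> 1 * (1 / (2 * \<delta>) * (1 / (2 * \<delta>)))"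
      using norm_blaschke_le[OF yJ(2) w] norm_inverse_add_le[OF u yJ(1)] norm_inverse_add_le[OF w yJ(1)] \<delta>
      by (intro mult_mono) auto
    then show "cmod (?\<omega> y J) \<le> 1 / (2 * \<delta>) * (1 / (2 * \<delta>)) * (1 + (wt y + sum wt J)) ^ 0"
      by (simp add: norm_divide norm_mult)
  qed (use \<delta> in auto)
  also have "\<dots> = infsum (\<lambda>J. (\<kappa> \<sigma> J * 1 - \<kappa> \<sigma> J * blaschke J w * blaschke J u) * (1 / (u + w))) (Fpow A)"
  proof (rule infsum_cong)
    fix J assume J: "J \<in> Fpow A"
    have "blaschke J u * blaschke J w / (u + w) + (\<Sum>y\<in>J. pf_coeff J y * ?\<omega> y (J - {y})) = 1 / (u + w)"
      using J Re_pos u w by (intro blaschke_double_partial_fractions) (auto simp: Fpow_def)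
    then have *: "(\<Sum>y\<in>J. pf_coeff J y * ?\<omega> y (J - {y})) = 1 / (u + w) - blaschke J u * blaschke J w / (u + w)"
      by (simp add: eq_diff_eq add.commute)
    show "\<kappa> \<sigma> J * (\<Sum>y\<in>J. pf_coeff J y * ?\<omega> y (J - {y})) =
        (\<kappa> \<sigma> J * 1 - \<kappa> \<sigma> J * blaschke J w * blaschke J u) * (1 / (u + w))"
      unfolding * by (simp add: algebra_simps diff_divide_distrib)
  qed
  also have "\<dots> = (tau \<sigma> (\<lambda>_. 1) - wave \<sigma> (\<lambda>J. blaschke J w) u) * (1 / (u + w))"
    unfolding tau_fun_def wave_fun_def infsum_cmult_left'
  proof (subst infsum_diff)
    show "(\<lambda>J. \<kappa> \<sigma> J * 1) summable_on Fpow A"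
      by (rule summable_tau[OF \<sigma>, of _ 1 0]) auto
    show "(\<lambda>J. \<kappa> \<sigma> J * blaschke J w * blaschke J u) summable_on Fpow A"
      using norm_blaschke_le w by (intro summable_wave[OF \<sigma>, of _ 1 0] u) auto
  qed simp
  finally have *: "\<sigma> * infsum (\<lambda>y. g y * infsum (\<lambda>J. \<kappa> \<sigma> J * ?\<omega> y J * blaschke J y) (Fpow A)) A =
      (tau \<sigma> (\<lambda>_. 1) - wave \<sigma> (\<lambda>J. blaschke J w) u) * (1 / (u + w))" .
  have "infsum (\<lambda>J. \<kappa> \<sigma> J * ?\<omega> y J * blaschke J y) (Fpow A) =
      wave \<sigma> (\<lambda>J. blaschke J w) y / ((u + y) * (w + y))" for y
    unfolding wave_fun_def divide_inverse by (subst infsum_cmult_left'[symmetric]) (simp add: mult_ac)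
  with * show ?thesis by (simp add: diff_divide_distrib)
qed

text \<open>Without the factor 1/(u + w) the residue sums are the moments of
  \<open>pf_coeff\<close>, which for m up to 2 are polynomials in p_1 and p_3.\<close>

lemma wave_moment:
  assumes \<sigma>: "cmod \<sigma> \<le> 1"
    and \<phi>: "\<And>J. J \<in> Fpow A \<Longrightarrow> cmod (\<phi> J) \<le> (1 + sum wt J) ^ k"
  shows "\<sigma> * infsum (\<lambda>w. g w * w ^ m * wave \<sigma> (\<lambda>J. \<phi> (insert w J)) w) A =
      tau \<sigma> (\<lambda>J. \<phi> J * (\<Sum>w\<in>J. pf_coeff J w * w ^ m))"
proof -
  have "\<sigma> * infsum (\<lambda>w. g w * infsum (\<lambda>J. \<kappa> \<sigma> J * (\<phi> (insert w J) * w ^ m) * blaschke J w) (Fpow A)) A =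
      infsum (\<lambda>J. \<kappa> \<sigma> J * (\<Sum>w\<in>J. pf_coeff J w * (\<phi> (insert w (J - {w})) * w ^ m))) (Fpow A)"
  proof (rule residue_sum[OF \<sigma>, of 1])
    fix w J assume wJ: "w \<in> A" "J \<in> Fpow A" "w \<notin> J"
    then have "cmod (\<phi> (insert w J)) \<le> (1 + (wt w + sum wt J)) ^ k"
      using \<phi>[of "insert w J"] by (simp add: Fpow_def)
    moreover have "cmod w \<le> 1 + (wt w + sum wt J)"
      using cmod_le_wt(1)[of w] sum_nonneg[of J wt] by simp
    ultimately have "cmod (\<phi> (insert w J)) * cmod w ^ m \<le>
        (1 + (wt w + sum wt J)) ^ k * (1 + (wt w + sum wt J)) ^ m"
      by (intro mult_mono power_mono) (auto intro!: zero_le_power add_nonneg_nonneg sum_nonneg)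
    then show "cmod (\<phi> (insert w J) * w ^ m) \<le> 1 * (1 + (wt w + sum wt J)) ^ (k + m)"
      by (simp add: norm_mult norm_power power_add)
  qed auto
  also have "\<dots> = tau \<sigma> (\<lambda>J. \<phi> J * (\<Sum>w\<in>J. pf_coeff J w * w ^ m))"
    unfolding tau_fun_def
  proof (rule infsum_cong)
    fix J
    have "(\<Sum>w\<in>J. pf_coeff J w * (\<phi> (insert w (J - {w})) * w ^ m)) = \<phi> J * (\<Sum>w\<in>J. pf_coeff J w * w ^ m)"
      unfolding sum_distrib_left by (intro sum.cong) (auto simp: insert_absorb mult_ac)
    then show "\<kappa> \<sigma> J * (\<Sum>w\<in>J. pf_coeff J w * (\<phi> (insert w (J - {w})) * w ^ m)) =
        \<kappa> \<sigma> J * (\<phi> J * (\<Sum>w\<in>J. pf_coeff J w * w ^ m))" by simp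
  qed
  finally have *: "\<sigma> * infsum (\<lambda>w. g w * infsum (\<lambda>J. \<kappa> \<sigma> J * (\<phi> (insert w J) * w ^ m) * blaschke J w) (Fpow A)) A =
      tau \<sigma> (\<lambda>J. \<phi> J * (\<Sum>w\<in>J. pf_coeff J w * w ^ m))" .
  have "infsum (\<lambda>J. \<kappa> \<sigma> J * (\<phi> (insert w J) * w ^ m) * blaschke J w) (Fpow A) =
      w ^ m * wave \<sigma> (\<lambda>J. \<phi> (insert w J)) w" for w
    unfolding wave_fun_def by (simp add: infsum_cmult_right'[symmetric] mult_ac)
  with * show ?thesis by (simp add: mult_ac)
qed

end

text \<open>In use X is the pairing of the two wave functions, P, Y, S are double sums with weights
  w^i y^j, and V, Z come from the pairing with the wave function weighted by -p_1. The first claim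
  belongs to i + j = 1, the second to i + j = 2.\<close>

lemma bilinear_elimination:
  fixes X P S V Z Y d0 d1 d2 d3 d' e0 e1 e2 e3 e' :: complex
  shows "X = e0 * (- 2 * d2) - P \<Longrightarrow> X = d0 * (2 * e2) + S \<Longrightarrow> P + S = - 2 * d1 * (2 * e1) \<Longrightarrow>
      d2 * e0 + d0 * e2 = 2 * d1 * e1"
    and "X = e0 * - (4 / 3 * d3 + 2 / 3 * d') - P \<Longrightarrow> X = d0 * (4 / 3 * e3 + 2 / 3 * e') + S \<Longrightarrow>
      e0 * (- (4 / 3 * d3 + 2 / 3 * d') + 2 * d3) - V = - d1 * (2 * e2) + (Z - Y) \<Longrightarrow>
      P + Y = - 4 * d2 * e1 \<Longrightarrow> Y + S = - 4 * d1 * e2 \<Longrightarrow> V + Z = 0 \<Longrightarrow>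
      d' * e0 - d0 * e' = 4 * d3 * e0 - 6 * d2 * e1 + 2 * d0 * e3"
proof -
  assume 1: "X = e0 * (- 2 * d2) - P" "X = d0 * (2 * e2) + S" "P + S = - 2 * d1 * (2 * e1)"
  have "P + S = (P + e0 * (- 2 * d2) - P) - (d0 * (2 * e2) + S) + S"
    unfolding 1(1)[symmetric] 1(2)[symmetric] add_diff_eq[symmetric] by simp
  then have q: "P + S = - (e0 * (2 * d2)) - d0 * (2 * e2)" by simp
  have "2 * (d2 * e0 + d0 * e2) = - (P + S)" unfolding q by (simp add: algebra_simps)
  then have "2 * (d2 * e0 + d0 * e2) = 2 * (2 * d1 * e1)" using 1(3) by simp
  then show "d2 * e0 + d0 * e2 = 2 * d1 * e1" by (metis mult_left_cancel zero_neq_numeral)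
next
  assume 1: "X = e0 * - (4 / 3 * d3 + 2 / 3 * d') - P" "X = d0 * (4 / 3 * e3 + 2 / 3 * e') + S"
    and z: "e0 * (- (4 / 3 * d3 + 2 / 3 * d') + 2 * d3) - V = - d1 * (2 * e2) + (Z - Y)"
    and 2: "P + Y = - 4 * d2 * e1" "Y + S = - 4 * d1 * e2" "V + Z = 0"
  have P: "P = - 4 * d2 * e1 - Y" and S: "S = - 4 * d1 * e2 - Y" and Z: "Z = - V"
    using 2 by (simp_all add: eq_diff_eq add.commute eq_neg_iff_add_eq_0)
  have Y: "Y = - d1 * (2 * e2) - e0 * (- (4 / 3 * d3 + 2 / 3 * d') + 2 * d3)"
    using z unfolding Z by (simp add: algebra_simps)
  have "e0 * - (4 / 3 * d3 + 2 / 3 * d') - P = d0 * (4 / 3 * e3 + 2 / 3 * e') + S"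
    using 1 by simp
  \<comment> \<open>What the hypotheses give is 2/3 of the goal; 54 is 81 times 2/3, with 81 a power
    of the denominator 3 to be cleared.\<close>
  then have "54 * (d' * e0 - d0 * e') = 54 * (4 * d3 * e0 - 6 * d2 * e1 + 2 * d0 * e3)"
    unfolding P S Y by (simp add: field_simps)
  then show "d' * e0 - d0 * e' = 4 * d3 * e0 - 6 * d2 * e1 + 2 * d0 * e3"
    by (metis mult_left_cancel zero_neq_numeral)
qed

section \<open>Double sums of wave functions and Hirota's bilinear equations\<close>

context tau_data
begin

definition dbl :: "(complex \<Rightarrow> complex) \<Rightarrow> (complex \<Rightarrow> complex) \<Rightarrow> complex" where
  "dbl a b = infsum (\<lambda>w. a w * infsum (\<lambda>y. b y / (w + y)) A) A"

lemma summable_dbl: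
  assumes "a summable_on A" "b summable_on A"
  shows "(\<lambda>(w, y). a w * (b y / (w + y))) summable_on A \<times> A"
proof (rule summable_on_norm_bound)
  show "(\<lambda>(w, y). (1 / (2 * \<delta>) * cmod (a w)) * cmod (b y)) summable_on A \<times> A"
    using assms \<delta> by (intro summable_on_times_real summable_on_cmult_right)
      (auto simp: summable_on_iff_abs_summable_on_complex)
  fix p assume "p \<in> A \<times> A"
  then obtain w y where p: "p = (w, y)" "w \<in> A" "y \<in> A" by auto
  have "cmod (1 / (w + y)) * (cmod (a w) * cmod (b y)) \<le> 1 / (2 * \<delta>) * (cmod (a w) * cmod (b y))"
    using norm_inverse_add_le[OF p(2,3)] by (intro mult_right_mono) auto
  then show "norm (case p of (w, y) \<Rightarrow> a w * (b y / (w + y))) \<le>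
      (case p of (w, y) \<Rightarrow> (1 / (2 * \<delta>) * cmod (a w)) * cmod (b y))"
    by (simp add: p norm_mult norm_divide)
qed

lemma dbl_eq: 
  assumes "a summable_on A" "b summable_on A"
  shows "dbl a b = infsum (\<lambda>(w, y). a w * (b y / (w + y))) (A \<times> A)"
    and "(\<lambda>w. a w * infsum (\<lambda>y. b y / (w + y)) A) summable_on A"
  using infsum_Sigma'_banach[OF summable_dbl[OF assms]] summable_on_Sigma_banach[OF summable_dbl[OF assms]]
  unfolding dbl_def infsum_cmult_right' by simp_all

lemma dbl_swap:
  assumes "a summable_on A" "b summable_on A"
  shows "infsum (\<lambda>y. b y * infsum (\<lambda>w. a w / (y + w)) A) A = dbl a b"
proof -
  have "dbl a b = infsum (\<lambda>w. infsum (\<lambda>y. a w * (b y / (w + y))) A) A"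
    unfolding dbl_def infsum_cmult_right' ..
  also have "\<dots> = infsum (\<lambda>y. infsum (\<lambda>w. a w * (b y / (w + y))) A) A"
    by (rule infsum_swap_banach[OF summable_dbl[OF assms]])
  also have "\<dots> = infsum (\<lambda>y. infsum (\<lambda>w. b y * (a w / (y + w))) A) A"
    by (simp add: mult_ac add.commute)
  finally show ?thesis unfolding infsum_cmult_right' ..
qed

text \<open>The rank-one structure: (w + y) times the kernel 1/(w + y) is 1, so raising the degree
  on either side and adding decouples the double sum.\<close>

lemma dbl_mult_sum:
  assumes "a summable_on A" "b summable_on A"
    "(\<lambda>w. a w * w) summable_on A" "(\<lambda>w. b w * w) summable_on A"
  shows "dbl (\<lambda>w. a w * w) b + dbl a (\<lambda>y. b y * y) = infsum a A * infsum b A"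
proof -
  have "dbl (\<lambda>w. a w * w) b + dbl a (\<lambda>y. b y * y) =
      infsum (\<lambda>p. (case p of (w, y) \<Rightarrow> a w * w * (b y / (w + y))) + (case p of (w, y) \<Rightarrow> a w * (b y * y / (w + y)))) (A \<times> A)"
    unfolding dbl_eq(1)[OF assms(3,2)] dbl_eq(1)[OF assms(1,4)]
    by (rule infsum_add[symmetric]) (intro summable_dbl assms)+
  also have "\<dots> = infsum (\<lambda>(w, y). a w * b y) (A \<times> A)"
  proof (rule infsum_cong)
    fix p assume "p \<in> A \<times> A"
    then show "(case p of (w, y) \<Rightarrow> a w * w * (b y / (w + y))) + (case p of (w, y) \<Rightarrow> a w * (b y * y / (w + y))) =
        (case p of (w, y) \<Rightarrow> a w * b y)"
      using add_nonzero by (auto simp: divide_simps) (simp add: algebra_simps)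
  qed
  finally show ?thesis by (simp add: infsum_times_infsum(2)[OF assms(1,2)])
qed

lemma dbl_diff_left:
  assumes "a summable_on A" "a' summable_on A" "b summable_on A"
  shows "dbl (\<lambda>w. a w - a' w) b = dbl a b - dbl a' b"
  unfolding dbl_def left_diff_distrib
  by (rule infsum_diff) (rule dbl_eq(2)[OF assms(1,3)] dbl_eq(2)[OF assms(2,3)])+

lemma summable_g_bounded:
  assumes "\<And>u. u \<in> A \<Longrightarrow> cmod (f u) \<le> K"
  shows "(\<lambda>w. g w * f w * w ^ m) summable_on A"
proof -
  obtain C where C: "0 \<le> C" "\<And>s. 0 \<le> s \<Longrightarrow> (1 + s) ^ m \<le> C * exp (\<epsilon> * s)"
    using power_le_exp_bound[OF \<epsilon>] by blast
  show ?thesis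
  proof (rule summable_on_norm_bound)
    show "(\<lambda>u. (\<bar>K\<bar> * C) * (cmod (g u) * exp (\<epsilon> * wt u))) summable_on A"
      by (intro summable_on_cmult_right summable_g)
    fix w assume w: "w \<in> A"
    have "cmod w ^ m \<le> (1 + wt w) ^ m" using cmod_le_wt(1)[of w] by (intro power_mono) auto
    also have "\<dots> \<le> C * exp (\<epsilon> * wt w)" using C by auto
    finally have "cmod (f w) * cmod w ^ m \<le> \<bar>K\<bar> * (C * exp (\<epsilon> * wt w))"
      using assms[OF w] by (intro mult_mono) auto
    then have "cmod (g w) * (cmod (f w) * cmod w ^ m) \<le> cmod (g w) * (\<bar>K\<bar> * (C * exp (\<epsilon> * wt w)))"
      by (rule mult_left_mono) simp
    then show "norm (g w * f w * w ^ m) \<le> (\<bar>K\<bar> * C) * (cmod (g w) * exp (\<epsilon> * wt w))"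
      by (simp add: norm_mult norm_power mult_ac)
  qed
qed

text \<open>d belongs to det(I - M) and e to det(I + M). Along the flows of the application,
  \<open>d k\<close> is (-1)^k times the k-th x-derivative of \<open>d 0\<close>, and
  \<open>d'\<close> is three times its \<tau>-derivative.\<close>

abbreviation "d k \<equiv> tau (- 1) (\<lambda>J. psum 1 J ^ k)"
abbreviation "e k \<equiv> tau 1 (\<lambda>J. psum 1 J ^ k)"
abbreviation "d' \<equiv> tau (- 1) (\<lambda>J. psum 3 J)"
abbreviation "e' \<equiv> tau 1 (\<lambda>J. psum 3 J)"

lemma psum_bound:
  "cmod (psum 1 J ^ k) \<le> (1 + sum wt J) ^ k" "cmod (psum 3 J) \<le> (1 + sum wt J) ^ 1"
  using norm_psum_le_wt[of J] sum_nonneg[of J wt] by (auto simp: norm_power intro: power_mono)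

lemma tau_lincomb:
  assumes "cmod \<sigma> \<le> 1"
  shows "tau \<sigma> (\<lambda>J. a * psum 1 J ^ k + b * psum 3 J) = a * tau \<sigma> (\<lambda>J. psum 1 J ^ k) + b * tau \<sigma> (psum 3)"
proof -
  have 1: "(\<lambda>J. \<kappa> \<sigma> J * psum 1 J ^ k) summable_on Fpow A" "(\<lambda>J. \<kappa> \<sigma> J * psum 3 J) summable_on Fpow A"
    using psum_bound by (auto intro: summable_tau[OF assms, of _ 1 k] summable_tau[OF assms, of _ 1 1])
  have "tau \<sigma> (\<lambda>J. a * psum 1 J ^ k + b * psum 3 J) =
      infsum (\<lambda>J. a * (\<kappa> \<sigma> J * psum 1 J ^ k) + b * (\<kappa> \<sigma> J * psum 3 J)) (Fpow A)"
    by (simp add: tau_fun_def algebra_simps)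
  then show ?thesis
    using 1 by (simp add: tau_fun_def infsum_add summable_on_cmult_right infsum_cmult_right')
qed

lemma wave_moments:
  assumes "cmod \<sigma> \<le> 1"
  shows "\<sigma> * infsum (\<lambda>w. g w * wave \<sigma> (\<lambda>_. 1) w * w ^ 0) A = 2 * tau \<sigma> (\<lambda>J. psum 1 J ^ 1)"
    "\<sigma> * infsum (\<lambda>w. g w * wave \<sigma> (\<lambda>_. 1) w * w ^ 1) A = 2 * tau \<sigma> (\<lambda>J. psum 1 J ^ 2)"
    "\<sigma> * infsum (\<lambda>w. g w * wave \<sigma> (\<lambda>_. 1) w * w ^ 2) A =
      4 / 3 * tau \<sigma> (\<lambda>J. psum 1 J ^ 3) + 2 / 3 * tau \<sigma> (psum 3)"
proof -
  have *: "\<sigma> * infsum (\<lambda>w. g w * wave \<sigma> (\<lambda>_. 1) w * w ^ m) A =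
      infsum (\<lambda>J. \<kappa> \<sigma> J * (\<Sum>w\<in>J. pf_coeff J w * w ^ m)) (Fpow A)" for m
    using wave_moment[OF assms, of "\<lambda>_. 1" 0 m] by (simp add: tau_fun_def mult_ac)
  have J: "finite J" "\<And>v. v \<in> J \<Longrightarrow> 0 < Re v" if "J \<in> Fpow A" for J
    using that Re_pos by (auto simp: Fpow_def)
  have "infsum (\<lambda>J. \<kappa> \<sigma> J * (\<Sum>w\<in>J. pf_coeff J w * w ^ 0)) (Fpow A) = tau \<sigma> (\<lambda>J. 2 * psum 1 J ^ 1 + 0 * psum 3 J)"
    unfolding tau_fun_def by (rule infsum_cong) (use pf_coeff_moments(1)[OF J] in auto)
  then show "\<sigma> * infsum (\<lambda>w. g w * wave \<sigma> (\<lambda>_. 1) w * w ^ 0) A = 2 * tau \<sigma> (\<lambda>J. psum 1 J ^ 1)"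
    unfolding * tau_lincomb[OF assms] by simp
  have "infsum (\<lambda>J. \<kappa> \<sigma> J * (\<Sum>w\<in>J. pf_coeff J w * w ^ 1)) (Fpow A) = tau \<sigma> (\<lambda>J. 2 * psum 1 J ^ 2 + 0 * psum 3 J)"
    unfolding tau_fun_def by (rule infsum_cong) (use pf_coeff_moments(2)[OF J] in auto)
  then show "\<sigma> * infsum (\<lambda>w. g w * wave \<sigma> (\<lambda>_. 1) w * w ^ 1) A = 2 * tau \<sigma> (\<lambda>J. psum 1 J ^ 2)"
    unfolding * tau_lincomb[OF assms] by simp
  have "infsum (\<lambda>J. \<kappa> \<sigma> J * (\<Sum>w\<in>J. pf_coeff J w * w ^ 2)) (Fpow A) =
      tau \<sigma> (\<lambda>J. 4 / 3 * psum 1 J ^ 3 + 2 / 3 * psum 3 J)"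
    unfolding tau_fun_def by (rule infsum_cong) (use pf_coeff_moments(3)[OF J] in auto)
  then show "\<sigma> * infsum (\<lambda>w. g w * wave \<sigma> (\<lambda>_. 1) w * w ^ 2) A =
      4 / 3 * tau \<sigma> (\<lambda>J. psum 1 J ^ 3) + 2 / 3 * tau \<sigma> (psum 3)"
    unfolding * tau_lincomb[OF assms] by simp
qed

text \<open>\<open>Tp\<close> belongs to the inverse of I - M, \<open>Tm\<close> to that of I + M.
  \<open>U\<close> is the x-derivative of \<open>Tp\<close> at fixed u, since d/dx multiplies each
  term by -p_1.\<close>

abbreviation "Tp \<equiv> wave (- 1) (\<lambda>_. 1)"
abbreviation "Tm \<equiv> wave 1 (\<lambda>_. 1)"
abbreviation "U \<equiv> wave (- 1) (\<lambda>J. - psum 1 J)"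

lemma wave_one_equation:
  assumes "cmod \<sigma> \<le> 1" "u \<in> A"
  shows "wave \<sigma> (\<lambda>_. 1) u + \<sigma> * infsum (\<lambda>w. g w * wave \<sigma> (\<lambda>_. 1) w / (u + w)) A = tau \<sigma> (\<lambda>_. 1)"
  by (rule wave_equation[OF assms(1), of 1 _ 0]) (use assms in auto)

text \<open>Inserting w raises p_1 by w. If w is already in J nothing is inserted, but then
  \<open>blaschke J w\<close> = 0 kills the term.\<close>

lemma wave_insert_psum:
  assumes "w \<in> A"
  shows "wave (- 1) (\<lambda>J. - psum 1 (insert w J)) w = U w - w * Tp w"
proof -
  have s: "(\<lambda>J. \<kappa> (- 1) J * - psum 1 J * blaschke J w) summable_on Fpow A"
    using psum_bound(1)[of _ 1] by (intro summable_wave[of _ _ 1 1] assms) auto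
  have s': "(\<lambda>J. \<kappa> (- 1) J * 1 * blaschke J w) summable_on Fpow A"
    by (intro summable_wave[of _ _ 1 0] assms) auto
  have "wave (- 1) (\<lambda>J. - psum 1 (insert w J)) w =
      infsum (\<lambda>J. \<kappa> (- 1) J * - psum 1 J * blaschke J w - w * (\<kappa> (- 1) J * 1 * blaschke J w)) (Fpow A)"
    unfolding wave_fun_def
  proof (rule infsum_cong)
    fix J assume "J \<in> Fpow A"
    then have "finite J" by (simp add: Fpow_def)
    then show "\<kappa> (- 1) J * - psum 1 (insert w J) * blaschke J w =
        \<kappa> (- 1) J * - psum 1 J * blaschke J w - w * (\<kappa> (- 1) J * 1 * blaschke J w)"
      by (cases "w \<in> J") (auto simp: psum_insert blaschke_eq_0 algebra_simps)
  qed
  also have "\<dots> = U w - w * Tp w"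
    unfolding wave_fun_def using s s' by (subst infsum_diff) (auto intro: summable_on_cmult_right simp: infsum_cmult_right')
  finally show ?thesis .
qed

text \<open>Hirota's equations: the pairings of the two wave functions are evaluated in two ways and eliminated.\<close>
theorem bilinear:
  "d 2 * e 0 + d 0 * e 2 = 2 * d 1 * e 1"
  "d' * e 0 - d 0 * e' = 4 * d 3 * e 0 - 6 * d 2 * e 1 + 2 * d 0 * e 3"
proof -
  let ?\<alpha> = "\<lambda>i w. g w * Tp w * w ^ i"
  let ?\<beta> = "\<lambda>i w. g w * Tm w * w ^ i"
  let ?\<upsilon> = "\<lambda>i w. g w * U w * w ^ i"
  let ?X = "\<lambda>i. infsum (\<lambda>w. g w * Tp w * Tm w * w ^ i) A"
  have s: "?\<alpha> i summable_on A" "?\<beta> i summable_on A" "?\<upsilon> i summable_on A" for i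
  proof -
    obtain K where "\<And>u. u \<in> A \<Longrightarrow> cmod (Tp u) \<le> K" using norm_wave_le[of "- 1" "\<lambda>_. 1" 1 0] by auto
    then show "?\<alpha> i summable_on A" by (rule summable_g_bounded)
    obtain K where "\<And>u. u \<in> A \<Longrightarrow> cmod (Tm u) \<le> K" using norm_wave_le[of "1" "\<lambda>_. 1" 1 0] by auto
    then show "?\<beta> i summable_on A" by (rule summable_g_bounded)
    obtain K where "\<And>u. u \<in> A \<Longrightarrow> cmod (U u) \<le> K"
      by (rule norm_wave_le[of "- 1" "\<lambda>J. - psum 1 J" 1 1]) (use psum_bound(1)[of _ 1] in auto)
    then show "?\<upsilon> i summable_on A" by (rule summable_g_bounded)
  qed
  have one: "tau \<sigma> (\<lambda>_. 1) = tau \<sigma> (\<lambda>J. psum 1 J ^ 0)" for \<sigma> by simp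
  have Tp: "Tp u = d 0 + infsum (\<lambda>w. ?\<alpha> 0 w / (u + w)) A" if "u \<in> A" for u
    using wave_one_equation[of "- 1" u] that by (simp add: algebra_simps)
  have Tm: "Tm u = e 0 - infsum (\<lambda>w. ?\<beta> 0 w / (u + w)) A" if "u \<in> A" for u
    using wave_one_equation[of "1" u] that by (simp add: algebra_simps)
  have U: "U u = - d 1 + infsum (\<lambda>w. (?\<upsilon> 0 w - ?\<alpha> 1 w) / (u + w)) A" if "u \<in> A" for u
  proof -
    have "U u + - 1 * infsum (\<lambda>w. g w * wave (- 1) (\<lambda>J. - psum 1 (insert w J)) w / (u + w)) A =
        tau (- 1) (\<lambda>J. - psum 1 J)"
      using psum_bound(1)[of _ 1] by (intro wave_equation[of _ 1 _ 1] that) auto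
    moreover have "infsum (\<lambda>w. g w * wave (- 1) (\<lambda>J. - psum 1 (insert w J)) w / (u + w)) A =
        infsum (\<lambda>w. (?\<upsilon> 0 w - ?\<alpha> 1 w) / (u + w)) A"
      by (rule infsum_cong) (simp add: wave_insert_psum algebra_simps del: One_nat_def)
    moreover have "tau (- 1) (\<lambda>J. - psum 1 J) = - d 1"
      by (simp add: tau_fun_def infsum_uminus)
    ultimately show ?thesis by (simp add: algebra_simps)
  qed
  \<comment> \<open>The integral equation of \<open>Tm\<close> replaces this factor by a constant
    minus a Cauchy sum; in \<open>X2\<close> the factor \<open>Tp\<close> is replaced
    instead.\<close>
  have X1: "?X i = e 0 * infsum (?\<alpha> i) A - dbl (?\<alpha> i) (?\<beta> 0)" for i
  proof -
    have "?X i = infsum (\<lambda>w. e 0 * ?\<alpha> i w - ?\<alpha> i w * infsum (\<lambda>y. ?\<beta> 0 y / (w + y)) A) A"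
      by (rule infsum_cong) (subst Tm, auto simp: algebra_simps)
    also have "\<dots> = infsum (\<lambda>w. e 0 * ?\<alpha> i w) A - dbl (?\<alpha> i) (?\<beta> 0)"
      unfolding dbl_def by (rule infsum_diff) (intro summable_on_cmult_right dbl_eq(2) s)+
    finally show ?thesis by (simp add: infsum_cmult_right')
  qed
  have X2: "?X i = d 0 * infsum (?\<beta> i) A + dbl (?\<alpha> 0) (?\<beta> i)" for i
  proof -
    have "?X i = infsum (\<lambda>w. d 0 * ?\<beta> i w + ?\<beta> i w * infsum (\<lambda>y. ?\<alpha> 0 y / (w + y)) A) A"
      by (rule infsum_cong) (subst Tp, auto simp: algebra_simps)
    also have "\<dots> = infsum (\<lambda>w. d 0 * ?\<beta> i w) A + infsum (\<lambda>w. ?\<beta> i w * infsum (\<lambda>y. ?\<alpha> 0 y / (w + y)) A) A"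
      by (rule infsum_add) (intro summable_on_cmult_right dbl_eq(2) s)+
    finally show ?thesis using dbl_swap[OF s(1)[of 0] s(2)[of i]] by (simp only: infsum_cmult_right')
  qed
  \<comment> \<open>Supplies the missing relation at second order: its evaluation through the
    equation of \<open>U\<close> involves \<open>dbl (?\<alpha> 1) (?\<beta> 1)\<close>.\<close>
  let ?Z = "infsum (\<lambda>w. g w * U w * Tm w * w) A"
  have Z1: "?Z = e 0 * infsum (?\<upsilon> 1) A - dbl (?\<upsilon> 1) (?\<beta> 0)"
  proof -
    have "?Z = infsum (\<lambda>w. e 0 * ?\<upsilon> 1 w - ?\<upsilon> 1 w * infsum (\<lambda>y. ?\<beta> 0 y / (w + y)) A) A"
      by (rule infsum_cong) (subst Tm, auto simp: algebra_simps)
    also have "\<dots> = infsum (\<lambda>w. e 0 * ?\<upsilon> 1 w) A - dbl (?\<upsilon> 1) (?\<beta> 0)"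
      unfolding dbl_def by (rule infsum_diff) (intro summable_on_cmult_right dbl_eq(2) s)+
    finally show ?thesis by (simp add: infsum_cmult_right')
  qed
  have su: "(\<lambda>w. ?\<upsilon> 0 w - ?\<alpha> 1 w) summable_on A"
    using summable_on_add[OF s(3)[of 0] summable_on_uminus[THEN iffD2, OF s(1)[of 1]]] by simp
  have Z2: "?Z = - d 1 * infsum (?\<beta> 1) A + (dbl (?\<upsilon> 0) (?\<beta> 1) - dbl (?\<alpha> 1) (?\<beta> 1))"
  proof -
    have "?Z = infsum (\<lambda>w. - d 1 * ?\<beta> 1 w + ?\<beta> 1 w * infsum (\<lambda>y. (?\<upsilon> 0 y - ?\<alpha> 1 y) / (w + y)) A) A"
      by (rule infsum_cong) (subst U, auto simp: algebra_simps)
    also have "\<dots> = infsum (\<lambda>w. - d 1 * ?\<beta> 1 w) A +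
        infsum (\<lambda>w. ?\<beta> 1 w * infsum (\<lambda>y. (?\<upsilon> 0 y - ?\<alpha> 1 y) / (w + y)) A) A"
      by (rule infsum_add) (intro summable_on_cmult_right dbl_eq(2) s su)+
    also have "infsum (\<lambda>w. ?\<beta> 1 w * infsum (\<lambda>y. (?\<upsilon> 0 y - ?\<alpha> 1 y) / (w + y)) A) A =
        dbl (?\<upsilon> 0) (?\<beta> 1) - dbl (?\<alpha> 1) (?\<beta> 1)"
      unfolding dbl_swap[OF su s(2)] by (rule dbl_diff_left[OF s(3,1,2)])
    finally show ?thesis by (simp only: infsum_cmult_right')
  qed
  have step: "?\<alpha> (Suc i) = (\<lambda>w. ?\<alpha> i w * w)" "?\<beta> (Suc i) = (\<lambda>w. ?\<beta> i w * w)" "?\<upsilon> (Suc i) = (\<lambda>w. ?\<upsilon> i w * w)" for i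
    by (simp_all add: fun_eq_iff mult_ac)
  have D\<alpha>: "dbl (?\<alpha> (Suc i)) (?\<beta> j) + dbl (?\<alpha> i) (?\<beta> (Suc j)) = infsum (?\<alpha> i) A * infsum (?\<beta> j) A" for i j
    unfolding step by (rule dbl_mult_sum[OF s(1,2)]) (unfold step[symmetric], (rule s)+)
  have D\<upsilon>: "dbl (?\<upsilon> (Suc i)) (?\<beta> j) + dbl (?\<upsilon> i) (?\<beta> (Suc j)) = infsum (?\<upsilon> i) A * infsum (?\<beta> j) A" for i j
    unfolding step by (rule dbl_mult_sum[OF s(3,2)]) (unfold step[symmetric], (rule s)+)
  have A: "infsum (?\<alpha> 0) A = - 2 * d 1" "infsum (?\<alpha> 1) A = - 2 * d 2"
      "infsum (?\<alpha> 2) A = - (4 / 3 * d 3 + 2 / 3 * d')"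
    using wave_moments[of "- 1"] by (simp_all add: algebra_simps add_eq_0_iff2 neg_eq_iff_add_eq_0)
  have B: "infsum (?\<beta> 0) A = 2 * e 1" "infsum (?\<beta> 1) A = 2 * e 2"
      "infsum (?\<beta> 2) A = 4 / 3 * e 3 + 2 / 3 * e'"
    using wave_moments[of 1] by simp_all
  have um: "infsum (?\<upsilon> m) A - infsum (?\<alpha> (Suc m)) A =
      tau (- 1) (\<lambda>J. psum 1 J * (\<Sum>w\<in>J. pf_coeff J w * w ^ m))" for m
  proof -
    have "- 1 * infsum (\<lambda>w. g w * w ^ m * wave (- 1) (\<lambda>J. - psum 1 (insert w J)) w) A =
      tau (- 1) (\<lambda>J. - psum 1 J * (\<Sum>w\<in>J. pf_coeff J w * w ^ m))"
      using psum_bound(1)[of _ 1] by (intro wave_moment[of _ _ 1]) auto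
    also have "\<dots> = - tau (- 1) (\<lambda>J. psum 1 J * (\<Sum>w\<in>J. pf_coeff J w * w ^ m))"
      by (simp add: tau_fun_def infsum_uminus)
    also have "infsum (\<lambda>w. g w * w ^ m * wave (- 1) (\<lambda>J. - psum 1 (insert w J)) w) A =
        infsum (\<lambda>w. ?\<upsilon> m w - ?\<alpha> (Suc m) w) A"
      by (rule infsum_cong) (simp add: wave_insert_psum algebra_simps del: One_nat_def)
    also have "\<dots> = infsum (?\<upsilon> m) A - infsum (?\<alpha> (Suc m)) A"
      by (rule infsum_diff[OF s(3,1)])
    finally show ?thesis by (simp only: mult_minus1 neg_equal_iff_equal)
  qed
  have J: "finite J" "\<And>v. v \<in> J \<Longrightarrow> 0 < Re v" if "J \<in> Fpow A" for J
    using that Re_pos by (auto simp: Fpow_def)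
  have "tau (- 1) (\<lambda>J. psum 1 J * (\<Sum>w\<in>J. pf_coeff J w * w ^ 0)) = tau (- 1) (\<lambda>J. 2 * psum 1 J ^ 2 + 0 * psum 3 J)"
    unfolding tau_fun_def by (rule infsum_cong) (use pf_coeff_moments(1)[OF J] in \<open>auto simp: power2_eq_square\<close>)
  \<comment> \<open>The zeroth moment 2 p_1 times p_1 yields 2 \<open>d 2\<close>, which cancels the
    first moment of \<open>Tp\<close>. This makes the right-hand side of \<open>U10\<close>
    vanish.\<close>
  then have u0: "infsum (?\<upsilon> 0) A = 0"
    using um[of 0] A(2) tau_lincomb[of "- 1" 2 2 0] by simp
  have "tau (- 1) (\<lambda>J. psum 1 J * (\<Sum>w\<in>J. pf_coeff J w * w ^ 1)) = tau (- 1) (\<lambda>J. 2 * psum 1 J ^ 3 + 0 * psum 3 J)"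
    unfolding tau_fun_def by (rule infsum_cong)
      (use pf_coeff_moments(2)[OF J] in \<open>auto simp: power2_eq_square power3_eq_cube\<close>)
  then have u1: "infsum (?\<upsilon> 1) A = infsum (?\<alpha> 2) A + 2 * d 3"
    using um[of 1] tau_lincomb[of "- 1" 2 3 0] by (simp add: numeral_2_eq_2 algebra_simps)
  have two: "Suc 1 = 2" "Suc 0 = 1" by simp_all
  show "d 2 * e 0 + d 0 * e 2 = 2 * d 1 * e 1"
    using bilinear_elimination(1)[OF X1[of 1, unfolded A] X2[of 1, unfolded B] D\<alpha>[of 0 0, unfolded two A B]] .
  have D20: "dbl (?\<alpha> 2) (?\<beta> 0) + dbl (?\<alpha> 1) (?\<beta> 1) = - 4 * d 2 * e 1"
    using D\<alpha>[of 1 0] unfolding two A B by simp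
  have D02: "dbl (?\<alpha> 1) (?\<beta> 1) + dbl (?\<alpha> 0) (?\<beta> 2) = - 4 * d 1 * e 2"
    using D\<alpha>[of 0 1] unfolding two A B by simp
  have U10: "dbl (?\<upsilon> 1) (?\<beta> 0) + dbl (?\<upsilon> 0) (?\<beta> 1) = 0"
    using D\<upsilon>[of 0 0] unfolding two u0 by simp
  have z: "e 0 * (- (4 / 3 * d 3 + 2 / 3 * d') + 2 * d 3) - dbl (?\<upsilon> 1) (?\<beta> 0) =
      - d 1 * (2 * e 2) + (dbl (?\<upsilon> 0) (?\<beta> 1) - dbl (?\<alpha> 1) (?\<beta> 1))"
    using Z1 Z2 unfolding u1 A B by simp
  show "d' * e 0 - d 0 * e' = 4 * d 3 * e 0 - 6 * d 2 * e 1 + 2 * d 0 * e 3"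
    using bilinear_elimination(2)[OF X1[of 2, unfolded A] X2[of 2, unfolded B] z D20 D02 U10] .
qed

lemma sum_wave:
  "infsum (\<lambda>w. g w * Tp w) A = - 2 * d 1" "infsum (\<lambda>w. g w * Tm w) A = 2 * e 1"
  using wave_moments(1)[of "- 1"] wave_moments(1)[of 1] by (simp_all add: minus_equation_iff)

text \<open>Pairing the equation with the column of the explicit resolvent kernel at w leaves only tau * f w = 0.\<close>
lemma kernel_solution_unique:
  assumes \<sigma>: "\<sigma> = 1 \<or> \<sigma> = - 1" and D: "tau \<sigma> (\<lambda>_. 1) \<noteq> 0"
    and h: "\<And>u. u \<in> A \<Longrightarrow> h u * h u = g u" and sh: "(\<lambda>u. cmod (h u)) summable_on A"
    and K: "\<And>u. u \<in> A \<Longrightarrow> cmod (f u) \<le> K"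
    and eq: "\<And>u. u \<in> A \<Longrightarrow> f u + \<sigma> * infsum (\<lambda>v. h u * h v / (u + v) * f v) A = 0"
    and w: "w \<in> A"
  shows "f w = 0"
proof -
  let ?T = "wave \<sigma> (\<lambda>J. blaschke J w)"
  have \<sigma>1: "cmod \<sigma> \<le> 1" using \<sigma> by auto
  define F where "F v = h v * f v" for v
  have sF: "F summable_on A"
  proof (rule summable_on_norm_bound)
    show "(\<lambda>u. cmod (h u) * K) summable_on A" using sh by (rule summable_on_cmult_left)
    show "norm (F u) \<le> cmod (h u) * K" if "u \<in> A" for u
      using K[OF that] by (simp add: F_def norm_mult mult_left_mono)
  qed
  obtain C where C: "0 \<le> C" "\<And>u. u \<in> A \<Longrightarrow> cmod (?T u) \<le> C"
    using norm_wave_le[OF \<sigma>1, of "\<lambda>J. blaschke J w" 1 0] norm_blaschke_le w by auto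
  \<comment> \<open>The resolvent column at w with weight g = h^2: one factor h comes from
    \<open>F\<close>, the other from the equation for f.\<close>
  define a where "a u = g u * (?T u / (u + w))" for u
  have Tb: "cmod (?T u / (u + w)) \<le> C * (1 / (2 * \<delta>))" if "u \<in> A" for u
  proof -
    have "cmod (?T u) * cmod (1 / (u + w)) \<le> C * (1 / (2 * \<delta>))"
      using C(1) C(2)[OF that] norm_inverse_add_le[OF that w] by (intro mult_mono) auto
    then show ?thesis by (simp add: norm_divide)
  qed
  from summable_g_bounded[of "\<lambda>u. ?T u / (u + w)", OF Tb, of 0]
  have sa: "a summable_on A" by (simp add: a_def[abs_def])
  have f: "f u = - \<sigma> * h u * infsum (\<lambda>v. F v / (u + v)) A" if "u \<in> A" for u
  proof -
    have "infsum (\<lambda>v. h u * h v / (u + v) * f v) A = h u * infsum (\<lambda>v. F v / (u + v)) A"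
      unfolding infsum_cmult_right'[symmetric] by (simp add: F_def mult_ac)
    with eq[OF that] have "f u + \<sigma> * (h u * infsum (\<lambda>v. F v / (u + v)) A) = 0" by simp
    then show ?thesis by (simp add: eq_neg_iff_add_eq_0 mult.assoc)
  qed
  let ?L = "infsum (\<lambda>u. F u * (?T u / (u + w))) A"
  let ?E = "infsum (\<lambda>v. F v / (w + v)) A"
  \<comment> \<open>\<open>?L\<close> is evaluated through the equation for f and then, after
    exchanging the sums, through the resolvent equation. The latter reproduces \<open>?L\<close>
    minus the tau value times \<open>?E\<close>, so \<open>?E\<close> = 0.\<close>
  have "?L = infsum (\<lambda>u. - \<sigma> * (a u * infsum (\<lambda>v. F v / (u + v)) A)) A"
    by (rule infsum_cong) (simp add: a_def F_def f h[symmetric] mult_ac)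
  also have "\<dots> = - \<sigma> * dbl a F" by (simp only: infsum_cmult_right' dbl_def)
  also have "\<dots> = - \<sigma> * infsum (\<lambda>v. F v * infsum (\<lambda>u. a u / (v + u)) A) A"
    using dbl_swap[OF sa sF] by simp
  also have "\<dots> = infsum (\<lambda>v. - \<sigma> * (F v * infsum (\<lambda>u. a u / (v + u)) A)) A"
    by (rule infsum_cmult_right'[symmetric])
  also have "\<dots> = infsum (\<lambda>v. F v * (?T v / (v + w)) - tau \<sigma> (\<lambda>_. 1) * (F v / (w + v))) A"
  proof (rule infsum_cong)
    fix v assume v: "v \<in> A"
    have "infsum (\<lambda>y. g y * ?T y / ((v + y) * (w + y))) A = infsum (\<lambda>u. a u / (v + u)) A"
      by (simp add: a_def mult_ac add.commute)
    with resolvent_equation[OF \<sigma>1 v w]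
    have "\<sigma> * infsum (\<lambda>u. a u / (v + u)) A = tau \<sigma> (\<lambda>_. 1) / (v + w) - ?T v / (v + w)"
      by (simp add: algebra_simps)
    then have "F v * (\<sigma> * infsum (\<lambda>u. a u / (v + u)) A) = F v * (tau \<sigma> (\<lambda>_. 1) / (v + w) - ?T v / (v + w))"
      by simp
    then show "- \<sigma> * (F v * infsum (\<lambda>u. a u / (v + u)) A) = F v * (?T v / (v + w)) - tau \<sigma> (\<lambda>_. 1) * (F v / (w + v))"
      by (simp add: algebra_simps)
  qed
  also have "\<dots> = ?L - infsum (\<lambda>v. tau \<sigma> (\<lambda>_. 1) * (F v / (w + v))) A"
  proof (rule infsum_diff)
    show "(\<lambda>v. F v * (?T v / (v + w))) summable_on A"
    proof (rule summable_on_norm_bound)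
      show "(\<lambda>u. cmod (F u) * (C * (1 / (2 * \<delta>)))) summable_on A"
        using sF by (intro summable_on_cmult_left) (simp add: summable_on_iff_abs_summable_on_complex)
      show "norm (F u * (?T u / (u + w))) \<le> cmod (F u) * (C * (1 / (2 * \<delta>)))" if "u \<in> A" for u
        unfolding norm_mult
        by (rule mult_left_mono) (use Tb[OF that] in \<open>auto simp: norm_divide\<close>)
    qed
    have "(\<lambda>v. F v / (w + v)) summable_on A"
    proof (rule summable_on_norm_bound)
      show "(\<lambda>u. cmod (F u) * (1 / (2 * \<delta>))) summable_on A"
        using sF by (intro summable_on_cmult_left) (simp add: summable_on_iff_abs_summable_on_complex)
      show "norm (F u / (w + u)) \<le> cmod (F u) * (1 / (2 * \<delta>))" if "u \<in> A" for u
        using mult_left_mono[OF norm_inverse_add_le[OF w that], of "cmod (F u)"] by (simp add: norm_divide)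
    qed
    then show "(\<lambda>v. tau \<sigma> (\<lambda>_. 1) * (F v / (w + v))) summable_on A"
      by (rule summable_on_cmult_right)
  qed
  finally have "?E = 0" using D by (simp add: infsum_cmult_right' del: times_divide_eq_right)
  then show ?thesis using f[OF w] by simp
qed

end

subsection \<open>Differentiation of exponential sums\<close>

lemma sq_le_exp: "0 \<le> s \<Longrightarrow> s\<^sup>2 \<le> 4 * exp (s::real)"
proof -
  assume s: "0 \<le> s"
  have "s / 2 \<le> exp (s / 2)" using exp_ge_add_one_self[of "s / 2"] by linarith
  then have "(s / 2)\<^sup>2 \<le> (exp (s / 2))\<^sup>2" using s by (intro power_mono) auto
  also have "(exp (s / 2))\<^sup>2 = exp s" by (simp add: exp_double[symmetric])
  finally show ?thesis by (simp add: power2_eq_square)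
qed

text \<open>Second-order Taylor remainder: half of the exponent pays for exp(t b), the other half
  for |b|^2 through \<open>sq_le_exp\<close>.\<close>

lemma norm_exp_minus_linear_le:
  assumes "0 < \<epsilon>" "\<bar>t\<bar> < \<epsilon> / 2"
  shows "cmod (exp (of_real t * b) - 1 - of_real t * b) \<le> t\<^sup>2 * (16 / \<epsilon>\<^sup>2 * exp (\<epsilon> * cmod b))"
proof -
  let ?z = "of_real t * b :: complex"
  have "\<bar>Re ?z\<bar> \<le> cmod ?z" by (rule abs_Re_le_cmod)
  also have "\<dots> = \<bar>t\<bar> * cmod b" by (simp add: norm_mult)
  also have "\<dots> \<le> \<epsilon> / 2 * cmod b" using assms by (intro mult_right_mono) auto
  finally have e: "exp \<bar>Re ?z\<bar> \<le> exp (\<epsilon> / 2 * cmod b)" by simp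
  have "(\<epsilon> / 2 * cmod b)\<^sup>2 \<le> 4 * exp (\<epsilon> / 2 * cmod b)" using assms by (intro sq_le_exp) auto
  then have b: "(cmod b)\<^sup>2 \<le> 16 / \<epsilon>\<^sup>2 * exp (\<epsilon> / 2 * cmod b)"
    using assms by (simp add: power_mult_distrib field_simps)
  have "cmod (exp ?z - (\<Sum>k\<le>1. ?z ^ k / fact k)) \<le> exp \<bar>Re ?z\<bar> * cmod ?z ^ Suc 1 / fact 1"
    by (rule Taylor_exp)
  then have "cmod (exp ?z - 1 - ?z) \<le> exp \<bar>Re ?z\<bar> * (t\<^sup>2 * (cmod b)\<^sup>2)"
    by (simp add: norm_mult power_mult_distrib power2_eq_square algebra_simps)
  also have "\<dots> \<le> exp (\<epsilon> / 2 * cmod b) * (t\<^sup>2 * (16 / \<epsilon>\<^sup>2 * exp (\<epsilon> / 2 * cmod b)))"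
    using e b by (intro mult_mono) (auto intro: mult_left_mono)
  also have "\<dots> = t\<^sup>2 * (16 / \<epsilon>\<^sup>2 * exp (\<epsilon> * cmod b))"
    by (simp add: mult_ac exp_add[symmetric])
  finally show ?thesis .
qed

text \<open>The remainders of the terms are bounded by t^2 times a summable majorant, so the
  difference quotient differs from the candidate by at most |t| times its sum.\<close>

lemma infsum_exp_has_vector_derivative:
  fixes a b :: "'a \<Rightarrow> complex"
  assumes \<epsilon>: "0 < \<epsilon>" and summ: "(\<lambda>J. cmod (a J) * exp (\<epsilon> * cmod (b J))) summable_on F"
  shows "((\<lambda>t. infsum (\<lambda>J. a J * exp (of_real t * b J)) F) has_vector_derivative
      infsum (\<lambda>J. a J * b J) F) (at 0)"
  unfolding has_vector_derivative_def
proof (rule has_derivativeI_sandwich)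
  let ?K = "infsum (\<lambda>J. 16 / \<epsilon>\<^sup>2 * (cmod (a J) * exp (\<epsilon> * cmod (b J)))) F"
  have s0: "a summable_on F"
    by (rule summable_on_norm_bound[OF summ]) (use \<epsilon> in \<open>simp add: mult_left_le_one_le mult_le_cancel_left1\<close>)
  have s1: "(\<lambda>J. a J * b J) summable_on F"
  proof (rule summable_on_norm_bound[OF summable_on_cmult_right[OF summ, of "1 / \<epsilon>"]])
    fix J
    have "\<epsilon> * cmod (b J) \<le> exp (\<epsilon> * cmod (b J))" using exp_ge_add_one_self[of "\<epsilon> * cmod (b J)"] by linarith
    then have "cmod (b J) \<le> 1 / \<epsilon> * exp (\<epsilon> * cmod (b J))" using \<epsilon> by (simp add: field_simps)
    then have "cmod (a J) * cmod (b J) \<le> cmod (a J) * (1 / \<epsilon> * exp (\<epsilon> * cmod (b J)))"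
      by (rule mult_left_mono) simp
    then show "norm (a J * b J) \<le> 1 / \<epsilon> * (cmod (a J) * exp (\<epsilon> * cmod (b J)))"
      by (simp add: norm_mult mult_ac)
  qed
  have st: "(\<lambda>J. a J * exp (of_real t * b J)) summable_on F" if "\<bar>t\<bar> < \<epsilon> / 2" for t
  proof (rule summable_on_norm_bound[OF summ])
    fix J
    have "Re (of_real t * b J) \<le> cmod (of_real t * b J)" by (rule complex_Re_le_cmod)
    also have "\<dots> \<le> \<epsilon> * cmod (b J)" using that \<epsilon> by (auto simp: norm_mult intro!: mult_right_mono)
    finally show "norm (a J * exp (of_real t * b J)) \<le> cmod (a J) * exp (\<epsilon> * cmod (b J))"
      by (simp add: norm_mult mult_left_mono)
  qed
  show "0 < \<epsilon> / 2" using \<epsilon> by simp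
  show "bounded_linear (\<lambda>t. t *\<^sub>R infsum (\<lambda>J. a J * b J) F)" by (rule bounded_linear_scaleR_left)
  show "((\<lambda>t. \<bar>t\<bar> * ?K) \<longlongrightarrow> 0) (at 0)" by (auto intro!: tendsto_eq_intros)
  fix t :: real assume t: "t \<in> UNIV" "t \<noteq> 0" "dist t 0 < \<epsilon> / 2"
  then have t': "\<bar>t\<bar> < \<epsilon> / 2" by simp
  have eq: "infsum (\<lambda>J. a J * exp (of_real t * b J)) F - infsum (\<lambda>J. a J * exp (of_real 0 * b J)) F
      - (t - 0) *\<^sub>R infsum (\<lambda>J. a J * b J) F =
      infsum (\<lambda>J. a J * (exp (of_real t * b J) - 1 - of_real t * b J)) F"
  proof -
    have "infsum (\<lambda>J. a J * (exp (of_real t * b J) - 1 - of_real t * b J)) F =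
        infsum (\<lambda>J. (a J * exp (of_real t * b J) - a J) - of_real t * (a J * b J)) F"
      by (simp add: algebra_simps)
    also have "\<dots> = infsum (\<lambda>J. a J * exp (of_real t * b J) - a J) F - infsum (\<lambda>J. of_real t * (a J * b J)) F"
    proof (rule infsum_diff)
      show "(\<lambda>J. a J * exp (of_real t * b J) - a J) summable_on F"
        using summable_on_add[OF st[OF t'] summable_on_uminus[THEN iffD2, OF s0]] by simp
    qed (intro summable_on_cmult_right s1)
    also have "infsum (\<lambda>J. a J * exp (of_real t * b J) - a J) F = infsum (\<lambda>J. a J * exp (of_real t * b J)) F - infsum a F"
      by (rule infsum_diff[OF st[OF t'] s0])
    finally show ?thesis by (simp add: infsum_cmult_right' scaleR_conv_of_real)
  qed
  have "cmod (infsum (\<lambda>J. a J * (exp (of_real t * b J) - 1 - of_real t * b J)) F) \<le> t\<^sup>2 * ?K"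
    unfolding infsum_cmult_right'[of "t\<^sup>2", symmetric]
  proof (rule norm_infsum_le)
    let ?B = "\<lambda>J. t\<^sup>2 * (16 / \<epsilon>\<^sup>2 * (cmod (a J) * exp (\<epsilon> * cmod (b J))))"
    have sB: "?B summable_on F" by (intro summable_on_cmult_right summ)
    then show "(?B has_sum infsum ?B F) F" by simp
    show le: "cmod (a J * (exp (of_real t * b J) - 1 - of_real t * b J)) \<le> ?B J" if "J \<in> F" for J
    proof -
      have "cmod (a J) * cmod (exp (of_real t * b J) - 1 - of_real t * b J) \<le>
          cmod (a J) * (t\<^sup>2 * (16 / \<epsilon>\<^sup>2 * exp (\<epsilon> * cmod (b J))))"
        by (rule mult_left_mono[OF norm_exp_minus_linear_le[OF \<epsilon> t']]) simp
      then show ?thesis by (simp add: norm_mult mult_ac)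
    qed
    show "((\<lambda>J. a J * (exp (of_real t * b J) - 1 - of_real t * b J)) has_sum
        infsum (\<lambda>J. a J * (exp (of_real t * b J) - 1 - of_real t * b J)) F) F"
      using summable_on_norm_bound[OF sB le] by simp
  qed
  then show "norm (infsum (\<lambda>J. a J * exp (of_real t * b J)) F - infsum (\<lambda>J. a J * exp (of_real 0 * b J)) F
      - (t - 0) *\<^sub>R infsum (\<lambda>J. a J * b J) F) / norm (t - 0) \<le> \<bar>t\<bar> * ?K"
    unfolding eq using t(2) by (simp add: divide_le_eq power2_eq_square mult_ac)
qed

lemma kappa_mult:
  assumes "finite J"
  shows "kappa (\<lambda>u. g u * exp (c * u ^ k)) \<sigma> J = kappa g \<sigma> J * exp (c * psum k J)"
proof -
  have "sdet J (\<lambda>u v. g v * exp (c * v ^ k) / (u + v)) =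
      sdet J (\<lambda>u v. g v / (u + v)) * (\<Prod>v\<in>J. exp (c * v ^ k))"
    using sdet_mult_col[of J "\<lambda>u v. g v / (u + v)" "\<lambda>v. exp (c * v ^ k)"] by (simp add: mult_ac)
  then show ?thesis
    using assms by (simp add: kappa_def psum_def sum_distrib_left exp_sum)
qed

section \<open>Derivatives of tau functions along the two flows\<close>

context tau_data
begin

text \<open>The flow multiplies the term of J by exp(t c p_k), so its derivative inserts c p_k. Half
  of \<epsilon> absorbs the weight \<phi>, the other half the exponential.\<close>

lemma tau_has_vector_derivative:
  assumes k: "k = 1 \<or> k = 3" and \<sigma>: "cmod \<sigma> \<le> 1" and c: "\<bar>c\<bar> \<le> 1"
    and \<phi>: "\<And>J. J \<in> Fpow A \<Longrightarrow> cmod (\<phi> J) \<le> (1 + sum wt J) ^ m"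
  shows "((\<lambda>t. tau_fun A (\<lambda>u. g u * exp (of_real (t * c) * u ^ k)) \<sigma> \<phi>) has_vector_derivative
      of_real c * tau \<sigma> (\<lambda>J. psum k J * \<phi> J)) (at 0)"
proof -
  obtain C where C: "0 \<le> C" "\<And>s. 0 \<le> s \<Longrightarrow> (1 + s) ^ m \<le> C * exp (\<epsilon> / 2 * s)"
    using power_le_exp_bound[of "\<epsilon> / 2" m] \<epsilon> by auto
  have "((\<lambda>t. infsum (\<lambda>J. \<kappa> \<sigma> J * \<phi> J * exp (of_real t * (of_real c * psum k J))) (Fpow A)) has_vector_derivative
      infsum (\<lambda>J. \<kappa> \<sigma> J * \<phi> J * (of_real c * psum k J)) (Fpow A)) (at 0)"
  proof (rule infsum_exp_has_vector_derivative)
    show "0 < \<epsilon> / 2" using \<epsilon> by simp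
    show "(\<lambda>J. cmod (\<kappa> \<sigma> J * \<phi> J) * exp (\<epsilon> / 2 * cmod (of_real c * psum k J))) summable_on Fpow A"
    proof (rule summable_on_norm_bound[OF summable_on_cmult_right[OF summable_\<kappa>_exp[OF \<sigma>], of C]])
      fix J assume J: "J \<in> Fpow A"
      have W: "0 \<le> sum wt J" by (simp add: sum_nonneg)
      have "cmod (\<phi> J) \<le> C * exp (\<epsilon> / 2 * sum wt J)" using \<phi>[OF J] C(2)[OF W] by linarith
      moreover have "cmod (of_real c * psum k J) \<le> 1 * sum wt J"
        unfolding norm_mult using k c norm_psum_le_wt[of J] by (intro mult_mono) auto
      then have "exp (\<epsilon> / 2 * cmod (of_real c * psum k J)) \<le> exp (\<epsilon> / 2 * sum wt J)"
        using \<epsilon> by simp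
      ultimately have "cmod (\<phi> J) * exp (\<epsilon> / 2 * cmod (of_real c * psum k J)) \<le>
          C * exp (\<epsilon> / 2 * sum wt J) * exp (\<epsilon> / 2 * sum wt J)"
        using C(1) by (intro mult_mono) auto
      also have "\<dots> = C * exp (\<epsilon> * sum wt J)" by (simp add: mult.assoc exp_add[symmetric])
      finally have "cmod (\<kappa> \<sigma> J) * (cmod (\<phi> J) * exp (\<epsilon> / 2 * cmod (of_real c * psum k J))) \<le>
          cmod (\<kappa> \<sigma> J) * (C * exp (\<epsilon> * sum wt J))"
        by (rule mult_left_mono) simp
      then show "norm (cmod (\<kappa> \<sigma> J * \<phi> J) * exp (\<epsilon> / 2 * cmod (of_real c * psum k J))) \<le>
          C * (cmod (\<kappa> \<sigma> J) * exp (\<epsilon> * sum wt J))"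
        by (simp add: norm_mult mult_ac)
    qed
  qed
  moreover have "infsum (\<lambda>J. \<kappa> \<sigma> J * \<phi> J * exp (of_real t * (of_real c * psum k J))) (Fpow A) =
      tau_fun A (\<lambda>u. g u * exp (of_real (t * c) * u ^ k)) \<sigma> \<phi>" for t
    unfolding tau_fun_def
    by (rule infsum_cong) (subst kappa_mult, auto simp: Fpow_def mult_ac)
  moreover have "infsum (\<lambda>J. \<kappa> \<sigma> J * \<phi> J * (of_real c * psum k J)) (Fpow A) =
      of_real c * tau \<sigma> (\<lambda>J. psum k J * \<phi> J)"
    unfolding tau_fun_def infsum_cmult_right'[symmetric] by (simp add: mult_ac)
  ultimately show ?thesis by simp
qed

end

subsection \<open>Estimates on the discrete sets\<close>

lemma S_plus_iff: "u \<in> S_plus z \<longleftrightarrow> exp (- u\<^sup>2 / 2) = z \<and> 0 < Re u"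
proof
  assume "exp (- u\<^sup>2 / 2) = z \<and> 0 < Re u"
  then have "- u \<in> S_minus z" by (simp add: S_minus_def)
  then show "u \<in> S_plus z" unfolding S_plus_def by (rule rev_image_eqI) simp
qed (auto simp: S_plus_def S_minus_def)

lemma S_minus_iff: "u \<in> S_minus z \<longleftrightarrow> - u \<in> S_plus z"
  by (simp add: S_plus_iff) (simp add: S_minus_def)

lemma S_minus_eq: "S_minus z = uminus ` S_plus z"
  by (auto simp: S_plus_def image_image)

lemma S_all_eq: "S_all z = S_plus z \<union> uminus ` S_plus z"
  by (simp add: S_all_def S_minus_eq)

text \<open>Termwise comparison with the geometric series, as the denominators have modulus at least
  1.\<close>

lemma norm_polylog_half_le:
  assumes "cmod w < 1"
  shows "cmod (polylog (1 / 2) w) \<le> cmod w / (1 - cmod w)"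
proof -
  let ?f = "\<lambda>k. w ^ Suc k / of_nat (Suc k) powr (1 / 2 :: complex)"
  have g: "(\<lambda>k. cmod w * cmod w ^ k) sums (cmod w * (1 / (1 - cmod w)))"
    using assms by (intro sums_mult geometric_sums) auto
  have le: "norm (?f k) \<le> cmod w * cmod w ^ k" for k
  proof -
    have "norm (of_nat (Suc k) powr (1 / 2) :: complex) = real (Suc k) powr (1 / 2)"
      using norm_powr_real_powr[of "of_nat (Suc k)" "1 / 2"] by simp
    moreover have "1 \<le> real (Suc k) powr (1 / 2)" by (rule ge_one_powr_ge_zero) auto
    ultimately have "1 \<le> norm (of_nat (Suc k) powr (1 / 2) :: complex)" by simp
    then have "norm (w ^ Suc k) / norm (of_nat (Suc k) powr (1 / 2) :: complex) \<le> norm (w ^ Suc k) / 1"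
      by (intro divide_left_mono) auto
    then show ?thesis by (simp add: norm_divide norm_mult norm_power)
  qed
  have s: "summable (\<lambda>k. norm (?f k))"
    by (rule summable_comparison_test[OF _ sums_summable[OF g]]) (use le in auto)
  have "norm (suminf ?f) \<le> (\<Sum>k. norm (?f k))" by (rule summable_norm[OF s])
  also have "\<dots> \<le> (\<Sum>k. cmod w * cmod w ^ k)"
    by (rule suminf_le[OF le s sums_summable[OF g]])
  also have "\<dots> = cmod w / (1 - cmod w)" using sums_unique[OF g] by simp
  finally show ?thesis unfolding polylog_def .
qed

lemma exp_has_integral_atMost: "((\<lambda>t::real. exp t) has_integral 1) {..0}"
proof -
  have "((\<lambda>x. exp (- 1 * x) :: real) has_integral exp (- 1 * 0) / 1) {0..}"
    by (rule has_integral_exp_minus_to_infinity) simp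
  then have h: "((\<lambda>x. exp (- x) :: real) has_integral 1) {0..}" by simp
  then have "(\<lambda>x. exp (- x) :: real) absolutely_integrable_on {0..}"
    by (intro nonnegative_absolutely_integrable_1) auto
  moreover have "integral {0..} (\<lambda>x. exp (- x) :: real) = 1" using h by (rule integral_unique)
  ultimately have "(\<lambda>x::real. exp x) absolutely_integrable_on {..0} \<and> integral {..0} (\<lambda>x::real. exp x) = 1"
    using has_absolute_integral_reflect_real[of "{0..}" "{..0}" "\<lambda>x::real. exp x" 1] by (auto simp: image_iff)
  then show ?thesis
    using integrable_integral[of exp "{..0::real}"] by (simp add: absolutely_integrable_on_def)
qed

text \<open>Integrability is not needed: the integral of a non-integrable function is 0 by convention.\<close>
lemma norm_Q_fun_le:
  assumes "cmod z < 1" "\<xi> \<in> S_minus z"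
  shows "cmod (Q_fun \<xi>) \<le> sqrt (2 / pi) * (exp (1 / 2) / (1 - cmod z))"
proof -
  let ?f = "\<lambda>t::real. polylog (1 / 2) (exp (- (\<xi> + of_real t)\<^sup>2 / 2))"
  let ?c = "exp (1 / 2) / (1 - cmod z)"
  have \<xi>: "exp (- \<xi>\<^sup>2 / 2) = z" "Re \<xi> < 0" using assms(2) by (auto simp: S_minus_def)
  have le: "norm (?f t) \<le> ?c * exp t" if "t \<in> {..0}" for t
  proof -
    let ?w = "exp (- (\<xi> + of_real t)\<^sup>2 / 2) :: complex"
    have t: "t \<le> 0" using that by simp
    have "- (\<xi> + of_real t)\<^sup>2 / 2 = - \<xi>\<^sup>2 / 2 + of_real (- t\<^sup>2 / 2) + - (of_real t * \<xi>)"
      by (simp add: power2_eq_square field_simps)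
    then have "?w = z * exp (of_real (- t\<^sup>2 / 2)) * exp (- (of_real t * \<xi>))"
      by (simp only: exp_add \<xi>(1))
    then have w: "cmod ?w = cmod z * exp (- t\<^sup>2 / 2) * exp (- (t * Re \<xi>))"
      by (simp add: norm_mult)
    have "0 \<le> t * Re \<xi>" using t \<xi>(2) by (simp add: mult_nonpos_nonpos)
    then have e: "exp (- (t * Re \<xi>)) \<le> 1" by simp
    \<comment> \<open>Completing the square turns the Gaussian into the integrable majorant exp(1/2)
      exp(t) on t <= 0; the estimate \<open>wz\<close> below keeps 1 - |w| away from 0.\<close>
    have "- t\<^sup>2 / 2 \<le> t + 1 / 2" using zero_le_power2[of "t + 1"] by (simp add: power2_eq_square field_simps)
    then have e2: "exp (- t\<^sup>2 / 2) \<le> exp (1 / 2) * exp t" by (simp add: exp_add[symmetric] add.commute)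
    have "cmod ?w \<le> cmod z * 1 * 1"
      unfolding w using e by (intro mult_mono) auto
    then have wz: "cmod ?w \<le> cmod z" by simp
    have we: "cmod ?w \<le> 1 * (exp (1 / 2) * exp t) * 1"
      unfolding w using assms(1) e e2 by (intro mult_mono) auto
    have "norm (?f t) \<le> cmod ?w / (1 - cmod ?w)"
      using wz assms(1) by (intro norm_polylog_half_le) (rule le_less_trans)
    also have "\<dots> \<le> (exp (1 / 2) * exp t) / (1 - cmod z)"
    proof (rule frac_le)
      show "cmod ?w \<le> exp (1 / 2) * exp t" using we by simp
      show "0 < 1 - cmod z" "1 - cmod z \<le> 1 - cmod ?w" using wz assms(1) by linarith+
    qed simp
    finally show ?thesis by simp
  qed
  have "norm (integral {..0} ?f) \<le> ?c"
  proof (cases "?f integrable_on {..0}")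
    case True
    have h: "((\<lambda>t. ?c * exp t) has_integral ?c * 1) {..0::real}"
      by (rule has_integral_mult_right[OF exp_has_integral_atMost])
    have "norm (integral {..0} ?f) \<le> integral {..0} (\<lambda>t. ?c * exp t)"
      using h by (intro integral_norm_bound_integral True le) (auto simp: integrable_on_def)
    also have "\<dots> = ?c" using integral_unique[OF h] by (simp only: mult_1_right)
    finally show ?thesis .
  next
    case False
    then show ?thesis using assms(1) by (simp add: not_integrable_integral)
  qed
  then show ?thesis
    unfolding Q_fun_def norm_mult by (intro mult_mono) auto
qed

section \<open>Geometry of the discrete set: hyperbola, sector and summability\<close>

context
  fixes z :: complex and \<rho> :: real
  assumes z: "0 < cmod z" "cmod z < 1"
  defines "\<rho> \<equiv> - 2 * ln (cmod z)"
begin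

lemma \<rho>_pos: "0 < \<rho>"
  using z by (simp add: \<rho>_def)

text \<open>Taking moduli in exp(-u^2/2) = z puts u on a hyperbola, and eliminating Im u from
  Re(u^3) = Re(u)^3 - 3 Re(u) Im(u)^2 leaves the leading term -2 Re(u)^3. The decay of the weights
  comes from this sign.\<close>

lemma S_plus_Re_Im:
  assumes "u \<in> S_plus z"
  shows "(Re u)\<^sup>2 - (Im u)\<^sup>2 = \<rho>" "(cmod u)\<^sup>2 = 2 * (Re u)\<^sup>2 - \<rho>"
    "Re (u ^ 3) = 3 * \<rho> * Re u - 2 * Re u ^ 3" "sqrt \<rho> \<le> Re u" "\<bar>Im u\<bar> \<le> Re u"
proof -
  have u: "exp (- u\<^sup>2 / 2) = z" "0 < Re u" using assms by (auto simp: S_plus_iff)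
  have "cmod (exp (- u\<^sup>2 / 2)) = exp (Re (- u\<^sup>2 / 2))" by (rule norm_exp_eq_Re)
  then have "ln (cmod z) = Re (- u\<^sup>2 / 2)" unfolding u(1) by simp
  also have "\<dots> = ((Im u)\<^sup>2 - (Re u)\<^sup>2) / 2"
    by (simp only: Re_divide_numeral uminus_complex.sel Re_power2 minus_diff_eq)
  finally show 1: "(Re u)\<^sup>2 - (Im u)\<^sup>2 = \<rho>"
    unfolding \<rho>_def by (simp add: field_simps)
  show "(cmod u)\<^sup>2 = 2 * (Re u)\<^sup>2 - \<rho>" unfolding cmod_power2 using 1 by linarith
  have "Re (u ^ 3) = Re (u * u * u)" unfolding power3_eq_cube ..
  also have "\<dots> = Re u * ((Re u)\<^sup>2 - 3 * (Im u)\<^sup>2)"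
    unfolding power2_eq_square times_complex.sel by (simp add: algebra_simps)
  also have "(Im u)\<^sup>2 = (Re u)\<^sup>2 - \<rho>" using 1 by linarith
  also have "Re u * ((Re u)\<^sup>2 - 3 * ((Re u)\<^sup>2 - \<rho>)) = 3 * \<rho> * Re u - 2 * Re u ^ 3"
    unfolding power2_eq_square power3_eq_cube by (simp add: algebra_simps)
  finally show "Re (u ^ 3) = 3 * \<rho> * Re u - 2 * Re u ^ 3" .
  have "0 \<le> (Im u)\<^sup>2" by simp
  with 1 have "\<rho> \<le> (Re u)\<^sup>2" by linarith
  then have "sqrt \<rho> \<le> sqrt ((Re u)\<^sup>2)" by (rule real_sqrt_le_mono)
  then show "sqrt \<rho> \<le> Re u" using u(2) by (simp only: real_sqrt_abs abs_of_pos)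
  have "(Im u)\<^sup>2 \<le> (Re u)\<^sup>2" using 1 \<rho>_pos by linarith
  then have "\<bar>Im u\<bar> \<le> \<bar>Re u\<bar>" by (simp only: abs_le_square_iff)
  then show "\<bar>Im u\<bar> \<le> Re u" using u(2) by (simp only: abs_of_pos)
qed

text \<open>|u + v|^2 - |u - v|^2 is 4 (Re u Re v + Im u Im v), which is nonnegative in the sector
  |Im u| <= Re u.\<close>

lemma S_plus_sector:
  assumes "u \<in> S_plus z" "v \<in> S_plus z"
  shows "cmod (u - v) \<le> cmod (u + v)"
proof -
  have "\<bar>Im u * Im v\<bar> \<le> Re u * Re v"
    unfolding abs_mult using S_plus_Re_Im(5)[OF assms(1)] S_plus_Re_Im(5)[OF assms(2)]
    by (intro mult_mono) auto
  then have "(cmod (u - v))\<^sup>2 \<le> (cmod (u + v))\<^sup>2"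
    unfolding cmod_power2 by (simp add: power2_eq_square algebra_simps)
  then show ?thesis by (rule power2_le_imp_le) simp
qed

text \<open>These w, the squares of the points, are the values of -2 log z and so are spaced by 4 pi
  i; the sum is compared with that of 1/k^2.\<close>

lemma summable_inverse_square_logs:
  "(\<lambda>w. 1 / (cmod w)\<^sup>2) summable_on {w. exp (- w / 2) = z}"
proof -
  define w0 where "w0 = - 2 * Ln z"
  define f where "f k = w0 + of_real (4 * pi * of_int k) * \<i>" for k :: int
  have zn: "z \<noteq> 0" using z by auto
  have sub: "{w. exp (- w / 2) = z} \<subseteq> range f"
  proof
    fix w assume "w \<in> {w. exp (- w / 2) = z}"
    then have "exp (- w / 2) = exp (Ln z)" using zn by simp
    then obtain n :: int where n: "- w / 2 = Ln z + of_int (2 * n) * pi * \<i>" by (auto simp: exp_eq)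
    have "w = - 2 * (- w / 2)" by simp
    also note n
    finally have "w = - 2 * (Ln z + of_int (2 * n) * pi * \<i>)" .
    then have "w = f (- n)" by (simp add: f_def w0_def algebra_simps)
    then show "w \<in> range f" by blast
  qed
  have inj: "inj f" by (auto simp: f_def inj_def)
  \<comment> \<open>With this principal choice |Im (f k)| >= 4 pi |k| - 2 pi >= |k| for k different
    from 0.\<close>
  have Im: "\<bar>Im w0\<bar> \<le> 2 * pi"
    using mpi_less_Im_Ln[OF zn] Im_Ln_le_pi[OF zn] by (simp add: w0_def abs_le_iff)
  have bound: "1 / (cmod (f k))\<^sup>2 \<le> 1 / (of_int k)\<^sup>2" if "k \<noteq> 0" for k
  proof -
    have k: "1 \<le> \<bar>real_of_int k\<bar>" using that by linarith
    have "4 * pi * \<bar>real_of_int k\<bar> - 2 * pi \<le> \<bar>Im w0 + 4 * pi * of_int k\<bar>"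
      using Im abs_triangle_ineq2[of "4 * pi * of_int k" "- Im w0"] by (simp add: abs_mult add.commute)
    moreover have "\<bar>real_of_int k\<bar> \<le> 4 * pi * \<bar>real_of_int k\<bar> - 2 * pi"
    proof -
      have "1 * \<bar>real_of_int k\<bar> \<le> (2 * pi) * \<bar>real_of_int k\<bar>"
        using pi_gt3 by (intro mult_right_mono) auto
      moreover have "2 * pi * 1 \<le> 2 * pi * \<bar>real_of_int k\<bar>" using k by (intro mult_left_mono) auto
      ultimately show ?thesis by linarith
    qed
    moreover have "\<bar>Im (f k)\<bar> \<le> cmod (f k)" by (rule abs_Im_le_cmod)
    ultimately have "\<bar>real_of_int k\<bar> \<le> cmod (f k)" by (simp add: f_def)
    then have "\<bar>real_of_int k\<bar>\<^sup>2 \<le> (cmod (f k))\<^sup>2" by (intro power_mono) auto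
    then show ?thesis using that by (intro divide_left_mono) (auto intro!: mult_pos_pos)
  qed
  have "summable (\<lambda>n. inverse (real (Suc n) ^ 2))"
    by (subst summable_Suc_iff) (rule inverse_power_summable, simp)
  then have nat: "(\<lambda>n::nat. 1 / (real (Suc n))\<^sup>2) summable_on UNIV"
    by (intro norm_summable_imp_summable_on) (simp add: divide_inverse)
  have pos: "(\<lambda>k. 1 / (cmod (f k))\<^sup>2) summable_on range (\<lambda>n. int (Suc n))"
  proof (rule summable_on_reindex[THEN iffD2])
    show "inj (\<lambda>n. int (Suc n))" by (auto simp: inj_def)
    show "(\<lambda>k. 1 / (cmod (f k))\<^sup>2) \<circ> (\<lambda>n. int (Suc n)) summable_on UNIV"
    proof (rule summable_on_comparison_test[OF nat])
      fix n :: nat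
      show "((\<lambda>k. 1 / (cmod (f k))\<^sup>2) \<circ> (\<lambda>n. int (Suc n))) n \<le> 1 / (real (Suc n))\<^sup>2"
        using bound[of "int (Suc n)"] by simp
    qed simp
  qed
  have neg: "(\<lambda>k. 1 / (cmod (f k))\<^sup>2) summable_on range (\<lambda>n. - int (Suc n))"
  proof (rule summable_on_reindex[THEN iffD2])
    show "inj (\<lambda>n. - int (Suc n))" by (auto simp: inj_def)
    show "(\<lambda>k. 1 / (cmod (f k))\<^sup>2) \<circ> (\<lambda>n. - int (Suc n)) summable_on UNIV"
    proof (rule summable_on_comparison_test[OF nat])
      fix n :: nat
      show "((\<lambda>k. 1 / (cmod (f k))\<^sup>2) \<circ> (\<lambda>n. - int (Suc n))) n \<le> 1 / (real (Suc n))\<^sup>2"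
        using bound[of "- int (Suc n)"] by (simp add: power2_eq_square algebra_simps)
    qed simp
  qed
  have un: "(UNIV :: int set) = insert 0 (range (\<lambda>n. int (Suc n)) \<union> range (\<lambda>n. - int (Suc n)))"
  proof -
    have "k \<in> insert 0 (range (\<lambda>n. int (Suc n)) \<union> range (\<lambda>n. - int (Suc n)))" for k :: int
    proof (cases k "0 :: int" rule: linorder_cases)
      case less
      then have "k = - int (Suc (nat (- k - 1)))" by simp
      then show ?thesis by (intro insertI2 UnI2 range_eqI)
    next
      case greater
      then have "k = int (Suc (nat (k - 1)))" by simp
      then show ?thesis by (intro insertI2 UnI1 range_eqI)
    qed simp
    then show ?thesis by (rule UNIV_eq_I)
  qed
  have "(\<lambda>k. 1 / (cmod (f k))\<^sup>2) summable_on insert 0 (range (\<lambda>n. int (Suc n)) \<union> range (\<lambda>n. - int (Suc n)))"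
    using summable_on_union[OF pos neg] by (rule summable_on_insert_iff[THEN iffD2])
  then have "(\<lambda>k. 1 / (cmod (f k))\<^sup>2) summable_on UNIV"
    by (simp only: un[symmetric])
  then have "(\<lambda>w. 1 / (cmod w)\<^sup>2) summable_on range f"
    by (intro summable_on_reindex[OF inj, THEN iffD2]) (simp add: o_def)
  then show ?thesis using sub by (rule summable_on_subset_banach)
qed

text \<open>In the right half-plane u is determined by u^2, so the points inject into the
  logarithms.\<close>

lemma summable_inverse_fourth_S_plus:
  "(\<lambda>u. 1 / (cmod u) ^ 4) summable_on S_plus z"
proof -
  have inj: "inj_on (\<lambda>u. u\<^sup>2) (S_plus z)"
  proof (rule inj_onI)
    fix u v assume uv: "u \<in> S_plus z" "v \<in> S_plus z" "u\<^sup>2 = v\<^sup>2"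
    then have "Re u \<noteq> - Re v" by (auto simp: S_plus_iff)
    then show "u = v" using uv(3) by (auto simp: power2_eq_iff)
  qed
  have "(\<lambda>w. 1 / (cmod w)\<^sup>2) summable_on (\<lambda>u. u\<^sup>2) ` S_plus z"
    by (rule summable_on_subset_banach[OF summable_inverse_square_logs]) (auto simp: S_plus_iff)
  then show ?thesis
    unfolding summable_on_reindex[OF inj] by (simp add: o_def norm_power power_mult[symmetric])
qed

text \<open>The cubic term dominates (|L| + 1) Re u up to a constant, which leaves exp(-Re u), and
  on the hyperbola this is at most a multiple of |u|^(-4).\<close>

lemma summable_exp_cubic:
  assumes "0 < c"
  shows "(\<lambda>u. exp (- c * Re u ^ 3 + L * Re u)) summable_on S_plus z"
proof -
  \<comment> \<open>Beyond \<open>a0\<close> one has c a^2 >= |L| + 1; up to \<open>a0\<close> the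
    linear term is at most \<open>?K\<close>.\<close>
  define a0 where "a0 = sqrt ((\<bar>L\<bar> + 1) / c)"
  let ?K = "(\<bar>L\<bar> + 1) * a0"
  have a0: "0 \<le> a0" "a0\<^sup>2 = (\<bar>L\<bar> + 1) / c" using assms by (simp_all add: a0_def)
  show ?thesis
  proof (rule summable_on_norm_bound)
    show "(\<lambda>u. (exp ?K * 256 * 4) * (1 / (cmod u) ^ 4)) summable_on S_plus z"
      by (intro summable_on_cmult_right summable_inverse_fourth_S_plus)
    fix u assume u: "u \<in> S_plus z"
    let ?a = "Re u"
    have a: "0 < ?a" using u by (simp add: S_plus_iff)
    have "- c * ?a ^ 3 + (\<bar>L\<bar> + 1) * ?a \<le> ?K"
    proof (cases "?a \<le> a0")
      case True
      then have "(\<bar>L\<bar> + 1) * ?a \<le> ?K" by (intro mult_left_mono) auto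
      moreover have "0 \<le> c * ?a ^ 3" using assms a by simp
      ultimately show ?thesis by linarith
    next
      case False
      then have "a0\<^sup>2 \<le> ?a\<^sup>2" using a0 by (intro power_mono) auto
      then have "(\<bar>L\<bar> + 1) \<le> c * ?a\<^sup>2" using a0 assms by (simp add: field_simps)
      then have "(\<bar>L\<bar> + 1) * ?a \<le> c * ?a\<^sup>2 * ?a" using a by (intro mult_right_mono) auto
      moreover have "0 \<le> ?K" using a0 by simp
      ultimately show ?thesis by (simp add: power3_eq_cube power2_eq_square mult_ac)
    qed
    moreover have "L * ?a \<le> \<bar>L\<bar> * ?a" using a by (intro mult_right_mono) auto
    ultimately have "- c * ?a ^ 3 + L * ?a \<le> ?K - ?a" by (simp add: algebra_simps)
    then have "exp (- c * ?a ^ 3 + L * ?a) \<le> exp ?K * exp (- ?a)"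
      unfolding mult_exp_exp by simp
    also have "\<dots> \<le> exp ?K * (256 * 4 / (cmod u) ^ 4)"
    proof (rule mult_left_mono)
      \<comment> \<open>\<open>sq_le_exp\<close> at a / 2, squared, gives a^4 <= 256 exp(a). The
        further factor 4 comes from |u|^2 <= 2 a^2.\<close>
      have "(?a / 2)\<^sup>2 \<le> 4 * exp (?a / 2)" using a by (intro sq_le_exp) simp
      then have "(?a\<^sup>2)\<^sup>2 \<le> (16 * exp (?a / 2))\<^sup>2" by (intro power_mono) (simp_all add: power_divide)
      also have "\<dots> = 256 * exp ?a" unfolding power_mult_distrib exp_double[symmetric] by simp
      finally have e: "?a ^ 4 \<le> 256 * exp ?a" by simp
      have "(cmod u)\<^sup>2 \<le> 2 * ?a\<^sup>2" using S_plus_Re_Im(2)[OF u] \<rho>_pos by simp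
      then have "((cmod u)\<^sup>2)\<^sup>2 \<le> (2 * ?a\<^sup>2)\<^sup>2" by (intro power_mono) auto
      then have "cmod u ^ 4 \<le> 4 * ?a ^ 4" by (simp add: power_mult_distrib)
      also have "\<dots> \<le> 4 * (256 * exp ?a)" using e by simp
      finally have "exp (- ?a) * cmod u ^ 4 \<le> exp (- ?a) * (4 * (256 * exp ?a))"
        by (intro mult_left_mono) auto
      also have "\<dots> = 256 * 4 * (exp (- ?a) * exp ?a)" by (simp only: mult_ac)
      also have "exp (- ?a) * exp ?a = 1" unfolding mult_exp_exp by simp
      finally have "exp (- ?a) * cmod u ^ 4 \<le> 256 * 4" by simp
      moreover have "u \<noteq> 0" using a by auto
      then have "0 < cmod u ^ 4" by simp
      ultimately show "exp (- ?a) \<le> 256 * 4 / (cmod u) ^ 4"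
        by (simp only: pos_le_divide_eq)
    qed simp
    finally show "norm (exp (- c * ?a ^ 3 + L * ?a)) \<le> (exp ?K * 256 * 4) * (1 / (cmod u) ^ 4)"
      by (simp add: mult_ac)
  qed
qed

lemma wt_le:
  assumes "u \<in> S_plus z"
  shows "wt u \<le> 2 * Re u + 8 * Re u ^ 3"
proof -
  have "cmod u \<le> \<bar>Re u\<bar> + \<bar>Im u\<bar>" by (rule cmod_le)
  also have "\<dots> \<le> 2 * Re u" using S_plus_Re_Im(5)[OF assms] assms by (simp add: S_plus_iff)
  finally have 1: "cmod u \<le> 2 * Re u" .
  then have "cmod u ^ 3 \<le> (2 * Re u) ^ 3" by (intro power_mono) auto
  then show ?thesis using 1 by (simp add: wt_def power_mult_distrib)
qed

end

subsection \<open>Inverting the doubled operator\<close>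

text \<open>Points carry mass one, so square-summable functions are bounded; the uniqueness argument
  works in this larger class.\<close>

lemma ell2_bounded:
  assumes "f \<in> ell2 A"
  obtains K where "0 \<le> K" "\<And>u. u \<in> A \<Longrightarrow> cmod (f u) \<le> K"
proof
  have s: "(\<lambda>u. (cmod (f u))\<^sup>2) summable_on A" using assms by (simp add: ell2_def)
  let ?S = "infsum (\<lambda>u. (cmod (f u))\<^sup>2) A"
  show "0 \<le> sqrt ?S" by (simp add: infsum_nonneg)
  show "cmod (f u) \<le> sqrt ?S" if "u \<in> A" for u
  proof (rule real_le_rsqrt)
    show "(cmod (f u))\<^sup>2 \<le> ?S"
      using finite_sum_le_infsum[OF s, of "{u}"] that by simp
  qed
qed

text \<open>h is a square root of g, which makes the kernel \<open>M\<close> symmetric; summability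
  of h itself lets \<open>M\<close> act on bounded functions by absolutely convergent sums.\<close>

locale tau_root_data = tau_data +
  fixes h :: "complex \<Rightarrow> complex"
  assumes h_sq: "\<And>u. u \<in> A \<Longrightarrow> h u * h u = g u"
    and h_nonzero: "\<And>u. u \<in> A \<Longrightarrow> h u \<noteq> 0"
    and summable_h: "(\<lambda>u. cmod (h u)) summable_on A"
begin

definition M :: "complex \<Rightarrow> complex \<Rightarrow> complex" where
  "M u v = h u * h v / (u + v)"

definition mulM :: "(complex \<Rightarrow> complex) \<Rightarrow> complex \<Rightarrow> complex" where
  "mulM F u = infsum (\<lambda>v. M u v * F v) A"

lemma sdet_M:
  assumes "J \<in> Fpow A"
  shows "sdet J M = sdet J (\<lambda>u v. g v / (u + v))"
proof -
  have J: "finite J" "J \<subseteq> A" using assms by (auto simp: Fpow_def)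
  have "sdet J (\<lambda>u v. g v / (u + v)) = sdet J (\<lambda>u v. h u * (g v / (u + v)) / h v)"
    using J h_nonzero by (intro sdet_conjugate[symmetric]) auto
  also have "\<dots> = sdet J M"
    using J h_nonzero by (intro sdet_cong) (auto simp: M_def subset_eq simp flip: h_sq)
  finally show ?thesis ..
qed

lemma norm_M_le:
  assumes "u \<in> A" "v \<in> A"
  shows "cmod (M u v) \<le> 1 / (2 * \<delta>) * cmod (h u) * cmod (h v)"
proof -
  have "cmod (h u) * cmod (h v) * cmod (1 / (u + v)) \<le> cmod (h u) * cmod (h v) * (1 / (2 * \<delta>))"
    using norm_inverse_add_le[OF assms] by (intro mult_left_mono) auto
  then show ?thesis by (simp add: M_def norm_mult norm_divide mult_ac)
qed

lemma summable_mulM: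
  assumes "u \<in> A" "\<And>v. v \<in> A \<Longrightarrow> cmod (F v) \<le> K"
  shows "(\<lambda>v. M u v * F v) summable_on A"
proof (rule summable_on_norm_bound)
  show "(\<lambda>v. 1 / (2 * \<delta>) * cmod (h u) * K * cmod (h v)) summable_on A"
    by (intro summable_on_cmult_right summable_h)
  fix v assume v: "v \<in> A"
  have "cmod (M u v) * cmod (F v) \<le> (1 / (2 * \<delta>) * cmod (h u) * cmod (h v)) * K"
    using norm_M_le[OF assms(1) v] assms(2)[OF v] \<delta> by (intro mult_mono) auto
  then show "norm (M u v * F v) \<le> 1 / (2 * \<delta>) * cmod (h u) * K * cmod (h v)"
    by (simp add: norm_mult mult_ac)
qed

lemma mulM_lincomb:
  assumes "u \<in> A" "\<And>v. v \<in> A \<Longrightarrow> cmod (F v) \<le> K" "\<And>v. v \<in> A \<Longrightarrow> cmod (G v) \<le> L"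
  shows "mulM (\<lambda>v. a * F v + b * G v) u = a * mulM F u + b * mulM G u"
proof -
  have "mulM (\<lambda>v. a * F v + b * G v) u = infsum (\<lambda>v. a * (M u v * F v) + b * (M u v * G v)) A"
    by (simp add: mulM_def algebra_simps)
  also have "\<dots> = infsum (\<lambda>v. a * (M u v * F v)) A + infsum (\<lambda>v. b * (M u v * G v)) A"
    using summable_mulM[OF assms(1,2)] summable_mulM[OF assms(1,3)]
    by (intro infsum_add summable_on_cmult_right) auto
  finally show ?thesis by (simp add: mulM_def infsum_cmult_right')
qed

lemma mulM_solution_unique:
  assumes \<sigma>: "\<sigma> = 1 \<or> \<sigma> = - 1" and D: "tau \<sigma> (\<lambda>_. 1) \<noteq> 0"
    and K: "\<And>u. u \<in> A \<Longrightarrow> cmod (f u) \<le> K"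
    and eq: "\<And>u. u \<in> A \<Longrightarrow> f u + \<sigma> * mulM f u = 0"
    and w: "w \<in> A"
  shows "f w = 0"
  by (rule kernel_solution_unique[OF \<sigma> D h_sq summable_h K _ w]) (use eq in \<open>auto simp: mulM_def M_def\<close>)

lemma mulM_wave:
  assumes "cmod \<sigma> \<le> 1" "u \<in> A"
  shows "h u * wave \<sigma> (\<lambda>_. 1) u + \<sigma> * mulM (\<lambda>v. h v * wave \<sigma> (\<lambda>_. 1) v) u = h u * tau \<sigma> (\<lambda>_. 1)"
proof -
  have "mulM (\<lambda>v. h v * wave \<sigma> (\<lambda>_. 1) v) u = infsum (\<lambda>w. h u * (g w * wave \<sigma> (\<lambda>_. 1) w / (u + w))) A"
    unfolding mulM_def by (rule infsum_cong) (simp add: M_def h_sq[symmetric])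
  also have "\<dots> = h u * infsum (\<lambda>w. g w * wave \<sigma> (\<lambda>_. 1) w / (u + w)) A"
    by (rule infsum_cmult_right')
  finally show ?thesis
    unfolding wave_one_equation[OF assms, symmetric] by (simp add: algebra_simps)
qed

text \<open>The inverses of I - M and I + M applied to h, as \<open>mulM_ap_am\<close>
  confirms.\<close>

definition ap :: "complex \<Rightarrow> complex" where "ap u = h u * Tp u / d 0"
definition am :: "complex \<Rightarrow> complex" where "am u = h u * Tm u / e 0"

lemma norm_ap_am_le:
  obtains K where "\<And>u. u \<in> A \<Longrightarrow> cmod (ap u) \<le> K * cmod (h u)" "\<And>u. u \<in> A \<Longrightarrow> cmod (am u) \<le> K * cmod (h u)"
proof -
  obtain K1 where K1: "0 \<le> K1" "\<And>u. u \<in> A \<Longrightarrow> cmod (Tp u) \<le> K1"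
    using norm_wave_le[of "- 1" "\<lambda>_. 1" 1 0] by auto
  obtain K2 where K2: "0 \<le> K2" "\<And>u. u \<in> A \<Longrightarrow> cmod (Tm u) \<le> K2"
    using norm_wave_le[of "1" "\<lambda>_. 1" 1 0] by auto
  let ?K = "max (K1 / cmod (d 0)) (K2 / cmod (e 0))"
  show thesis
  proof (rule that[of ?K])
    fix u assume u: "u \<in> A"
    have "cmod (Tp u) / cmod (d 0) \<le> K1 / cmod (d 0)" using K1 u by (intro divide_right_mono) auto
    then have "cmod (Tp u) / cmod (d 0) * cmod (h u) \<le> ?K * cmod (h u)" by (intro mult_right_mono) auto
    then show "cmod (ap u) \<le> ?K * cmod (h u)" by (simp add: ap_def norm_mult norm_divide mult_ac)
    have "cmod (Tm u) / cmod (e 0) \<le> K2 / cmod (e 0)" using K2 u by (intro divide_right_mono) auto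
    then have "cmod (Tm u) / cmod (e 0) * cmod (h u) \<le> ?K * cmod (h u)" by (intro mult_right_mono) auto
    then show "cmod (am u) \<le> ?K * cmod (h u)" by (simp add: am_def norm_mult norm_divide mult_ac)
  qed
qed

lemma h_bounded: obtains K where "\<And>u. u \<in> A \<Longrightarrow> cmod (h u) \<le> K"
proof
  show "cmod (h u) \<le> infsum (\<lambda>u. cmod (h u)) A" if "u \<in> A" for u
    using finite_sum_le_infsum[OF summable_h, of "{u}"] that by simp
qed

lemma ap_am_bounded:
  obtains K where "\<And>u. u \<in> A \<Longrightarrow> cmod (ap u) \<le> K" "\<And>u. u \<in> A \<Longrightarrow> cmod (am u) \<le> K"
proof -
  obtain K where K: "\<And>u. u \<in> A \<Longrightarrow> cmod (ap u) \<le> K * cmod (h u)" "\<And>u. u \<in> A \<Longrightarrow> cmod (am u) \<le> K * cmod (h u)"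
    by (rule norm_ap_am_le) (rule that)
  obtain L where L: "\<And>u. u \<in> A \<Longrightarrow> cmod (h u) \<le> L" by (rule h_bounded) (rule that)
  show thesis
  proof (rule that[of "\<bar>K\<bar> * L"])
    fix u assume u: "u \<in> A"
    have "K * cmod (h u) \<le> \<bar>K\<bar> * L" using L[OF u] by (intro mult_mono) auto
    then show "cmod (ap u) \<le> \<bar>K\<bar> * L" "cmod (am u) \<le> \<bar>K\<bar> * L" using K[OF u] by linarith+
  qed
qed

lemma mulM_ap_am:
  assumes "d 0 \<noteq> 0" "e 0 \<noteq> 0" "u \<in> A"
  shows "mulM ap u = ap u - h u" "mulM am u = h u - am u"
proof -
  have p: "mulM ap u = 1 / d 0 * mulM (\<lambda>v. h v * Tp v) u" "mulM am u = 1 / e 0 * mulM (\<lambda>v. h v * Tm v) u"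
    unfolding mulM_def infsum_cmult_right'[symmetric] by (simp_all add: ap_def am_def)
  have "mulM (\<lambda>v. h v * Tp v) u = h u * Tp u - h u * d 0"
    using mulM_wave[of "- 1", OF _ assms(3)] by (simp add: algebra_simps)
  then show "mulM ap u = ap u - h u" unfolding p using assms by (simp add: ap_def field_simps)
  have "mulM (\<lambda>v. h v * Tm v) u = h u * e 0 - h u * Tm u"
    using mulM_wave[of 1, OF _ assms(3)] by (simp add: algebra_simps)
  then show "mulM am u = h u - am u" unfolding p using assms by (simp add: am_def field_simps)
qed

section \<open>The block antidiagonal operator on A and -A\<close>

context
  fixes H :: "complex \<Rightarrow> complex \<Rightarrow> complex"
  assumes H: "\<And>u v. u \<in> A \<Longrightarrow> v \<in> A \<Longrightarrow>
    H u v = 0 \<and> H (- u) (- v) = 0 \<and> H u (- v) = - M u v \<and> H (- u) v = - M u v"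
begin

abbreviation "AA \<equiv> A \<union> uminus ` A"

lemma uminus_notin: "u \<in> A \<Longrightarrow> - u \<notin> A"
  using Re_pos[of u] Re_pos[of "- u"] by auto

text \<open>The diagonal blocks vanish, so the operator swaps the two halves while applying
  -M.\<close>

lemma kernel_op_H:
  assumes "u \<in> A"
  shows "kernel_op AA H F u = - mulM (\<lambda>v. F (- v)) u" "kernel_op AA H F (- u) = - mulM F u"
proof -
  have H1: "H u v = 0" "H (- u) (- v) = 0" "H u (- v) = - M u v" "H (- u) v = - M u v" if "v \<in> A" for v
    using H[OF assms that] by blast+
  have "kernel_op AA H F u = infsum (\<lambda>v. H u v * F v) (uminus ` A)"
    unfolding kernel_op_def
  proof (rule infsum_cong_neutral)
    fix v assume "v \<in> AA - uminus ` A"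
    then have "v \<in> A" by blast
    then show "H u v * F v = 0" using H1(1)[of v] by simp
  qed auto
  also have "\<dots> = infsum (\<lambda>v. H u (- v) * F (- v)) A"
    by (subst infsum_reindex) (auto simp: o_def)
  also have "\<dots> = - mulM (\<lambda>v. F (- v)) u"
    unfolding mulM_def infsum_uminus[symmetric] by (rule infsum_cong) (simp only: H1 mult_minus_left)
  finally show "kernel_op AA H F u = - mulM (\<lambda>v. F (- v)) u" .
  have "kernel_op AA H F (- u) = infsum (\<lambda>v. H (- u) v * F v) A"
    unfolding kernel_op_def
  proof (rule infsum_cong_neutral)
    fix v assume "v \<in> AA - A"
    then obtain w where w: "w \<in> A" "v = - w" by auto
    show "H (- u) v * F v = 0" unfolding w(2) H1(2)[OF w(1)] by simp
  qed auto
  also have "\<dots> = - mulM F u"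
    unfolding mulM_def infsum_uminus[symmetric] by (rule infsum_cong) (simp only: H1 mult_minus_left)
  finally show "kernel_op AA H F (- u) = - mulM F u" .
qed

text \<open>For uniqueness, let E be the difference of two solutions. The combinations E(u) + c
  E(-u) with c = 1 and c = -1 decouple the block system into homogeneous equations for I + c M,
  which have only the zero solution because the tau values do not vanish.\<close>

lemma inv_one_minus_block:
  assumes D: "d 0 \<noteq> 0" "e 0 \<noteq> 0" and F: "F \<in> ell2 AA"
    and eq: "\<And>u. u \<in> A \<Longrightarrow> F u + mulM (\<lambda>v. F (- v)) u = f u" "\<And>u. u \<in> A \<Longrightarrow> F (- u) + mulM F u = f (- u)"
  shows "inv_one_minus AA H f = F"
  unfolding inv_one_minus_def
proof (rule the_equality)
  show "F \<in> ell2 AA \<and> (\<forall>u\<in>AA. F u - kernel_op AA H F u = f u)"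
  proof (intro conjI ballI F)
    fix u assume "u \<in> AA"
    then consider "u \<in> A" | v where "v \<in> A" "u = - v" by blast
    then show "F u - kernel_op AA H F u = f u"
    proof cases
      case 1
      show ?thesis unfolding kernel_op_H(1)[OF 1] using eq(1)[OF 1] by simp
    next
      case 2
      show ?thesis unfolding 2(2) kernel_op_H(2)[OF 2(1)] using eq(2)[OF 2(1)] by simp
    qed
  qed
  fix G assume G: "G \<in> ell2 AA \<and> (\<forall>u\<in>AA. G u - kernel_op AA H G u = f u)"
  have eqG: "G u + mulM (\<lambda>v. G (- v)) u = f u" "G (- u) + mulM G u = f (- u)" if "u \<in> A" for u
  proof -
    have "u \<in> AA" "- u \<in> AA" using that by auto
    then have "G u - kernel_op AA H G u = f u" "G (- u) - kernel_op AA H G (- u) = f (- u)"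
      using G by blast+
    then show "G u + mulM (\<lambda>v. G (- v)) u = f u" "G (- u) + mulM G u = f (- u)"
      unfolding kernel_op_H[OF that] by simp_all
  qed
  obtain K where K: "\<And>u. u \<in> AA \<Longrightarrow> cmod (F u) \<le> K" by (rule ell2_bounded[OF F]) (rule that)
  obtain L where L: "\<And>u. u \<in> AA \<Longrightarrow> cmod (G u) \<le> L" by (rule ell2_bounded[OF conjunct1[OF G]]) (rule that)
  define E where "E u = 1 * G u + (- 1) * F u" for u
  have EK: "cmod (E u) \<le> K + L" if "u \<in> AA" for u
    using K[OF that] L[OF that] norm_triangle_ineq4[of "G u" "F u"] by (simp add: E_def)
  have E: "E u + mulM (\<lambda>v. E (- v)) u = 0" "E (- u) + mulM E u = 0" if "u \<in> A" for u
  proof -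
    have 1: "mulM (\<lambda>v. E (- v)) u = 1 * mulM (\<lambda>v. G (- v)) u + (- 1) * mulM (\<lambda>v. F (- v)) u"
      unfolding E_def by (rule mulM_lincomb[OF that, of _ L _ K]) (rule K L, blast)+
    have 2: "mulM E u = 1 * mulM G u + (- 1) * mulM F u"
      unfolding E_def by (rule mulM_lincomb[OF that, of _ L _ K]) (rule K L, blast)+
    show "E u + mulM (\<lambda>v. E (- v)) u = 0" "E (- u) + mulM E u = 0"
      unfolding 1 2 using eq[OF that] eqG[OF that] by (simp_all add: E_def algebra_simps)
  qed
  have z: "1 * E u + c * E (- u) = 0" if c: "c = 1 \<or> c = - 1" and u: "u \<in> A" for c u
  proof (rule mulM_solution_unique[OF c, where f = "\<lambda>u. 1 * E u + c * E (- u)" and w = u])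
    show "tau c (\<lambda>_. 1) \<noteq> 0" using D c by auto
    show "cmod (1 * E u + c * E (- u)) \<le> (K + L) + (K + L)" if "u \<in> A" for u
    proof (rule norm_triangle_mono)
      show "cmod (1 * E u) \<le> K + L" using EK[of u] that by simp
      have "cmod c = 1" using c by auto
      moreover have "cmod (E (- u)) \<le> K + L" using that by (intro EK) blast
      ultimately show "cmod (c * E (- u)) \<le> K + L" by (simp add: norm_mult)
    qed
    show "1 * E u + c * E (- u) + c * mulM (\<lambda>v. 1 * E v + c * E (- v)) u = 0" if u: "u \<in> A" for u
    proof -
      have "mulM (\<lambda>v. 1 * E v + c * E (- v)) u = 1 * mulM E u + c * mulM (\<lambda>v. E (- v)) u"
        by (rule mulM_lincomb[OF u, of _ "K + L" _ "K + L"]) (rule EK, blast)+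
      moreover have "mulM (\<lambda>v. E (- v)) u = - E u" "mulM E u = - E (- u)"
        using E[OF u] by (simp_all add: eq_neg_iff_add_eq_0 add.commute)
      moreover have "c * c = 1" using c by auto
      ultimately show ?thesis by (simp add: right_diff_distrib mult.assoc[symmetric])
    qed
  qed (rule u)
  have zero: "E u = 0 \<and> E (- u) = 0" if "u \<in> A" for u
  proof -
    have "E u + E (- u) = 0" "E u - E (- u) = 0"
      using z[of 1 u] z[of "- 1" u] that by simp_all
    then show ?thesis by simp
  qed
  show "G = F"
  proof
    fix u
    show "G u = F u"
    proof (cases "u \<in> AA")
      case True
      then have "E u = 0" using zero by (metis UnE imageE)
      then show ?thesis by (simp add: E_def)
    next
      case False
      then show ?thesis using F G by (simp add: ell2_def)
    qed
  qed
qed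

text \<open>On A this is (I - M^2)^(-1) h and on -A it is -M (I - M^2)^(-1) h, written through the
  inverses of I - M and I + M: the solution for the right-hand side h on A and 0 on -A.
  \<open>F2\<close> is its mirror image.\<close>

definition F1 :: "complex \<Rightarrow> complex" where
  "F1 u = (if u \<in> A then (ap u + am u) / 2 else if - u \<in> A then (am (- u) - ap (- u)) / 2 else 0)"

definition F2 :: "complex \<Rightarrow> complex" where
  "F2 u = (if u \<in> A then (am u - ap u) / 2 else if - u \<in> A then (ap (- u) + am (- u)) / 2 else 0)"

lemma F1_F2_ell2: "F1 \<in> ell2 AA" "F2 \<in> ell2 AA"
proof -
  obtain K where K: "\<And>u. u \<in> A \<Longrightarrow> cmod (ap u) \<le> K * cmod (h u)" "\<And>u. u \<in> A \<Longrightarrow> cmod (am u) \<le> K * cmod (h u)"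
    by (rule norm_ap_am_le) (rule that)
  have b: "cmod ((ap u + am u) / 2) \<le> K * cmod (h u)" "cmod ((am u - ap u) / 2) \<le> K * cmod (h u)" if "u \<in> A" for u
    using K[OF that] norm_triangle_ineq[of "ap u" "am u"] norm_triangle_ineq4[of "am u" "ap u"]
    by (simp_all add: norm_divide)
  have hh: "(\<lambda>u. K\<^sup>2 * (cmod (g u) * exp (\<epsilon> * wt u))) summable_on A"
    by (intro summable_on_cmult_right summable_g)
  have sq: "(\<lambda>u. (cmod (f u))\<^sup>2) summable_on A" if f: "\<And>u. u \<in> A \<Longrightarrow> cmod (f u) \<le> K * cmod (h u)" for f
  proof (rule summable_on_comparison_test[OF hh])
    fix u assume u: "u \<in> A"
    have "(cmod (f u))\<^sup>2 \<le> (K * cmod (h u))\<^sup>2" using f[OF u] by (intro power_mono) auto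
    also have "\<dots> = K\<^sup>2 * cmod (g u)"
      using h_sq[OF u] by (simp add: power_mult_distrib power2_eq_square norm_mult[symmetric])
    also have "\<dots> \<le> K\<^sup>2 * (cmod (g u) * exp (\<epsilon> * wt u))"
      using \<epsilon> by (intro mult_left_mono) (auto simp: mult_le_cancel_left1)
    finally show "(cmod (f u))\<^sup>2 \<le> K\<^sup>2 * (cmod (g u) * exp (\<epsilon> * wt u))" .
  qed simp
  have un: "(\<lambda>u. (cmod (f u))\<^sup>2) summable_on AA"
    if "\<And>u. u \<in> A \<Longrightarrow> cmod (f u) \<le> K * cmod (h u)" "\<And>u. u \<in> A \<Longrightarrow> cmod (f (- u)) \<le> K * cmod (h u)" for f
  proof (rule summable_on_union)
    show "(\<lambda>u. (cmod (f u))\<^sup>2) summable_on A" by (rule sq) (rule that(1))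
    have "inj_on uminus A" by simp
    then show "(\<lambda>u. (cmod (f u))\<^sup>2) summable_on uminus ` A"
      using sq[of "\<lambda>u. f (- u)"] that(2) by (simp add: summable_on_reindex o_def)
  qed
  have v: "F1 u = 0" "F2 u = 0" if "u \<notin> AA" for u
  proof -
    have "u \<notin> A" "- u \<notin> A" using that by (auto simp: image_iff)
    then show "F1 u = 0" "F2 u = 0" by (simp_all add: F1_def F2_def)
  qed
  show "F1 \<in> ell2 AA" "F2 \<in> ell2 AA"
  proof -
    have "(\<lambda>u. (cmod (F1 u))\<^sup>2) summable_on AA"
    proof (rule un)
      fix u assume u: "u \<in> A"
      show "cmod (F1 u) \<le> K * cmod (h u)" using b(1)[OF u] u by (simp add: F1_def)
      show "cmod (F1 (- u)) \<le> K * cmod (h u)" using b(2)[OF u] u by (simp add: F1_def uminus_notin)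
    qed
    then show "F1 \<in> ell2 AA" using v(1) by (simp add: ell2_def)
    have "(\<lambda>u. (cmod (F2 u))\<^sup>2) summable_on AA"
    proof (rule un)
      fix u assume u: "u \<in> A"
      show "cmod (F2 u) \<le> K * cmod (h u)" using b(2)[OF u] u by (simp add: F2_def)
      show "cmod (F2 (- u)) \<le> K * cmod (h u)" using b(1)[OF u] u by (simp add: F2_def uminus_notin)
    qed
    then show "F2 \<in> ell2 AA" using v(2) by (simp add: ell2_def)
  qed
qed

lemma inv_one_minus_F1_F2:
  assumes D: "d 0 \<noteq> 0" "e 0 \<noteq> 0"
  shows "(\<And>u. u \<in> A \<Longrightarrow> f u = h u \<and> f (- u) = 0) \<Longrightarrow> inv_one_minus AA H f = F1"
    and "(\<And>u. u \<in> A \<Longrightarrow> f u = 0 \<and> f (- u) = h u) \<Longrightarrow> inv_one_minus AA H f = F2"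
proof -
  obtain K where K: "\<And>u. u \<in> A \<Longrightarrow> cmod (ap u) \<le> K" "\<And>u. u \<in> A \<Longrightarrow> cmod (am u) \<le> K"
    by (rule ap_am_bounded) (rule that)
  have m: "mulM (\<lambda>v. a * ap v + b * am v) u = a * (ap u - h u) + b * (h u - am u)" if "u \<in> A" for a b u
    using mulM_lincomb[OF that, of ap K am K] K mulM_ap_am[OF D that] by simp
  have cong: "mulM F u = mulM G u" if "\<And>v. v \<in> A \<Longrightarrow> F v = G v" for F G u
    unfolding mulM_def using that by (intro infsum_cong) auto
  have s: "mulM (\<lambda>v. F1 (- v)) u = 1 / 2 * (h u - am u) - 1 / 2 * (ap u - h u)" (is ?A)
    "mulM F1 u = 1 / 2 * (ap u - h u) + 1 / 2 * (h u - am u)" (is ?B)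
    "mulM (\<lambda>v. F2 (- v)) u = 1 / 2 * (ap u - h u) + 1 / 2 * (h u - am u)" (is ?C)
    "mulM F2 u = 1 / 2 * (h u - am u) - 1 / 2 * (ap u - h u)" (is ?D) if "u \<in> A" for u
  proof -
    have "mulM (\<lambda>v. F1 (- v)) u = mulM (\<lambda>v. (- 1 / 2) * ap v + 1 / 2 * am v) u"
      by (rule cong) (simp add: F1_def uminus_notin diff_divide_distrib)
    then show ?A using m[OF that, of "- 1 / 2" "1 / 2"] by simp
    have "mulM F1 u = mulM (\<lambda>v. 1 / 2 * ap v + 1 / 2 * am v) u"
      by (rule cong) (simp add: F1_def add_divide_distrib)
    then show ?B using m[OF that, of "1 / 2" "1 / 2"] by simp
    have "mulM (\<lambda>v. F2 (- v)) u = mulM (\<lambda>v. 1 / 2 * ap v + 1 / 2 * am v) u"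
      by (rule cong) (simp add: F2_def uminus_notin add_divide_distrib)
    then show ?C using m[OF that, of "1 / 2" "1 / 2"] by simp
    have "mulM F2 u = mulM (\<lambda>v. (- 1 / 2) * ap v + 1 / 2 * am v) u"
      by (rule cong) (simp add: F2_def diff_divide_distrib)
    then show ?D using m[OF that, of "- 1 / 2" "1 / 2"] by simp
  qed
  show "inv_one_minus AA H f = F1" if f: "\<And>u. u \<in> A \<Longrightarrow> f u = h u \<and> f (- u) = 0"
  proof (rule inv_one_minus_block[OF D F1_F2_ell2(1)])
    fix u assume u: "u \<in> A"
    show "F1 u + mulM (\<lambda>v. F1 (- v)) u = f u" "F1 (- u) + mulM F1 u = f (- u)"
      unfolding s[OF u] using f[OF u] u by (simp_all add: F1_def uminus_notin field_simps)
  qed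
  show "inv_one_minus AA H f = F2" if f: "\<And>u. u \<in> A \<Longrightarrow> f u = 0 \<and> f (- u) = h u"
  proof (rule inv_one_minus_block[OF D F1_F2_ell2(2)])
    fix u assume u: "u \<in> A"
    show "F2 u + mulM (\<lambda>v. F2 (- v)) u = f u" "F2 (- u) + mulM F2 u = f (- u)"
      unfolding s[OF u] using f[OF u] u by (simp_all add: F2_def uminus_notin field_simps)
  qed
qed

lemma summable_sdet_H: "(\<lambda>J. sdet J H) summable_on Fpow AA"
proof (rule summable_on_sdet)
  let ?b = "\<lambda>u. cmod (if u \<in> A then h u else h (- u))"
  show "?b summable_on AA"
  proof (rule summable_on_union)
    show "?b summable_on A" using summable_h by (simp cong: summable_on_cong)
    have "(\<lambda>u. ?b (- u)) summable_on A" using summable_h uminus_notin by (simp cong: summable_on_cong)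
    moreover have "inj_on uminus A" by simp
    ultimately show "?b summable_on uminus ` A" by (simp only: summable_on_reindex o_def)
  qed
  show "0 \<le> 1 / (2 * \<delta>)" using \<delta> by simp
  show "cmod (H u v) \<le> 1 / (2 * \<delta>) * ?b u * ?b v" if u: "u \<in> AA" and v: "v \<in> AA" for u v
  proof -
    obtain u' where u': "u' \<in> A" "u = u' \<or> u = - u'" using u by blast
    obtain v' where v': "v' \<in> A" "v = v' \<or> v = - v'" using v by blast
    note uv = u'(1) v'(1) u'(2) v'(2)
    have b: "?b u = cmod (h u')" "?b v = cmod (h v')"
      using uv uminus_notin[OF uv(1)] uminus_notin[OF uv(2)] by auto
    have "H u v = 0 \<or> H u v = - M u' v'"
      using H[OF uv(1,2)] uv(3,4) by (elim disjE) simp_all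
    then have "cmod (H u v) \<le> cmod (M u' v')" by auto
    then show ?thesis unfolding b using norm_M_le[OF uv(1,2)] by linarith
  qed
qed simp

lemma fredholm_det_H: "fredholm_det AA H = d 0 * e 0"
proof -
  have k: "(\<lambda>J. \<kappa> \<sigma> J * 1) summable_on Fpow A" if "cmod \<sigma> \<le> 1" for \<sigma>
    by (rule summable_tau[OF that, of _ 1 0]) auto
  have sM: "(\<lambda>J. sdet J M) summable_on Fpow A"
    using k[of 1] sdet_M by (simp add: kappa_def cong: summable_on_cong)
  have "fredholm_det AA H = infsum (\<lambda>J. (-1) ^ card J * sdet J M) (Fpow A) * infsum (\<lambda>J. sdet J M) (Fpow A)"
    by (rule fredholm_det_block_antidiagonal[OF Re_pos H sM summable_sdet_H])
  also have "infsum (\<lambda>J. (-1) ^ card J * sdet J M) (Fpow A) = d 0"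
    unfolding tau_fun_def kappa_def by (rule infsum_cong) (simp add: sdet_M)
  also have "infsum (\<lambda>J. sdet J M) (Fpow A) = e 0"
    unfolding tau_fun_def kappa_def by (rule infsum_cong) (simp add: sdet_M)
  finally show ?thesis .
qed

end

lemma sum_h_ap_am:
  "infsum (\<lambda>u. h u * ap u) A = - 2 * (d 1 / d 0)" "infsum (\<lambda>u. h u * am u) A = 2 * (e 1 / e 0)"
  "(\<lambda>u. h u * ap u) summable_on A" "(\<lambda>u. h u * am u) summable_on A"
proof -
  have "infsum (\<lambda>u. h u * ap u) A = infsum (\<lambda>u. g u * Tp u * (1 / d 0)) A"
    by (rule infsum_cong) (simp add: ap_def h_sq[symmetric])
  then show "infsum (\<lambda>u. h u * ap u) A = - 2 * (d 1 / d 0)"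
    unfolding infsum_cmult_left' sum_wave by simp
  have "infsum (\<lambda>u. h u * am u) A = infsum (\<lambda>u. g u * Tm u * (1 / e 0)) A"
    by (rule infsum_cong) (simp add: am_def h_sq[symmetric])
  then show "infsum (\<lambda>u. h u * am u) A = 2 * (e 1 / e 0)"
    unfolding infsum_cmult_left' sum_wave by simp
  obtain K where K: "\<And>u. u \<in> A \<Longrightarrow> cmod (ap u) \<le> K" "\<And>u. u \<in> A \<Longrightarrow> cmod (am u) \<le> K"
    by (rule ap_am_bounded) (rule that)
  have "(\<lambda>u. K * cmod (h u)) summable_on A" by (intro summable_on_cmult_right summable_h)
  note sK = this
  have nb: "norm (h u * ap u) \<le> K * cmod (h u)" "norm (h u * am u) \<le> K * cmod (h u)" if "u \<in> A" for u
    using mult_right_mono[OF K(1)[OF that], of "cmod (h u)"] mult_right_mono[OF K(2)[OF that], of "cmod (h u)"]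
    by (simp_all add: norm_mult mult.commute)
  show "(\<lambda>u. h u * ap u) summable_on A" by (rule summable_on_norm_bound[OF sK nb(1)])
  show "(\<lambda>u. h u * am u) summable_on A" by (rule summable_on_norm_bound[OF sK nb(2)])
qed

end

subsection \<open>The periodic TASEP kernels\<close>

text \<open>exp(-V(u) - Q(-u)) / u, the square of the nonzero entry of \<open>f_vec\<close> at u in
  \<open>S_plus z\<close>, written so that x and \<tau> enter through one separate
  exponential.\<close>

definition tasep_g :: "real \<Rightarrow> real \<Rightarrow> complex \<Rightarrow> complex" where
  "tasep_g \<tau> x u = exp (- Q_fun (- u)) / u * exp (of_real (\<tau> / 3) * u ^ 3 - of_real x * u)"

definition tasep_h :: "real \<Rightarrow> real \<Rightarrow> complex \<Rightarrow> complex" where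
  "tasep_h \<tau> x u = exp (- (1 / 2) * V_fun \<tau> x u - (1 / 2) * Q_fun (- u)) / csqrt u"

lemma tasep_h_sq: "tasep_h \<tau> x u * tasep_h \<tau> x u = tasep_g \<tau> x u"
proof -
  let ?E = "- (1 / 2) * V_fun \<tau> x u - (1 / 2) * Q_fun (- u)"
  have "?E + ?E = - Q_fun (- u) + (of_real (\<tau> / 3) * u ^ 3 - of_real x * u)"
    by (simp add: V_fun_def algebra_simps)
  then have "exp ?E * exp ?E = exp (- Q_fun (- u)) * exp (of_real (\<tau> / 3) * u ^ 3 - of_real x * u)"
    by (simp only: exp_add[symmetric])
  moreover have "csqrt u * csqrt u = u" by (simp add: power2_eq_square[symmetric])
  ultimately show ?thesis unfolding tasep_h_def tasep_g_def times_divide_times_eq by simp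
qed

lemma tasep_g_shift_x:
  "tasep_g \<tau> (x + t) u = tasep_g \<tau> x u * exp (of_real (t * - 1) * u ^ 1)"
proof -
  have "of_real (\<tau> / 3) * u ^ 3 - of_real (x + t) * u =
      (of_real (\<tau> / 3) * u ^ 3 - of_real x * u) + of_real (t * - 1) * u ^ 1"
    by (simp add: algebra_simps)
  then show ?thesis unfolding tasep_g_def by (simp only: exp_add mult.assoc)
qed

lemma tasep_g_shift_\<tau>:
  "tasep_g (\<tau> + t) x u = tasep_g \<tau> x u * exp (of_real (t * (1 / 3)) * u ^ 3)"
proof -
  have "of_real ((\<tau> + t) / 3) * u ^ 3 - of_real x * u =
      (of_real (\<tau> / 3) * u ^ 3 - of_real x * u) + of_real (t * (1 / 3)) * u ^ 3"
    by (simp add: algebra_simps add_divide_distrib)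
  then show ?thesis unfolding tasep_g_def by (simp only: exp_add mult.assoc)
qed

text \<open>\<open>Q_fun\<close> is bounded on the set and |u| >= sqrt \<rho>, so the size is
  governed by Re(u^3) and Re u alone.\<close>

lemma norm_tasep_g_le:
  fixes z :: complex
  defines "\<rho> \<equiv> - 2 * ln (cmod z)"
  assumes z: "0 < cmod z" "cmod z < 1"
  obtains K where "0 \<le> K" "\<And>u. u \<in> S_plus z \<Longrightarrow>
    cmod (tasep_g \<tau> x u) \<le> K * exp (- (2 * \<tau> / 3) * Re u ^ 3 + (\<tau> * \<rho> - x) * Re u)"
proof -
  have \<rho>: "0 < \<rho>" using \<rho>_pos[OF z] by (simp add: \<rho>_def)
  define C where "C = sqrt (2 / pi) * (exp (1 / 2) / (1 - cmod z))"
  show thesis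
  proof (rule that[of "exp C / sqrt \<rho>"])
    show "0 \<le> exp C / sqrt \<rho>" using \<rho> by simp
    fix u assume u: "u \<in> S_plus z"
    note re = S_plus_Re_Im[OF z u, folded \<rho>_def]
    have "- u \<in> S_minus z" using u by (simp add: S_minus_iff)
    then have Q: "cmod (Q_fun (- u)) \<le> C" unfolding C_def by (rule norm_Q_fun_le[OF z(2)])
    have "Re (- Q_fun (- u)) \<le> cmod (- Q_fun (- u))" by (rule complex_Re_le_cmod)
    then have "exp (Re (- Q_fun (- u))) \<le> exp C" using Q by simp
    moreover have "sqrt \<rho> \<le> cmod u" using re(4) complex_Re_le_cmod[of u] by linarith
    ultimately have Qu: "exp (Re (- Q_fun (- u))) / cmod u \<le> exp C / sqrt \<rho>"
      using \<rho> by (intro frac_le) auto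
    have E: "Re (of_real (\<tau> / 3) * u ^ 3 - of_real x * u) = - (2 * \<tau> / 3) * Re u ^ 3 + (\<tau> * \<rho> - x) * Re u"
    proof -
      have "Re (of_real (\<tau> / 3) * u ^ 3 - of_real x * u) = \<tau> / 3 * Re (u ^ 3) - x * Re u"
        by (simp only: minus_complex.sel times_complex.sel Re_complex_of_real Im_complex_of_real
          mult_zero_left diff_zero)
      then show ?thesis unfolding re(3) by (simp add: field_simps)
    qed
    show "cmod (tasep_g \<tau> x u) \<le> exp C / sqrt \<rho> * exp (- (2 * \<tau> / 3) * Re u ^ 3 + (\<tau> * \<rho> - x) * Re u)"
      unfolding tasep_g_def norm_mult norm_divide norm_exp_eq_Re E by (rule mult_right_mono[OF Qu]) simp
  qed
qed

text \<open>\<delta> = sqrt \<rho> is the vertex of the hyperbola. The margin \<epsilon> = \<tau>/24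
  fits \<open>wt u\<close> <= 2 a + 8 a^3 with a = Re u: it costs \<tau>/3 of the cubic rate 2
  \<tau>/3 and leaves \<tau>/3.\<close>

lemma tau_root_data_tasep:
  assumes z: "0 < cmod z" "cmod z < 1" and \<tau>: "0 < \<tau>"
  shows "tau_root_data (S_plus z) (tasep_g \<tau> x) (sqrt (- 2 * ln (cmod z))) (\<tau> / 24) (tasep_h \<tau> x)"
proof
  define \<rho> where "\<rho> = - 2 * ln (cmod z)"
  note re = S_plus_Re_Im[OF z, folded \<rho>_def]
  obtain K where K: "0 \<le> K" "\<And>u. u \<in> S_plus z \<Longrightarrow>
      cmod (tasep_g \<tau> x u) \<le> K * exp (- (2 * \<tau> / 3) * Re u ^ 3 + (\<tau> * \<rho> - x) * Re u)"
    by (rule norm_tasep_g_le[OF z, of \<tau> x]) (rule that[unfolded \<rho>_def])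
  show "0 < sqrt (- 2 * ln (cmod z))" using \<rho>_pos[OF z] by simp
  show "sqrt (- 2 * ln (cmod z)) \<le> Re u" if "u \<in> S_plus z" for u
    using S_plus_Re_Im(4)[OF z that] .
  show "cmod (u - v) \<le> cmod (u + v)" if "u \<in> S_plus z" "v \<in> S_plus z" for u v
    using S_plus_sector[OF z that] .
  show "0 < \<tau> / 24" using \<tau> by simp
  show "(\<lambda>u. cmod (tasep_g \<tau> x u) * exp (\<tau> / 24 * wt u)) summable_on S_plus z"
  proof (rule summable_on_norm_bound)
    have "0 < \<tau> / 3" using \<tau> by simp
    then show "(\<lambda>u. K * exp (- (\<tau> / 3) * Re u ^ 3 + (\<tau> * \<rho> - x + \<tau> / 12) * Re u)) summable_on S_plus z"
      by (intro summable_on_cmult_right summable_exp_cubic[OF z])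
    fix u assume u: "u \<in> S_plus z"
    have "\<tau> / 24 * wt u \<le> \<tau> / 24 * (2 * Re u + 8 * Re u ^ 3)"
      using wt_le[OF z u] \<tau> by (intro mult_left_mono) auto
    also have "\<tau> / 24 * (2 * Re u + 8 * Re u ^ 3) = \<tau> / 12 * Re u + \<tau> / 3 * Re u ^ 3"
      by (simp add: field_simps)
    finally have "exp (\<tau> / 24 * wt u) \<le> exp (\<tau> / 12 * Re u + \<tau> / 3 * Re u ^ 3)"
      by (simp only: exp_le_cancel_iff)
    then have "cmod (tasep_g \<tau> x u) * exp (\<tau> / 24 * wt u) \<le>
        (K * exp (- (2 * \<tau> / 3) * Re u ^ 3 + (\<tau> * \<rho> - x) * Re u)) * exp (\<tau> / 12 * Re u + \<tau> / 3 * Re u ^ 3)"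
      by (rule mult_mono[OF K(2)[OF u]]) (simp_all add: K(1))
    moreover have "- (2 * \<tau> / 3) * Re u ^ 3 + (\<tau> * \<rho> - x) * Re u + (\<tau> / 12 * Re u + \<tau> / 3 * Re u ^ 3) =
        - (\<tau> / 3) * Re u ^ 3 + (\<tau> * \<rho> - x + \<tau> / 12) * Re u"
      by (simp add: field_simps)
    then have "(K * exp (- (2 * \<tau> / 3) * Re u ^ 3 + (\<tau> * \<rho> - x) * Re u)) * exp (\<tau> / 12 * Re u + \<tau> / 3 * Re u ^ 3) =
        K * exp (- (\<tau> / 3) * Re u ^ 3 + (\<tau> * \<rho> - x + \<tau> / 12) * Re u)"
      unfolding mult.assoc mult_exp_exp by (simp only:)
    ultimately show "norm (cmod (tasep_g \<tau> x u) * exp (\<tau> / 24 * wt u)) \<le>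
        K * exp (- (\<tau> / 3) * Re u ^ 3 + (\<tau> * \<rho> - x + \<tau> / 12) * Re u)"
      by (simp only: real_norm_def abs_mult abs_exp_cancel abs_norm_cancel)
  qed
  show "tasep_h \<tau> x u * tasep_h \<tau> x u = tasep_g \<tau> x u" for u by (rule tasep_h_sq)
  show "tasep_h \<tau> x u \<noteq> 0" if "u \<in> S_plus z" for u
  proof -
    have "u \<noteq> 0" using that by (auto simp: S_plus_iff)
    then show ?thesis by (simp add: tasep_h_def)
  qed
  show "(\<lambda>u. cmod (tasep_h \<tau> x u)) summable_on S_plus z"
  proof (rule summable_on_norm_bound)
    have "0 < \<tau> / 3" using \<tau> by simp
    then show "(\<lambda>u. sqrt K * exp (- (\<tau> / 3) * Re u ^ 3 + (\<tau> * \<rho> - x) / 2 * Re u)) summable_on S_plus z"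
      by (intro summable_on_cmult_right summable_exp_cubic[OF z])
    fix u assume u: "u \<in> S_plus z"
    let ?e = "- (\<tau> / 3) * Re u ^ 3 + (\<tau> * \<rho> - x) / 2 * Re u"
    have "(cmod (tasep_h \<tau> x u))\<^sup>2 = cmod (tasep_g \<tau> x u)"
      unfolding power2_eq_square norm_mult[symmetric] tasep_h_sq ..
    also have "\<dots> \<le> K * exp (- (2 * \<tau> / 3) * Re u ^ 3 + (\<tau> * \<rho> - x) * Re u)" by (rule K(2)[OF u])
    also have "- (2 * \<tau> / 3) * Re u ^ 3 + (\<tau> * \<rho> - x) * Re u = 2 * ?e" by (simp add: field_simps)
    also have "K * exp (2 * ?e) = (sqrt K * exp ?e)\<^sup>2"
      unfolding exp_double power_mult_distrib real_sqrt_pow2[OF K(1)] ..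
    finally have "cmod (tasep_h \<tau> x u) \<le> sqrt K * exp ?e"
      by (rule power2_le_imp_le) (simp add: K(1))
    then show "norm (cmod (tasep_h \<tau> x u)) \<le> sqrt K * exp ?e" by (simp only: real_norm_def abs_norm_cancel)
  qed
qed

text \<open>After the reflection u -> -u, conjugation by exp(Psi)/u puts both exponentials on the
  column variable. Halving x and \<tau> makes the square exp(2 Psi) carry exactly the exponent of
  \<open>tasep_g\<close>.\<close>

lemma fredholm_det_K_flat:
  assumes z: "0 < cmod z" "cmod z < 1" and \<tau>: "0 < \<tau>"
  shows "fredholm_det (S_minus z) (K_flat (x / 2) (\<tau> / 2)) = tau_fun (S_plus z) (tasep_g \<tau> x) (- 1) (\<lambda>_. 1)"
proof -
  interpret tau_root_data "S_plus z" "tasep_g \<tau> x" "sqrt (- 2 * ln (cmod z))" "\<tau> / 24" "tasep_h \<tau> x"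
    by (rule tau_root_data_tasep[OF z \<tau>])
  let ?K = "K_flat (x / 2) (\<tau> / 2)"
  let ?\<Psi> = "\<lambda>u. Psi (- u) (x / 2) (\<tau> / 2)"
  have E: "exp (?\<Psi> u + ?\<Psi> u) = exp (- Q_fun (- u)) * exp (of_real (\<tau> / 3) * u ^ 3 - of_real x * u)" for u
  proof -
    have "?\<Psi> u + ?\<Psi> u = - Q_fun (- u) + (of_real (\<tau> / 3) * u ^ 3 - of_real x * u)"
      by (simp add: Psi_def algebra_simps)
    then show ?thesis by (simp only: exp_add)
  qed
  have det: "sdet (uminus ` J) ?K = sdet J (\<lambda>u v. tasep_g \<tau> x v / (u + v))" if J: "J \<in> Fpow (S_plus z)" for J
  proof -
    have fin: "finite J" "J \<subseteq> S_plus z" using J by (auto simp: Fpow_def)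
    have nz: "u \<noteq> 0" if "u \<in> J" for u using fin(2) that by (auto simp: S_plus_iff)
    have "sdet (uminus ` J) ?K = sdet J (\<lambda>u v. ?K (- u) (- v))"
      by (rule sdet_reindex) (use fin in \<open>auto simp: bij_betw_def\<close>)
    also have "\<dots> = sdet J (\<lambda>u v. (exp (?\<Psi> u) / u) * (tasep_g \<tau> x v / (u + v)) / (exp (?\<Psi> v) / v))"
    proof (rule sdet_cong)
      fix u v assume uv: "u \<in> J" "v \<in> J"
      have s: "u + v \<noteq> 0" using uv fin(2) by (intro add_nonzero) auto
      have k: "?K (- u) (- v) = exp (?\<Psi> u) * exp (?\<Psi> v) / (u * (u + v))"
      proof -
        have "- u * (- u + - v) = u * (u + v)" by (simp add: algebra_simps)
        then show ?thesis unfolding K_flat_def exp_add[symmetric] by (simp only:)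
      qed
      have g: "tasep_g \<tau> x v = exp (?\<Psi> v) * exp (?\<Psi> v) / v"
        unfolding tasep_g_def exp_add[symmetric] E by (simp add: exp_add[symmetric])
      show "?K (- u) (- v) = (exp (?\<Psi> u) / u) * (tasep_g \<tau> x v / (u + v)) / (exp (?\<Psi> v) / v)"
        unfolding k g using nz[OF uv(1)] nz[OF uv(2)] s by simp
    qed
    also have "\<dots> = sdet J (\<lambda>u v. tasep_g \<tau> x v / (u + v))"
      by (rule sdet_conjugate) (use fin nz in auto)
    finally show ?thesis .
  qed
  have inj: "inj_on (image uminus) (Fpow (S_plus z))"
    by (rule inj_on_image_Fpow) simp
  have im: "Fpow (S_minus z) = image uminus ` Fpow (S_plus z)"
    unfolding S_minus_eq
  proof (intro equalityI subsetI)
    fix J assume "J \<in> Fpow (uminus ` S_plus z)"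
    then have "uminus ` J \<in> Fpow (S_plus z)" "J = uminus ` uminus ` J"
      by (auto simp: Fpow_def image_image)
    then show "J \<in> image uminus ` Fpow (S_plus z)" by (rule rev_image_eqI)
  qed (auto simp: Fpow_def)
  have k: "(\<lambda>J. \<kappa> \<sigma> J * 1) summable_on Fpow (S_plus z)" if "cmod \<sigma> \<le> 1" for \<sigma>
    by (rule summable_tau[OF that, of _ 1 0]) auto
  have "(\<lambda>J. sdet (uminus ` J) ?K) summable_on Fpow (S_plus z)"
    using k[of 1] det by (simp add: kappa_def cong: summable_on_cong)
  then have s: "(\<lambda>J. sdet J ?K) summable_on Fpow (S_minus z)"
    unfolding im by (simp only: summable_on_reindex[OF inj] o_def)
  have "fredholm_det (S_minus z) ?K = infsum (\<lambda>J. (-1) ^ card J * sdet J ?K) (Fpow (S_minus z))"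
    by (rule fredholm_det_eq_infsum[OF s])
  also have "\<dots> = infsum (\<lambda>J. (-1) ^ card (uminus ` J) * sdet (uminus ` J) ?K) (Fpow (S_plus z))"
    unfolding im by (simp only: infsum_reindex[OF inj] o_def)
  also have "\<dots> = d 0"
    unfolding tau_fun_def kappa_def
  proof (rule infsum_cong)
    fix J assume J: "J \<in> Fpow (S_plus z)"
    have "card (uminus ` J) = card J" by (rule card_image) simp
    then show "(- 1) ^ card (uminus ` J) * sdet (uminus ` J) ?K =
        (- 1) ^ card J * sdet J (\<lambda>u v. tasep_g \<tau> x v / (u + v)) * psum 1 J ^ 0"
      using det[OF J] by simp
  qed
  finally show ?thesis by simp
qed

lemma f_vec_g_vec:
  assumes "u \<in> S_plus z"
  shows "f_vec z \<tau> x u = vector [tasep_h \<tau> x u, 0]" "f_vec z \<tau> x (- u) = vector [0, tasep_h \<tau> x u]"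
    "g_vec z \<tau> x u = vector [0, tasep_h \<tau> x u]" "g_vec z \<tau> x (- u) = vector [- tasep_h \<tau> x u, 0]"
proof -
  have n: "- u \<notin> S_plus z" using assms by (simp add: S_plus_iff)
  have "V_fun \<tau> x (- u) = - V_fun \<tau> x u" by (simp add: V_fun_def)
  then have V: "1 / 2 * V_fun \<tau> x (- u) = - (1 / 2) * V_fun \<tau> x u" by simp
  show "f_vec z \<tau> x u = vector [tasep_h \<tau> x u, 0]" "f_vec z \<tau> x (- u) = vector [0, tasep_h \<tau> x u]"
    "g_vec z \<tau> x u = vector [0, tasep_h \<tau> x u]" "g_vec z \<tau> x (- u) = vector [- tasep_h \<tau> x u, 0]"
    using assms n unfolding f_vec_def g_vec_def tasep_h_def V by simp_all
qed

text \<open>Only \<open>S_minus z\<close> contributes to the first column, since the first component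
  of \<open>g_vec\<close> vanishes on \<open>S_plus z\<close>; its value -h there gives the overall
  sign. The rest are the pairings of h with \<open>ap\<close> and \<open>am\<close> from
  \<open>sum_h_ap_am\<close>.\<close>

lemma X1_entries:
  fixes x \<tau> :: real
  assumes z: "0 < cmod z" "cmod z < 1" and \<tau>: "0 < \<tau>"
  defines "D \<equiv> \<lambda>\<sigma> k. tau_fun (S_plus z) (tasep_g \<tau> x) \<sigma> (\<lambda>J. psum 1 J ^ k)"
  shows "X1_defined z \<tau> x \<longleftrightarrow> D (- 1) 0 \<noteq> 0 \<and> D 1 0 \<noteq> 0"
    and "D (- 1) 0 \<noteq> 0 \<Longrightarrow> D 1 0 \<noteq> 0 \<Longrightarrow> R_fun z \<tau> x = D (- 1) 1 / D (- 1) 0 - D 1 1 / D 1 0"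
    and "D (- 1) 0 \<noteq> 0 \<Longrightarrow> D 1 0 \<noteq> 0 \<Longrightarrow> Q_entry z \<tau> x = - (D (- 1) 1 / D (- 1) 0) - D 1 1 / D 1 0"
proof -
  interpret tau_root_data "S_plus z" "tasep_g \<tau> x" "sqrt (- 2 * ln (cmod z))" "\<tau> / 24" "tasep_h \<tau> x"
    by (rule tau_root_data_tasep[OF z \<tau>])
  let ?H = "H_ker z \<tau> x" and ?h = "tasep_h \<tau> x"
  have H: "?H u v = 0 \<and> ?H (- u) (- v) = 0 \<and> ?H u (- v) = - M u v \<and> ?H (- u) v = - M u v"
    if uv: "u \<in> S_plus z" "v \<in> S_plus z" for u v
  proof -
    have s: "u + v \<noteq> 0" by (rule add_nonzero[OF uv])
    then have ne: "u \<noteq> - v" "- u \<noteq> v" by (auto simp: add_eq_0_iff2)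
    have "?H u v = 0" "?H (- u) (- v) = 0"
      by (simp_all add: H_ker_def sum_2 f_vec_g_vec[OF uv(1)] f_vec_g_vec[OF uv(2)])
    moreover have "?H u (- v) = - M u v"
      using ne by (simp add: H_ker_def sum_2 f_vec_g_vec[OF uv(1)] f_vec_g_vec[OF uv(2)] M_def)
    moreover have "?H (- u) v = - M u v"
    proof -
      have "?H (- u) v = (?h u * ?h v) / (- u - v)"
        using ne by (simp add: H_ker_def sum_2 f_vec_g_vec[OF uv(1)] f_vec_g_vec[OF uv(2)])
      also have "- u - v = - (u + v)" by simp
      also have "(?h u * ?h v) / - (u + v) = - M u v"
        unfolding M_def by (rule minus_divide_right[symmetric])
      finally show ?thesis .
    qed
    ultimately show ?thesis by blast
  qed
  show "X1_defined z \<tau> x \<longleftrightarrow> D (- 1) 0 \<noteq> 0 \<and> D 1 0 \<noteq> 0"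
  proof -
    have "fredholm_det (S_all z) ?H = d 0 * e 0"
      unfolding S_all_eq by (rule fredholm_det_H[OF H])
    then show ?thesis unfolding X1_defined_def D_def by simp
  qed
  assume D: "D (- 1) 0 \<noteq> 0" "D 1 0 \<noteq> 0"
  have F: "F_vec z \<tau> x u = vector [F1 u, F2 u]" for u
  proof -
    have 1: "inv_one_minus (S_all z) ?H (\<lambda>v. f_vec z \<tau> x v $ 1) = F1"
      unfolding S_all_eq
      by (rule inv_one_minus_F1_F2(1)[OF H]) (use D in \<open>simp_all add: D_def f_vec_g_vec\<close>)
    have 2: "inv_one_minus (S_all z) ?H (\<lambda>v. f_vec z \<tau> x v $ 2) = F2"
      unfolding S_all_eq
      by (rule inv_one_minus_F1_F2(2)[OF H]) (use D in \<open>simp_all add: D_def f_vec_g_vec\<close>)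
    show ?thesis
      by (simp add: F_vec_def Finite_Cartesian_Product.vec_eq_iff forall_2 1 2)
  qed
  have sum: "X1 z \<tau> x $ i $ 1 = - infsum (\<lambda>u. F_vec z \<tau> x (- u) $ i * ?h u) (S_plus z)" for i
  proof -
    have "X1 z \<tau> x $ i $ 1 = infsum (\<lambda>s. F_vec z \<tau> x s $ i * g_vec z \<tau> x s $ 1) (uminus ` S_plus z)"
      unfolding X1_def S_all_eq vec_lambda_beta
    proof (rule infsum_cong_neutral)
      fix s assume "s \<in> S_plus z \<union> uminus ` S_plus z - uminus ` S_plus z"
      then have "s \<in> S_plus z" by blast
      then show "F_vec z \<tau> x s $ i * g_vec z \<tau> x s $ 1 = 0" by (simp add: f_vec_g_vec)
    qed auto
    also have "\<dots> = infsum (\<lambda>u. F_vec z \<tau> x (- u) $ i * g_vec z \<tau> x (- u) $ 1) (S_plus z)"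
      by (subst infsum_reindex) (auto simp: o_def)
    also have "\<dots> = - infsum (\<lambda>u. F_vec z \<tau> x (- u) $ i * ?h u) (S_plus z)"
      unfolding infsum_uminus[symmetric] by (rule infsum_cong) (simp add: f_vec_g_vec)
    finally show ?thesis .
  qed
  have lin: "infsum (\<lambda>u. a * (?h u * ap u) + b * (?h u * am u)) (S_plus z) =
      a * (- 2 * (d 1 / d 0)) + b * (2 * (e 1 / e 0))" for a b
  proof -
    have "infsum (\<lambda>u. a * (?h u * ap u) + b * (?h u * am u)) (S_plus z) =
        infsum (\<lambda>u. a * (?h u * ap u)) (S_plus z) + infsum (\<lambda>u. b * (?h u * am u)) (S_plus z)"
      by (rule infsum_add) (intro summable_on_cmult_right sum_h_ap_am(3,4))+
    then show ?thesis unfolding infsum_cmult_right' sum_h_ap_am(1,2) .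
  qed
  have "R_fun z \<tau> x = - infsum (\<lambda>u. 1 / 2 * (?h u * ap u) + 1 / 2 * (?h u * am u)) (S_plus z)"
    unfolding R_fun_def sum F
    by (rule arg_cong[where f = uminus], rule infsum_cong)
      (simp add: F2_def[OF H] uminus_notin[OF H] field_simps)
  then show "R_fun z \<tau> x = D (- 1) 1 / D (- 1) 0 - D 1 1 / D 1 0"
    unfolding lin D_def by simp
  have "Q_entry z \<tau> x = - infsum (\<lambda>u. - (1 / 2) * (?h u * ap u) + 1 / 2 * (?h u * am u)) (S_plus z)"
    unfolding Q_entry_def sum F
    by (rule arg_cong[where f = uminus], rule infsum_cong)
      (simp add: F1_def[OF H] uminus_notin[OF H] field_simps)
  then show "Q_entry z \<tau> x = - (D (- 1) 1 / D (- 1) 0) - D 1 1 / D 1 0"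
    unfolding lin D_def by simp
qed

subsection \<open>The mKdV equation\<close>

text \<open>This form of the quotient rule expresses derivatives of normalised tau functions again
  by normalised tau functions.\<close>

lemma has_vector_derivative_quotient:
  fixes f g :: "real \<Rightarrow> complex"
  assumes "(f has_vector_derivative f') (at x)" "(g has_vector_derivative g') (at x)" "g x \<noteq> 0"
  shows "((\<lambda>y. f y / g y) has_vector_derivative f' / g x - f x / g x * (g' / g x)) (at x)"
proof -
  have "((\<lambda>y. f y / g y) has_derivative
      (\<lambda>h. - f x * (inverse (g x) * (h *\<^sub>R g') * inverse (g x)) + (h *\<^sub>R f') / g x)) (at x)"
    using assms unfolding has_vector_derivative_def by (intro has_derivative_divide)
  moreover have "(\<lambda>h. - f x * (inverse (g x) * (h *\<^sub>R g') * inverse (g x)) + (h *\<^sub>R f') / g x) =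
      (\<lambda>h. h *\<^sub>R (f' / g x - f x / g x * (g' / g x)))"
    by (simp add: fun_eq_iff scaleR_conv_of_real divide_inverse algebra_simps)
  ultimately show ?thesis unfolding has_vector_derivative_def by simp
qed

lemma has_vector_derivative_shift:
  assumes "((\<lambda>t. f (x + t)) has_vector_derivative f') (at (0::real))"
  shows "(f has_vector_derivative f') (at x)"
proof -
  have "((\<lambda>y. y - x) has_vector_derivative 1) (at x)"
    by (auto intro!: derivative_eq_intros)
  moreover have "((\<lambda>t. f (x + t)) has_vector_derivative f') (at (x - x))" using assms by simp
  ultimately have "((\<lambda>t. f (x + t)) \<circ> (\<lambda>y. y - x) has_vector_derivative 1 *\<^sub>R f') (at x)"
    by (rule vector_diff_chain_at)
  then show ?thesis by (simp add: o_def)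
qed

text \<open>Dividing by D x places the values near 1, where the principal logarithm is continuous
  and differentiable; the constant \<open>Ln (D x)\<close> restores the value.\<close>

lemma has_log_derivativeI:
  assumes D: "(D has_vector_derivative D') (at x)" and cont: "continuous_on UNIV D" and nz: "D x \<noteq> 0"
  shows "has_log_derivative D (D' / D x) x"
proof -
  define G where "G y = D y / D x" for y
  have contG: "continuous_on UNIV G"
    unfolding G_def using cont nz by (intro continuous_intros) auto
  have "isCont G x" using contG by (simp add: continuous_on_eq_continuous_at)
  then have "\<exists>e>0. \<forall>y. dist y x < e \<longrightarrow> dist (G y) (G x) < 1"
    unfolding continuous_at_eps_delta by (elim allE[of _ 1] impE) simp_all
  then obtain e where e: "0 < e" "\<And>y. dist y x < e \<Longrightarrow> dist (G y) (G x) < 1" by blast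
  have Gx: "G x = 1" using nz by (simp add: G_def)
  have pos: "0 < Re (G y)" if "y \<in> ball x e" for y
  proof -
    have "cmod (G y - 1) < 1" using e(2)[of y] that by (simp add: Gx dist_norm norm_minus_commute)
    moreover have "\<bar>Re (G y - 1)\<bar> \<le> cmod (G y - 1)" by (rule abs_Re_le_cmod)
    ultimately show ?thesis by simp
  qed
  define L where "L y = Ln (G y) + Ln (D x)" for y
  have "continuous_on (ball x e) L"
    unfolding L_def
  proof (intro continuous_intros)
    show "continuous_on (ball x e) G" using contG by (rule continuous_on_subset) simp
    show "G y \<notin> \<real>\<^sub>\<le>\<^sub>0" if "y \<in> ball x e" for y
      using pos[OF that] by (auto simp: complex_nonpos_Reals_iff)
  qed
  moreover have "exp (L y) = D y" if "y \<in> ball x e" for y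
  proof -
    have "G y \<noteq> 0" using pos[OF that] by auto
    then have "exp (L y) = G y * D x" using nz by (simp add: L_def exp_add)
    then show ?thesis using nz by (simp add: G_def)
  qed
  moreover have "(L has_vector_derivative D' / D x) (at x)"
  proof -
    have "(G has_vector_derivative D' / D x) (at x)"
      using has_vector_derivative_quotient[OF D has_vector_derivative_const nz] by (simp add: G_def[abs_def])
    moreover have "(Ln has_field_derivative inverse (G x)) (at (G x))"
      using Gx by (intro has_field_derivative_Ln) (simp add: complex_nonpos_Reals_iff)
    ultimately have "((Ln \<circ> G) has_vector_derivative (D' / D x) * inverse (G x)) (at x)"
      by (rule field_vector_diff_chain_at)
    then have "((\<lambda>y. Ln (G y) + Ln (D x)) has_vector_derivative (D' / D x) * inverse (G x) + 0) (at x)"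
      unfolding o_def by (rule has_vector_derivative_add[OF _ has_vector_derivative_const])
    then show ?thesis by (simp add: L_def[abs_def] Gx)
  qed
  ultimately show ?thesis unfolding has_log_derivative_def using e(1) by blast
qed

text \<open>The hypothesis is the product-rule derivative of d2 e0 + d0 e2 - 2 d1 e1, in which each
  index rises by one with a minus sign.\<close>

lemma bilinear_derivative:
  fixes d0 d1 d2 d3 e0 e1 e2 e3 :: complex
  assumes "((d2 * - e1 + - d3 * e0) + (d0 * - e3 + - d1 * e2) - 2 * (d1 * - e2 + - d2 * e1)) = 0"
  shows "d3 * e0 + d0 * e3 = d2 * e1 + d1 * e2"
proof -
  have "(d2 * e1 + d1 * e2) - (d3 * e0 + d0 * e3) =
      ((d2 * - e1 + - d3 * e0) + (d0 * - e3 + - d1 * e2) - 2 * (d1 * - e2 + - d2 * e1))"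
    by (simp add: algebra_simps)
  also note assms
  finally show ?thesis by (metis eq_iff_diff_eq_0)
qed

text \<open>Here a_k and b_k stand for the k-th tau coefficients divided by the zeroth, for \<sigma>
  = -1 and \<sigma> = 1. The left side of the first claim is R_xx for R = a1 - b1; its right side is
  the expression of the second Hirota equation plus 2 R^3. The second claim is Q_x = -R^2.\<close>

lemma mkdv_elimination:
  fixes a1 a2 a3 b1 b2 b3 :: complex
  assumes 1: "a2 + b2 = 2 * a1 * b1" and 2: "a3 + b3 = a2 * b1 + a1 * b2"
  shows "((a1 * (a1 * a1 - a2) + (a1 * a1 - a2) * a1) - (a2 * a1 - a3))
        - ((b1 * (b1 * b1 - b2) + (b1 * b1 - b2) * b1) - (b2 * b1 - b3)) =
      (4 * a3 - 6 * a2 * b1 + 2 * b3) + 2 * ((a1 - b1) * ((a1 - b1) * (a1 - b1)))"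
    and "- (a1 * a1 - a2) - (b1 * b1 - b2) = - (a1 - b1)\<^sup>2"
proof -
  have a3: "a3 = a2 * b1 + a1 * b2 - b3" and a2: "a2 = 2 * a1 * b1 - b2"
    using 1 2 by (simp_all add: eq_diff_eq)
  show "((a1 * (a1 * a1 - a2) + (a1 * a1 - a2) * a1) - (a2 * a1 - a3))
        - ((b1 * (b1 * b1 - b2) + (b1 * b1 - b2) * b1) - (b2 * b1 - b3)) =
      (4 * a3 - 6 * a2 * b1 + 2 * b3) + 2 * ((a1 - b1) * ((a1 - b1) * (a1 - b1)))"
    unfolding a3 a2 by (simp add: algebra_simps)
  show "- (a1 * a1 - a2) - (b1 * b1 - b2) = - (a1 - b1)\<^sup>2"
    unfolding a2 by (simp add: power2_eq_square algebra_simps)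
qed

section \<open>Derivatives of the tau functions and of their logarithms in x and \<tau>\<close>

definition tasep_tau ::
  "complex \<Rightarrow> (complex set \<Rightarrow> complex) \<Rightarrow> complex \<Rightarrow> real \<Rightarrow> real \<Rightarrow> complex" where
  "tasep_tau z \<phi> \<sigma> \<tau> x = tau_fun (S_plus z) (tasep_g \<tau> x) \<sigma> \<phi>"

abbreviation T :: "complex \<Rightarrow> nat \<Rightarrow> complex \<Rightarrow> real \<Rightarrow> real \<Rightarrow> complex" where
  "T z k \<equiv> tasep_tau z (\<lambda>J. psum 1 J ^ k)"
abbreviation T3 :: "complex \<Rightarrow> complex \<Rightarrow> real \<Rightarrow> real \<Rightarrow> complex" where
  "T3 z \<equiv> tasep_tau z (\<lambda>J. psum 3 J)"
abbreviation T13 :: "complex \<Rightarrow> complex \<Rightarrow> real \<Rightarrow> real \<Rightarrow> complex" where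
  "T13 z \<equiv> tasep_tau z (\<lambda>J. psum 1 J * psum 3 J)"

text \<open>Logarithmic derivatives: \<open>rt z 1\<close> is minus the x-derivative of log
  \<open>T z 0\<close>, and \<open>rt3 z\<close> is three times its \<tau>-derivative.\<close>

definition rt :: "complex \<Rightarrow> nat \<Rightarrow> complex \<Rightarrow> real \<Rightarrow> real \<Rightarrow> complex" where
  "rt z k \<sigma> \<tau> x = T z k \<sigma> \<tau> x / T z 0 \<sigma> \<tau> x"
definition rt3 :: "complex \<Rightarrow> complex \<Rightarrow> real \<Rightarrow> real \<Rightarrow> complex" where
  "rt3 z \<sigma> \<tau> x = T3 z \<sigma> \<tau> x / T z 0 \<sigma> \<tau> x"
definition rt13 :: "complex \<Rightarrow> complex \<Rightarrow> real \<Rightarrow> real \<Rightarrow> complex" where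
  "rt13 z \<sigma> \<tau> x = T13 z \<sigma> \<tau> x / T z 0 \<sigma> \<tau> x"

context
  fixes z :: complex
  assumes z: "0 < cmod z" "cmod z < 1"
begin

text \<open>The base point is absorbed in g: moving x or \<tau> by t multiplies g by exp(-t u) or
  exp(t u^3 / 3), so the derivative at t = 0 gives it everywhere. Here p_1 gets its sign and p_3 its
  factor 1/3.\<close>

lemma tasep_tau_derivs:
  assumes "0 < \<tau>" "cmod \<sigma> \<le> 1" "\<And>J. cmod (\<phi> J) \<le> (1 + sum wt J) ^ m"
  shows "((\<lambda>y. tasep_tau z \<phi> \<sigma> \<tau> y) has_vector_derivative - tasep_tau z (\<lambda>J. psum 1 J * \<phi> J) \<sigma> \<tau> x) (at x)"
    and "((\<lambda>t. tasep_tau z \<phi> \<sigma> t x) has_vector_derivative 1 / 3 * tasep_tau z (\<lambda>J. psum 3 J * \<phi> J) \<sigma> \<tau> x) (at \<tau>)"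
proof -
  interpret tau_root_data "S_plus z" "tasep_g \<tau> x" "sqrt (- 2 * ln (cmod z))" "\<tau> / 24" "tasep_h \<tau> x"
    by (rule tau_root_data_tasep[OF z assms(1)])
  have "((\<lambda>t. tau_fun (S_plus z) (\<lambda>u. tasep_g \<tau> x u * exp (of_real (t * - 1) * u ^ 1)) \<sigma> \<phi>) has_vector_derivative
      of_real (- 1) * tau \<sigma> (\<lambda>J. psum 1 J * \<phi> J)) (at 0)"
    using assms(3) by (intro tau_has_vector_derivative[OF _ assms(2), of _ _ _ m]) auto
  then have "((\<lambda>t. tasep_tau z \<phi> \<sigma> \<tau> (x + t)) has_vector_derivative of_real (- 1) * tau \<sigma> (\<lambda>J. psum 1 J * \<phi> J)) (at 0)"
    unfolding tasep_tau_def tasep_g_shift_x[abs_def] .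
  from has_vector_derivative_shift[OF this]
  show "((\<lambda>y. tasep_tau z \<phi> \<sigma> \<tau> y) has_vector_derivative - tasep_tau z (\<lambda>J. psum 1 J * \<phi> J) \<sigma> \<tau> x) (at x)"
    by (simp add: tasep_tau_def)
  have "((\<lambda>t. tau_fun (S_plus z) (\<lambda>u. tasep_g \<tau> x u * exp (of_real (t * (1 / 3)) * u ^ 3)) \<sigma> \<phi>) has_vector_derivative
      of_real (1 / 3) * tau \<sigma> (\<lambda>J. psum 3 J * \<phi> J)) (at 0)"
    using assms(3) by (intro tau_has_vector_derivative[OF _ assms(2), of _ _ _ m]) auto
  then have "((\<lambda>t. tasep_tau z \<phi> \<sigma> (\<tau> + t) x) has_vector_derivative of_real (1 / 3) * tau \<sigma> (\<lambda>J. psum 3 J * \<phi> J)) (at 0)"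
    unfolding tasep_tau_def tasep_g_shift_\<tau>[abs_def] .
  from has_vector_derivative_shift[OF this]
  show "((\<lambda>t. tasep_tau z \<phi> \<sigma> t x) has_vector_derivative 1 / 3 * tasep_tau z (\<lambda>J. psum 3 J * \<phi> J) \<sigma> \<tau> x) (at \<tau>)"
    by (simp add: tasep_tau_def)
qed

lemma T_derivs:
  assumes "0 < \<tau>" "cmod \<sigma> \<le> 1"
  shows "(T z k \<sigma> \<tau> has_vector_derivative - T z (Suc k) \<sigma> \<tau> x) (at x)"
    and "(T3 z \<sigma> \<tau> has_vector_derivative - T13 z \<sigma> \<tau> x) (at x)"
    and "((\<lambda>t. T z 0 \<sigma> t x) has_vector_derivative 1 / 3 * T3 z \<sigma> \<tau> x) (at \<tau>)"
    and "((\<lambda>t. T z 1 \<sigma> t x) has_vector_derivative 1 / 3 * T13 z \<sigma> \<tau> x) (at \<tau>)"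
proof -
  have b: "cmod (psum 1 J ^ k) \<le> (1 + sum wt J) ^ k" "cmod (psum 3 J) \<le> (1 + sum wt J) ^ 1" for J k
    using norm_psum_le_wt[of J] sum_nonneg[of J wt] by (auto simp: norm_power intro: power_mono)
  show "(T z k \<sigma> \<tau> has_vector_derivative - T z (Suc k) \<sigma> \<tau> x) (at x)"
    using tasep_tau_derivs(1)[OF assms b(1)] by simp
  show "(T3 z \<sigma> \<tau> has_vector_derivative - T13 z \<sigma> \<tau> x) (at x)"
    using tasep_tau_derivs(1)[OF assms b(2)] by simp
  show "((\<lambda>t. T z 0 \<sigma> t x) has_vector_derivative 1 / 3 * T3 z \<sigma> \<tau> x) (at \<tau>)"
    using tasep_tau_derivs(2)[OF assms b(1)[of _ 0]] by simp
  show "((\<lambda>t. T z 1 \<sigma> t x) has_vector_derivative 1 / 3 * T13 z \<sigma> \<tau> x) (at \<tau>)"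
    using tasep_tau_derivs(2)[OF assms b(1)[of _ 1]] by (simp add: mult.commute)
qed

lemma T_bilinear:
  assumes "0 < \<tau>"
  shows "T z 2 (- 1) \<tau> x * T z 0 1 \<tau> x + T z 0 (- 1) \<tau> x * T z 2 1 \<tau> x = 2 * T z 1 (- 1) \<tau> x * T z 1 1 \<tau> x"
    and "T3 z (- 1) \<tau> x * T z 0 1 \<tau> x - T z 0 (- 1) \<tau> x * T3 z 1 \<tau> x =
      4 * T z 3 (- 1) \<tau> x * T z 0 1 \<tau> x - 6 * T z 2 (- 1) \<tau> x * T z 1 1 \<tau> x + 2 * T z 0 (- 1) \<tau> x * T z 3 1 \<tau> x"
    and "T z 3 (- 1) \<tau> x * T z 0 1 \<tau> x + T z 0 (- 1) \<tau> x * T z 3 1 \<tau> x =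
      T z 2 (- 1) \<tau> x * T z 1 1 \<tau> x + T z 1 (- 1) \<tau> x * T z 2 1 \<tau> x"
proof -
  have 1: "T z 2 (- 1) \<tau> x * T z 0 1 \<tau> x + T z 0 (- 1) \<tau> x * T z 2 1 \<tau> x = 2 * T z 1 (- 1) \<tau> x * T z 1 1 \<tau> x \<and>
    T3 z (- 1) \<tau> x * T z 0 1 \<tau> x - T z 0 (- 1) \<tau> x * T3 z 1 \<tau> x =
      4 * T z 3 (- 1) \<tau> x * T z 0 1 \<tau> x - 6 * T z 2 (- 1) \<tau> x * T z 1 1 \<tau> x + 2 * T z 0 (- 1) \<tau> x * T z 3 1 \<tau> x" for x
  proof -
    interpret tau_root_data "S_plus z" "tasep_g \<tau> x" "sqrt (- 2 * ln (cmod z))" "\<tau> / 24" "tasep_h \<tau> x"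
      by (rule tau_root_data_tasep[OF z assms])
    show ?thesis unfolding tasep_tau_def using bilinear by blast
  qed
  show "T z 2 (- 1) \<tau> x * T z 0 1 \<tau> x + T z 0 (- 1) \<tau> x * T z 2 1 \<tau> x = 2 * T z 1 (- 1) \<tau> x * T z 1 1 \<tau> x"
    "T3 z (- 1) \<tau> x * T z 0 1 \<tau> x - T z 0 (- 1) \<tau> x * T3 z 1 \<tau> x =
      4 * T z 3 (- 1) \<tau> x * T z 0 1 \<tau> x - 6 * T z 2 (- 1) \<tau> x * T z 1 1 \<tau> x + 2 * T z 0 (- 1) \<tau> x * T z 3 1 \<tau> x"
    using 1 by blast+
  have Tx: "(T z k \<sigma> \<tau> has_vector_derivative - T z (Suc k) \<sigma> \<tau> x) (at x)" if "\<sigma> = 1 \<or> \<sigma> = - 1" for k \<sigma>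
    using that by (intro T_derivs(1)[OF assms]) auto
  \<comment> \<open>The first relation holds for every x, so the derivative of \<open>?F\<close> is
    that of the zero function; this is the third relation.\<close>
  let ?F = "\<lambda>x. T z 2 (- 1) \<tau> x * T z 0 1 \<tau> x + T z 0 (- 1) \<tau> x * T z 2 1 \<tau> x - 2 * (T z 1 (- 1) \<tau> x * T z 1 1 \<tau> x)"
  have "(?F has_vector_derivative
      ((T z 2 (- 1) \<tau> x * - T z (Suc 0) 1 \<tau> x + - T z (Suc 2) (- 1) \<tau> x * T z 0 1 \<tau> x)
      + (T z 0 (- 1) \<tau> x * - T z (Suc 2) 1 \<tau> x + - T z (Suc 0) (- 1) \<tau> x * T z 2 1 \<tau> x)
      - 2 * (T z 1 (- 1) \<tau> x * - T z (Suc 1) 1 \<tau> x + - T z (Suc 1) (- 1) \<tau> x * T z 1 1 \<tau> x))) (at x)"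
    by (intro has_vector_derivative_diff has_vector_derivative_add has_vector_derivative_mult
        has_vector_derivative_mult_right Tx) auto
  moreover have "?F = (\<lambda>x. 0)" using 1 by (auto simp: fun_eq_iff)
  ultimately have "((\<lambda>x. 0) has_vector_derivative
      ((T z 2 (- 1) \<tau> x * - T z (Suc 0) 1 \<tau> x + - T z (Suc 2) (- 1) \<tau> x * T z 0 1 \<tau> x)
      + (T z 0 (- 1) \<tau> x * - T z (Suc 2) 1 \<tau> x + - T z (Suc 0) (- 1) \<tau> x * T z 2 1 \<tau> x)
      - 2 * (T z 1 (- 1) \<tau> x * - T z (Suc 1) 1 \<tau> x + - T z (Suc 1) (- 1) \<tau> x * T z 1 1 \<tau> x))) (at x)"
    by simp
  from vector_derivative_unique_at[OF this has_vector_derivative_const]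
  have E: "((T z 2 (- 1) \<tau> x * - T z 1 1 \<tau> x + - T z 3 (- 1) \<tau> x * T z 0 1 \<tau> x)
      + (T z 0 (- 1) \<tau> x * - T z 3 1 \<tau> x + - T z 1 (- 1) \<tau> x * T z 2 1 \<tau> x)
      - 2 * (T z 1 (- 1) \<tau> x * - T z 2 1 \<tau> x + - T z 2 (- 1) \<tau> x * T z 1 1 \<tau> x)) = 0"
    by (simp only: eval_nat_numeral BitM.simps One_nat_def)
  show "T z 3 (- 1) \<tau> x * T z 0 1 \<tau> x + T z 0 (- 1) \<tau> x * T z 3 1 \<tau> x =
      T z 2 (- 1) \<tau> x * T z 1 1 \<tau> x + T z 1 (- 1) \<tau> x * T z 2 1 \<tau> x"
    by (rule bilinear_derivative[OF E])
qed

text \<open>The second and third derivatives differ by the factor -1/3, both being multiples of the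
  mixed derivative of log \<open>T z 0\<close> in x and \<tau>. This turns R_\<tau> into an
  x-derivative.\<close>

lemma rt_derivs:
  assumes "0 < \<tau>" "cmod \<sigma> \<le> 1" "T z 0 \<sigma> \<tau> x \<noteq> 0"
  shows "(rt z k \<sigma> \<tau> has_vector_derivative rt z k \<sigma> \<tau> x * rt z 1 \<sigma> \<tau> x - rt z (Suc k) \<sigma> \<tau> x) (at x)"
    and "(rt3 z \<sigma> \<tau> has_vector_derivative rt3 z \<sigma> \<tau> x * rt z 1 \<sigma> \<tau> x - rt13 z \<sigma> \<tau> x) (at x)"
    and "((\<lambda>t. rt z 1 \<sigma> t x) has_vector_derivative 1 / 3 * (rt13 z \<sigma> \<tau> x - rt z 1 \<sigma> \<tau> x * rt3 z \<sigma> \<tau> x)) (at \<tau>)"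
proof -
  note D = T_derivs[OF assms(1,2)]
  show "(rt z k \<sigma> \<tau> has_vector_derivative rt z k \<sigma> \<tau> x * rt z 1 \<sigma> \<tau> x - rt z (Suc k) \<sigma> \<tau> x) (at x)"
    using has_vector_derivative_quotient[OF D(1)[of k x] D(1)[of 0 x] assms(3)]
    by (simp add: rt_def[abs_def])
  show "(rt3 z \<sigma> \<tau> has_vector_derivative rt3 z \<sigma> \<tau> x * rt z 1 \<sigma> \<tau> x - rt13 z \<sigma> \<tau> x) (at x)"
    using has_vector_derivative_quotient[OF D(2)[of x] D(1)[of 0 x] assms(3)]
    by (simp add: rt_def rt3_def[abs_def] rt13_def)
  show "((\<lambda>t. rt z 1 \<sigma> t x) has_vector_derivative 1 / 3 * (rt13 z \<sigma> \<tau> x - rt z 1 \<sigma> \<tau> x * rt3 z \<sigma> \<tau> x)) (at \<tau>)"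
    using has_vector_derivative_quotient[OF D(4)[of x] D(3)[of x] assms(3)]
    by (simp add: rt_def rt3_def rt13_def right_diff_distrib mult.left_commute)
qed

text \<open>Higher derivatives of R need its formula on a neighbourhood of x; this supplies
  one.\<close>

lemma open_T_nonzero:
  assumes "0 < \<tau>"
  shows "open {y. T z 0 (- 1) \<tau> y \<noteq> 0 \<and> T z 0 1 \<tau> y \<noteq> 0}" "continuous_on UNIV (T z 0 (- 1) \<tau>)"
proof -
  have c: "continuous_on UNIV (T z 0 \<sigma> \<tau>)" if "cmod \<sigma> \<le> 1" for \<sigma>
    using has_vector_derivative_continuous[OF T_derivs(1)[OF assms that, of 0]]
    by (simp add: continuous_on_eq_continuous_at)
  show "open {y. T z 0 (- 1) \<tau> y \<noteq> 0 \<and> T z 0 1 \<tau> y \<noteq> 0}"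
    using c by (intro open_Collect_conj open_Collect_neq continuous_on_const) auto
  show "continuous_on UNIV (T z 0 (- 1) \<tau>)" using c by simp
qed

end

text \<open>The logarithmic derivative is minus \<open>rt z 1 (- 1)\<close>, which is (Q - R)/2 by
  \<open>X1_entries\<close>; hence the coefficient -1/2 of R. The second Hirota equation gives R_xx
  = W + 2 R^3, where W is the difference of the two \<open>rt3\<close>; because 3 R_\<tau> = -W_x,
  one more x-derivative is mKdV.\<close>

theorem theorem8p4:
  fixes z :: complex and \<tau> x :: real
  assumes "0 < cmod z" "cmod z < 1"
    and "\<tau> > 0"
    and "X1_defined z \<tau> x"
  shows "has_log_derivative (\<lambda>y. fredholm_det (S_minus z) (K_flat (y / 2) (\<tau> / 2)))
           (- (1 / 2) * R_fun z \<tau> x + (1 / 2) * Q_entry z \<tau> x) x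
    \<and> ((\<lambda>t. R_fun z t x) differentiable at \<tau>
      \<and> (\<lambda>y. R_fun z \<tau> y) differentiable at x
      \<and> (\<lambda>y. partial_x (R_fun z) \<tau> y) differentiable at x
      \<and> (\<lambda>y. partial_x (partial_x (R_fun z)) \<tau> y) differentiable at x
      \<and> 3 * partial_\<tau> (R_fun z) \<tau> x + partial_x (partial_x (partial_x (R_fun z))) \<tau> x
           - 6 * (R_fun z \<tau> x)\<^sup>2 * partial_x (R_fun z) \<tau> x = 0)
    \<and> ((\<lambda>y. Q_entry z \<tau> y) differentiable at x
      \<and> partial_x (Q_entry z) \<tau> x = - (R_fun z \<tau> x)\<^sup>2)"
proof -
  note z = assms(1,2) and \<tau> = assms(3) and def = assms(4)
  define S where "S = {y. T z 0 (- 1) \<tau> y \<noteq> 0 \<and> T z 0 1 \<tau> y \<noteq> 0}"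
  have S: "open S" unfolding S_def by (rule open_T_nonzero[OF z \<tau>])
  have nz: "T z 0 (- 1) \<tau> y \<noteq> 0" "T z 0 1 \<tau> y \<noteq> 0" if "y \<in> S" for y
    using that by (auto simp: S_def)
  have x: "x \<in> S"
    using def unfolding X1_entries(1)[OF z \<tau>] by (simp add: S_def tasep_tau_def)
  let ?a = "\<lambda>k. rt z k (- 1) \<tau>" and ?b = "\<lambda>k. rt z k 1 \<tau>"
  have R: "R_fun z t y = rt z 1 (- 1) t y - rt z 1 1 t y" if "0 < t" "T z 0 (- 1) t y \<noteq> 0" "T z 0 1 t y \<noteq> 0" for t y
    using X1_entries(2)[OF z that(1), of y, folded tasep_tau_def, OF that(2,3)] by (simp only: rt_def)
  have Q: "Q_entry z \<tau> y = - ?a 1 y - ?b 1 y" if "y \<in> S" for y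
    using X1_entries(3)[OF z \<tau>, of y, folded tasep_tau_def, OF nz[OF that]] by (simp only: rt_def)
  \<comment> \<open>\<open>partial_x\<close> is a pointwise derivative, so iterating it requires
    formulas valid on all of the open set \<open>S\<close>, not only at x.\<close>
  have trans: "(F has_vector_derivative G') (at y)"
    if "(G has_vector_derivative G') (at y)" "y \<in> S" "\<And>y. y \<in> S \<Longrightarrow> F y = G y" for F G :: "real \<Rightarrow> complex" and G' y
    by (rule has_vector_derivative_transform_within_open[OF that(1) S that(2)]) (simp add: that(3))
  have da: "(?a k has_vector_derivative ?a k y * ?a 1 y - ?a (Suc k) y) (at y)"
    and db: "(?b k has_vector_derivative ?b k y * ?b 1 y - ?b (Suc k) y) (at y)" if "y \<in> S" for k y
    by (rule rt_derivs(1)[OF z \<tau> _ nz(1)[OF that]] rt_derivs(1)[OF z \<tau> _ nz(2)[OF that]], simp)+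
  have da3: "(rt3 z (- 1) \<tau> has_vector_derivative rt3 z (- 1) \<tau> y * ?a 1 y - rt13 z (- 1) \<tau> y) (at y)"
    and db3: "(rt3 z 1 \<tau> has_vector_derivative rt3 z 1 \<tau> y * ?b 1 y - rt13 z 1 \<tau> y) (at y)" if "y \<in> S" for y
    by (rule rt_derivs(2)[OF z \<tau> _ nz(1)[OF that]] rt_derivs(2)[OF z \<tau> _ nz(2)[OF that]], simp)+
  have two: "Suc 1 = 2" "Suc 2 = 3" by simp_all
  have N: "?a 2 y + ?b 2 y = 2 * ?a 1 y * ?b 1 y"
    "?a 3 y + ?b 3 y = ?a 2 y * ?b 1 y + ?a 1 y * ?b 2 y"
    "rt3 z (- 1) \<tau> y - rt3 z 1 \<tau> y = 4 * ?a 3 y - 6 * ?a 2 y * ?b 1 y + 2 * ?b 3 y" if "y \<in> S" for y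
  proof -
    note n = nz[OF that]
    note B = T_bilinear[OF z \<tau>, of y]
    let ?d = "T z 0 (- 1) \<tau> y" and ?e = "T z 0 1 \<tau> y"
    have e: "p / ?d + q / ?e = (p * ?e + ?d * q) / (?d * ?e)" "p / ?d - q / ?e = (p * ?e - ?d * q) / (?d * ?e)"
      "(p / ?d) * (q / ?e) = p * q / (?d * ?e)" for p q
      using n by (simp_all add: field_simps)
    show "?a 2 y + ?b 2 y = 2 * ?a 1 y * ?b 1 y"
      unfolding rt_def e mult.assoc using B(1) by simp
    show "?a 3 y + ?b 3 y = ?a 2 y * ?b 1 y + ?a 1 y * ?b 2 y"
      unfolding rt_def e using B(3) by (simp add: add_divide_distrib[symmetric])
    have "4 * ?a 3 y - 6 * ?a 2 y * ?b 1 y + 2 * ?b 3 y =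
        (4 * T z 3 (- 1) \<tau> y * ?e - 6 * T z 2 (- 1) \<tau> y * T z 1 1 \<tau> y + 2 * ?d * T z 3 1 \<tau> y) / (?d * ?e)"
      using n by (simp add: rt_def field_simps)
    then show "rt3 z (- 1) \<tau> y - rt3 z 1 \<tau> y = 4 * ?a 3 y - 6 * ?a 2 y * ?b 1 y + 2 * ?b 3 y"
      unfolding rt3_def e B(2) by simp
  qed
  have RS: "R_fun z \<tau> y = ?a 1 y - ?b 1 y" if "y \<in> S" for y
    by (rule R[OF \<tau> nz[OF that]])
  define R1 where "R1 y = (?a 1 y * ?a 1 y - ?a 2 y) - (?b 1 y * ?b 1 y - ?b 2 y)" for y
  have dR: "(R_fun z \<tau> has_vector_derivative R1 y) (at y)" if "y \<in> S" for y
  proof (rule trans[OF _ that RS])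
    show "((\<lambda>y. ?a 1 y - ?b 1 y) has_vector_derivative R1 y) (at y)"
      unfolding R1_def using has_vector_derivative_diff[OF da[OF that, of 1] db[OF that, of 1]]
      by (simp only: two)
  qed
  have pR: "partial_x (R_fun z) \<tau> y = R1 y" if "y \<in> S" for y
    unfolding partial_x_def by (rule vector_derivative_at[OF dR[OF that]])
  \<comment> \<open>R_xx with the third-order ratios traded for \<open>rt3\<close> by the second
    Hirota equation, so that no fourth-order ratio appears in R_xxx.\<close>
  define R2 where "R2 y = (rt3 z (- 1) \<tau> y - rt3 z 1 \<tau> y) + 2 * ((?a 1 y - ?b 1 y) * ((?a 1 y - ?b 1 y) * (?a 1 y - ?b 1 y)))" for y
  have dR1: "(partial_x (R_fun z) \<tau> has_vector_derivative R2 y) (at y)" if "y \<in> S" for y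
  proof (rule trans[OF _ that pR])
    let ?D = "((?a 1 y * (?a 1 y * ?a 1 y - ?a 2 y) + (?a 1 y * ?a 1 y - ?a 2 y) * ?a 1 y)
          - (?a 2 y * ?a 1 y - ?a 3 y))
        - ((?b 1 y * (?b 1 y * ?b 1 y - ?b 2 y) + (?b 1 y * ?b 1 y - ?b 2 y) * ?b 1 y)
          - (?b 2 y * ?b 1 y - ?b 3 y))"
    have "(R1 has_vector_derivative ?D) (at y)"
      unfolding R1_def
      by (intro has_vector_derivative_diff has_vector_derivative_mult
          da[OF that, of 1, unfolded two] db[OF that, of 1, unfolded two]
          da[OF that, of 2, unfolded two] db[OF that, of 2, unfolded two])
    moreover have "?D = R2 y"
      unfolding R2_def N(3)[OF that] by (rule mkdv_elimination(1)[OF N(1,2)[OF that]])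
    ultimately show "(R1 has_vector_derivative R2 y) (at y)" by simp
  qed
  have pR1: "partial_x (partial_x (R_fun z)) \<tau> y = R2 y" if "y \<in> S" for y
    unfolding partial_x_def[of "partial_x (R_fun z)"] by (rule vector_derivative_at[OF dR1[OF that]])
  define r where "r = ?a 1 x - ?b 1 x"
  \<comment> \<open>The x-derivative of the difference of the two \<open>rt3\<close>; in
    \<open>dRt\<close> it reappears with the factor -1/3.\<close>
  define \<theta> where "\<theta> = (rt3 z (- 1) \<tau> x * ?a 1 x - rt13 z (- 1) \<tau> x) - (rt3 z 1 \<tau> x * ?b 1 x - rt13 z 1 \<tau> x)"
  have dr: "((\<lambda>y. ?a 1 y - ?b 1 y) has_vector_derivative R1 x) (at x)"
    unfolding R1_def using has_vector_derivative_diff[OF da[OF x, of 1] db[OF x, of 1]]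
    by (simp only: two)
  have dR2: "(partial_x (partial_x (R_fun z)) \<tau> has_vector_derivative \<theta> + 2 * (r * (r * R1 x + R1 x * r) + R1 x * (r * r))) (at x)"
  proof (rule trans[OF _ x pR1])
    show "(R2 has_vector_derivative \<theta> + 2 * (r * (r * R1 x + R1 x * r) + R1 x * (r * r))) (at x)"
      unfolding R2_def \<theta>_def r_def
      by (intro has_vector_derivative_add has_vector_derivative_diff has_vector_derivative_mult
          has_vector_derivative_mult_right da3[OF x] db3[OF x] dr)
  qed
  have pR2: "partial_x (partial_x (partial_x (R_fun z))) \<tau> x = \<theta> + 2 * (r * (r * R1 x + R1 x * r) + R1 x * (r * r))"
    unfolding partial_x_def[of "partial_x (partial_x (R_fun z))"] by (rule vector_derivative_at[OF dR2])
  have dRt: "((\<lambda>t. R_fun z t x) has_vector_derivative - (1 / 3) * \<theta>) (at \<tau>)"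
  proof -
    have c: "isCont (\<lambda>t. T z 0 \<sigma> t x) \<tau>" if "cmod \<sigma> \<le> 1" for \<sigma>
      using T_derivs(3)[OF z \<tau> that] by (rule has_vector_derivative_continuous)
    have ev: "\<forall>\<^sub>F t in nhds \<tau>. T z 0 \<sigma> t x \<noteq> 0" if "cmod \<sigma> \<le> 1" "T z 0 \<sigma> \<tau> x \<noteq> 0" for \<sigma>
    proof (rule tendsto_imp_eventually_ne[OF _ that(2)])
      show "((\<lambda>t. T z 0 \<sigma> t x) \<longlongrightarrow> T z 0 \<sigma> \<tau> x) (nhds \<tau>)"
        using c[OF that(1)] unfolding isCont_def tendsto_nhds_iff by simp
    qed
    have "\<forall>\<^sub>F t in nhds \<tau>. T z 0 (- 1) t x \<noteq> 0" "\<forall>\<^sub>F t in nhds \<tau>. T z 0 1 t x \<noteq> 0"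
      by (rule ev[OF _ nz(1)[OF x]], simp) (rule ev[OF _ nz(2)[OF x]], simp)
    \<comment> \<open>The formula \<open>R\<close> is stated for positive times, so the
      neighbourhood of \<tau> is cut down to them.\<close>
    moreover have "\<forall>\<^sub>F t in nhds \<tau>. 0 < t" using eventually_nhds_in_open[of "{0<..}" \<tau>] \<tau> by simp
    ultimately have "\<forall>\<^sub>F t in nhds \<tau>. T z 0 (- 1) t x \<noteq> 0 \<and> T z 0 1 t x \<noteq> 0 \<and> 0 < t"
      by eventually_elim simp
    then obtain U where U: "open U" "\<tau> \<in> U" "\<And>t. t \<in> U \<Longrightarrow> T z 0 (- 1) t x \<noteq> 0 \<and> T z 0 1 t x \<noteq> 0 \<and> 0 < t"
      unfolding eventually_nhds by blast
    have "((\<lambda>t. rt z 1 (- 1) t x - rt z 1 1 t x) has_vector_derivative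
        1 / 3 * (rt13 z (- 1) \<tau> x - ?a 1 x * rt3 z (- 1) \<tau> x) - 1 / 3 * (rt13 z 1 \<tau> x - ?b 1 x * rt3 z 1 \<tau> x)) (at \<tau>)"
      by (intro has_vector_derivative_diff rt_derivs(3)[OF z \<tau>] nz[OF x]) simp_all
    then have "((\<lambda>t. rt z 1 (- 1) t x - rt z 1 1 t x) has_vector_derivative - (1 / 3) * \<theta>) (at \<tau>)"
      by (simp add: \<theta>_def algebra_simps)
    then show ?thesis
    proof (rule has_vector_derivative_transform_within_open[OF _ U(1,2)])
      fix t assume "t \<in> U"
      then have "0 < t" "T z 0 (- 1) t x \<noteq> 0" "T z 0 1 t x \<noteq> 0" using U(3) by blast+
      then show "rt z 1 (- 1) t x - rt z 1 1 t x = R_fun z t x" by (rule R[symmetric])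
    qed
  qed
  have pRt: "partial_\<tau> (R_fun z) \<tau> x = - (1 / 3) * \<theta>"
    unfolding partial_\<tau>_def by (rule vector_derivative_at[OF dRt])
  have mkdv: "3 * partial_\<tau> (R_fun z) \<tau> x + partial_x (partial_x (partial_x (R_fun z))) \<tau> x
           - 6 * (R_fun z \<tau> x)\<^sup>2 * partial_x (R_fun z) \<tau> x = 0"
    unfolding pRt pR2 pR[OF x] RS[OF x] r_def[symmetric]
    by (simp add: power2_eq_square algebra_simps)
  have dQ: "(Q_entry z \<tau> has_vector_derivative - (R_fun z \<tau> x)\<^sup>2) (at x)"
  proof (rule trans[OF _ x Q])
    have "((\<lambda>y. - ?a 1 y - ?b 1 y) has_vector_derivative
        - (?a 1 x * ?a 1 x - ?a 2 x) - (?b 1 x * ?b 1 x - ?b 2 x)) (at x)"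
      using has_vector_derivative_diff[OF has_vector_derivative_minus[OF da[OF x, of 1]] db[OF x, of 1]]
      by (simp only: two)
    moreover have "- (?a 1 x * ?a 1 x - ?a 2 x) - (?b 1 x * ?b 1 x - ?b 2 x) = - (R_fun z \<tau> x)\<^sup>2"
      unfolding RS[OF x] by (rule mkdv_elimination(2)[OF N(1,2)[OF x]])
    ultimately show "((\<lambda>y. - ?a 1 y - ?b 1 y) has_vector_derivative - (R_fun z \<tau> x)\<^sup>2) (at x)" by simp
  qed
  have log: "has_log_derivative (\<lambda>y. fredholm_det (S_minus z) (K_flat (y / 2) (\<tau> / 2)))
           (- (1 / 2) * R_fun z \<tau> x + (1 / 2) * Q_entry z \<tau> x) x"
  proof -
    have "fredholm_det (S_minus z) (K_flat (y / 2) (\<tau> / 2)) = T z 0 (- 1) \<tau> y" for y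
      unfolding fredholm_det_K_flat[OF z \<tau>] tasep_tau_def by simp
    moreover have "- (1 / 2) * R_fun z \<tau> x + (1 / 2) * Q_entry z \<tau> x = - T z (Suc 0) (- 1) \<tau> x / T z 0 (- 1) \<tau> x"
      unfolding RS[OF x] Q[OF x] by (simp add: rt_def algebra_simps)
    moreover have "has_log_derivative (T z 0 (- 1) \<tau>) (- T z (Suc 0) (- 1) \<tau> x / T z 0 (- 1) \<tau> x) x"
      by (intro has_log_derivativeI T_derivs(1)[OF z \<tau>] open_T_nonzero(2)[OF z \<tau>] nz(1)[OF x]) simp
    ultimately show ?thesis by simp
  qed
  have diff: "F differentiable at y" if "(F has_vector_derivative F') (at y)" for F :: "real \<Rightarrow> complex" and F' y
    using that by (rule differentiableI_vector)
  show ?thesis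
    using log mkdv diff[OF dRt] diff[OF dR[OF x]] diff[OF dR1[OF x]] diff[OF dR2] diff[OF dQ]
      vector_derivative_at[OF dQ]
    by (simp add: partial_x_def[of "Q_entry z"])
qed

end
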